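(* Let $\mathbf A,\mathbf B$ be $r\times s$ matrices with integer entries, with $i$-th columns $a_i,b_i\in\mathbb Z^r$ respectively, let $v\in\mathbb Z^r$ be a column vector, and let $\mathbf M=(\mathbf A\,|\,\mathbf B\,|\,v)$. For $m=(m_1,\dots,m_s),\,e=(e_1,\dots,e_s)\in\mathbb Z^s$ consider the sum $$I_{\mathbf M}(m,e)(q)=\sum_{k\in\mathbb Z^r} q^{\frac12 v\cdot k}\prod_{i=1}^s I_\Delta(m_i-b_i\cdot k,\; e_i+a_i\cdot k).$$ Then $I_{\mathbf M}(m,e)(q)$ converges in $\mathbb Z((q^{1/2}))$ for all $m,e\in\mathbb Z^s$ if and only if $\mathbf M$ supports an index structure. In that case, $I_{\mathbf M}$ is $q$-holonomic in the variables $(m,e)$.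
   Context: Tetrahedron index: for $m,e\in\mathbb Z$, $$I_\Delta(m,e)=\sum_{n=\max\{0,-e\}}^\infty (-1)^n\frac{q^{\frac12 n(n+1)-(n+\frac12 e)m}}{(q)_n(q)_{n+e}}\in\mathbb Z[[q^{1/2}]],\qquad (q)_n=\prod_{i=1}^n(1-q^i).$$ $\mathbb Z((q^{1/2}))$ is the ring of formal Laurent series in $q^{1/2}$ with integer coefficients. The degree of a series is the smallest exponent of $q$ occurring in it ($+\infty$ for $0$). A sum over a lattice converges in $\mathbb Z((q^{1/2}))$ if for every $N_0$ only finitely many summands have degree less than $N_0$. Index structure: $\mathbf M=(\mathbf A|\mathbf B|v)$ supports an index structure if the rank of the $r\times 2s$ matrix $(\mathbf A|\mathbf B)$ is $r$ and for every function $Q:\{1,\dots,s\}\to\{1,2,3\}$ there exists $(\alpha,\beta,\gamma)\in\mathbb Q^{s}\times\mathbb Q^s\times\mathbb Q^s$ with $$\mathbf A\alpha+\mathbf B\gamma=v,\qquad \alpha+\beta+\gamma=(1,\dots,1)^T,$$ such that for every $i=1,\dots,s$: $\alpha_i>0$ if $Q(i)=1$, $\beta_i>0$ if $Q(i)=2$, $\gamma_i>0$ if $Q(i)=3$. $q$-holonomic is meant in the standard sense of Zeilberger and Wilf--Zeilberger: for $f:\mathbb Z^n\to\mathbb Q((q^{1/2}))$ let $(M_jf)(x)=q^{x_j/2}f(x)$ and $(L_jf)(x)=f(x_1,\dots,x_j+1,\dots,x_n)$; $f$ is $q$-holonomic if the $\mathbb Q(q^{1/2})$-dimension of the span of all $M^{\alpha}L^{\beta}f$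 with $\alpha,\beta\in\mathbb N^n$, $|\alpha|+|\beta|\le N$, is $O(N^n)$ as $N\to\infty$. Here $n=2s$. *)

theory Defs
  imports
    "HOL-Analysis.Analysis"
    "HOL-Computational_Algebra.Formal_Laurent_Series"
    "HOL-Computational_Algebra.Polynomial_FPS"
    "HOL-Computational_Algebra.Polynomial_Factorial"
    "HOL-Computational_Algebra.Field_as_Ring"
    "HOL-Library.Function_Algebras"
    "HOL-Library.Landau_Symbols"
begin

unbundle Formal_Laurent_Series.fps_syntax

text \<open>
  Throughout, the formal variable \<open>X\<close> of power and Laurent series stands for \<open>q\<^sup>1\<^sup>/\<^sup>2\<close>. Thus
  \<open>\<int>[[q\<^sup>1\<^sup>/\<^sup>2]]\<close> is \<^typ>\<open>int fps\<close>, \<open>\<int>((q\<^sup>1\<^sup>/\<^sup>2))\<close> is \<^typ>\<open>int fls\<close>, \<open>\<rat>((q\<^sup>1\<^sup>/\<^sup>2))\<close> is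
  \<^typ>\<open>rat fls\<close>, \<open>\<rat>(q\<^sup>1\<^sup>/\<^sup>2)\<close> is \<^typ>\<open>rat poly fract\<close>, and \<open>q\<^sup>a\<close> for a half-integer \<open>a\<close> is
  \<open>fls_X_intpow (2 * a)\<close>.
\<close>

section \<open>Degree and convergence of sums of Laurent series\<close>

definition q_degree :: "int fls \<Rightarrow> ereal" where
  "q_degree f = (if f = 0 then \<infinity> else ereal (real_of_int (fls_subdegree f) / 2))"

definition laurent_sum_converges :: "('k \<Rightarrow> int fls) \<Rightarrow> 'k set \<Rightarrow> bool" where
  "laurent_sum_converges g K \<longleftrightarrow> (\<forall>N\<^sub>0::real. finite {k \<in> K. q_degree (g k) < ereal N\<^sub>0})"

text \<open>
  The value of a convergent sum is the library's \<^const>\<open>infsum\<close> for the \<open>X\<close>-adic metric on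
  \<^typ>\<open>int fls\<close>; each coefficient of it is a finite sum.
\<close>

lemma laurent_sum_converges_finite_nth:
  assumes "laurent_sum_converges g K"
  shows "finite {k \<in> K. \<exists>i\<le>n. g k $$ i \<noteq> 0}"
proof (rule finite_subset)
  show "finite {k \<in> K. q_degree (g k) < ereal (real_of_int n / 2 + 1)}"
    using assms unfolding laurent_sum_converges_def by blast
next
  show "{k \<in> K. \<exists>i\<le>n. g k $$ i \<noteq> 0} \<subseteq> {k \<in> K. q_degree (g k) < ereal (real_of_int n / 2 + 1)}"
  proof safe
    fix k i assume "i \<le> n" and nz: "g k $$ i \<noteq> 0"
    have "fls_subdegree (g k) \<le> i"
      using nz by (rule fls_subdegree_leI)
    with \<open>i \<le> n\<close> have "real_of_int (fls_subdegree (g k)) \<le> real_of_int n"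
      by linarith
    moreover have "g k \<noteq> 0" using nz by auto
    ultimately show "q_degree (g k) < ereal (real_of_int n / 2 + 1)"
      by (simp add: q_degree_def)
  qed
qed

lemma laurent_sum_converges_has_sum:
  assumes conv: "laurent_sum_converges g K"
  shows "\<exists>S. (g has_sum S) K \<and> (\<forall>n. S $$ n = (\<Sum>k | k \<in> K \<and> g k $$ n \<noteq> 0. g k $$ n))"
proof -
  define c where "c n = (\<Sum>k | k \<in> K \<and> g k $$ n \<noteq> 0. g k $$ n)" for n
  define F where "F n = {k \<in> K. \<exists>i\<le>n. g k $$ i \<noteq> 0}" for n
  have finF: "finite (F n)" for n
    unfolding F_def by (rule laurent_sum_converges_finite_nth[OF conv])
  have part: "(\<Sum>k\<in>Y. g k $$ i) = c i" if "finite Y" "F n \<subseteq> Y" "Y \<subseteq> K" "i \<le> n" for Y n i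
    unfolding c_def using that by (intro sum.mono_neutral_right) (auto simp: F_def)
  define b where "b = Min (insert 0 ((\<lambda>k. fls_subdegree (g k)) ` F 0))"
  have c0: "c n = 0" if "n < b" for n
  proof -
    have "b \<le> 0" unfolding b_def using finF by simp
    with that have "n \<le> 0" by linarith
    have "{k. k \<in> K \<and> g k $$ n \<noteq> 0} = {}"
    proof (rule ccontr)
      assume "{k. k \<in> K \<and> g k $$ n \<noteq> 0} \<noteq> {}"
      then obtain k where k: "k \<in> K" "g k $$ n \<noteq> 0" by auto
      with \<open>n \<le> 0\<close> have "k \<in> F 0" unfolding F_def by auto
      hence "b \<le> fls_subdegree (g k)" unfolding b_def using finF by (intro Min_le) auto
      also have "\<dots> \<le> n" using k by (intro fls_subdegree_leI)
      finally show False using that by simp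
    qed
    thus ?thesis unfolding c_def by (simp only: sum.empty)
  qed
  define S where "S = Abs_fls c"
  have Sn: "S $$ n = c n" for n
    unfolding S_def by (rule nth_Abs_fls_lower_bound[of b]) (use c0 in auto)
  have "(sum g \<longlongrightarrow> S) (finite_subsets_at_top K)"
  proof (rule tendstoI)
    fix e :: real assume "e > 0"
    then obtain n :: nat where n: "inverse (2 ^ n) < e"
      using real_arch_pow_inv[of e "1/2"] by (auto simp: power_divide field_simps)
    have "dist (sum g Y) S < e" if Y: "finite Y" "F (int n) \<subseteq> Y" "Y \<subseteq> K" for Y
    proof (cases "sum g Y = S")
      case True
      thus ?thesis using \<open>e > 0\<close> by simp
    next
      case False
      have nth: "(sum g Y - S) $$ i = 0" if "i \<le> int n" for i
      proof -
        have "(sum g Y) $$ i = (\<Sum>k\<in>Y. g k $$ i)"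
          using Y(1) by induction auto
        thus ?thesis using part[OF Y that] Sn by simp
      qed
      have "fls_subdegree (sum g Y - S) \<ge> int n"
        by (rule fls_subdegree_geI) (use False nth in auto)
      hence "nat (fls_subdegree (sum g Y - S)) \<ge> n" "\<not> fls_subdegree (sum g Y - S) < 0" by auto
      hence "dist (sum g Y) S \<le> inverse (2 ^ n)"
        using False by (simp add: dist_fls_def le_imp_inverse_le)
      thus ?thesis using n by simp
    qed
    thus "\<forall>\<^sub>F Y in finite_subsets_at_top K. dist (sum g Y) S < e"
      unfolding eventually_finite_subsets_at_top
      by (intro exI[of _ "F (int n)"]) (use finF in \<open>auto simp: F_def\<close>)
  qed
  hence "(g has_sum S) K" by (simp add: has_sum_def)
  thus ?thesis using Sn unfolding c_def by blast
qed

lemma laurent_infsum_nth: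
  assumes "laurent_sum_converges g K"
  shows "infsum g K $$ n = (\<Sum>k | k \<in> K \<and> g k $$ n \<noteq> 0. g k $$ n)"
  using laurent_sum_converges_has_sum[OF assms] infsumI by metis


section \<open>The tetrahedron index\<close>

definition q_poch :: "nat \<Rightarrow> int fps" where
  "q_poch n = (\<Prod>i=1..n. 1 - fps_X ^ (2 * i))"

text \<open>
  \<^typ>\<open>int\<close> has no \<^const>\<open>inverse\<close>, so division of integral power series is not available as an
  operation; the reciprocal of a series with constant coefficient \<open>1\<close> is
  \<open>fps_right_inverse f 1\<close>.
\<close>

lemma q_poch_nth_0 [simp]: "fps_nth (q_poch n) 0 = 1"
  by (induction n) (simp_all add: q_poch_def)

lemma q_poch_mult_right_inverse:
  "q_poch n * q_poch k * fps_right_inverse (q_poch n * q_poch k) 1 = 1"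
  by (rule fps_right_inverse) simp

definition tetra_term :: "int \<Rightarrow> int \<Rightarrow> nat \<Rightarrow> int fls" where
  "tetra_term m e n =
     (-1) ^ n * fls_X_intpow (int n * (int n + 1) - (2 * int n + e) * m)
       * fps_to_fls (fps_right_inverse (q_poch n * q_poch (nat (int n + e))) 1)"

lemma tetra_term_converges: "laurent_sum_converges (tetra_term m e) {nat (max 0 (- e))..}"
  unfolding laurent_sum_converges_def
proof
  fix N\<^sub>0 :: real
  define b where "b = 2 * \<bar>m\<bar> + \<bar>e * m\<bar> + 2 * \<lceil>\<bar>N\<^sub>0\<bar>\<rceil>"
  have "n < nat b" if less: "q_degree (tetra_term m e n) < ereal N\<^sub>0" for n
  proof (rule ccontr)
    assume "\<not> n < nat b"
    hence n: "int n \<ge> b" by linarith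
    define a where "a = int n * (int n + 1) - (2 * int n + e) * m"
    define h where "h = fps_to_fls (fps_right_inverse (q_poch n * q_poch (nat (int n + e))) 1)"
    have "tetra_term m e n = fls_X_intpow a * ((-1) ^ n * h)"
      by (simp only: tetra_term_def a_def h_def mult_ac)
    hence t: "tetra_term m e n = fls_shift (- a) ((-1) ^ n * h)"
      by (simp only: fls_X_intpow_times_conv_shift)
    have nz: "tetra_term m e n \<noteq> 0" using less by (auto simp: q_degree_def)
    have h0: "h $$ i = 0" if "i < 0" for i using that by (simp add: h_def)
    have "((-1) ^ n * h) $$ i = 0" if "i < 0" for i
      using h0[OF that] by (cases "even n") simp_all
    hence "tetra_term m e n $$ i = 0" if "i < a" for i
      unfolding t using that by simp
    hence "a \<le> fls_subdegree (tetra_term m e n)"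
      using nz by (intro fls_subdegree_geI) auto
    moreover have "real_of_int (fls_subdegree (tetra_term m e n)) < 2 * N\<^sub>0"
      using less nz by (simp add: q_degree_def)
    ultimately have "real_of_int a < 2 * N\<^sub>0" by linarith
    also have "\<dots> \<le> real_of_int (2 * \<lceil>\<bar>N\<^sub>0\<bar>\<rceil>)" by (simp, linarith)
    finally have "a < 2 * \<lceil>\<bar>N\<^sub>0\<bar>\<rceil>" by linarith
    moreover have "int n * (int n + 1 - 2 * m) \<ge> int n * 1"
    proof (rule mult_left_mono)
      have "\<lceil>\<bar>N\<^sub>0\<bar>\<rceil> \<ge> 0" by simp
      with n show "1 \<le> int n + 1 - 2 * m" unfolding b_def by linarith
    qed simp
    moreover have "a = int n * (int n + 1 - 2 * m) - e * m"
      by (simp add: a_def algebra_simps)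
    ultimately show False using n unfolding b_def by linarith
  qed
  hence "{n \<in> {nat (max 0 (- e))..}. q_degree (tetra_term m e n) < ereal N\<^sub>0} \<subseteq> {..<nat b}"
    by auto
  thus "finite {n \<in> {nat (max 0 (- e))..}. q_degree (tetra_term m e n) < ereal N\<^sub>0}"
    by (rule finite_subset) simp
qed

definition tetra_index :: "int \<Rightarrow> int \<Rightarrow> int fls" where
  "tetra_index m e = (\<Sum>\<^sub>\<infinity>n\<in>{nat (max 0 (- e))..}. tetra_term m e n)"


section \<open>The sum attached to \<open>(A | B | v)\<close>\<close>

definition int_dot :: "int^'n \<Rightarrow> int^'n \<Rightarrow> int" where
  "int_dot x y = (\<Sum>j\<in>UNIV. x $ j * y $ j)"

definition index_summand ::
  "int^'s^'r \<Rightarrow> int^'s^'r \<Rightarrow> int^'r \<Rightarrow> int^'s \<Rightarrow> int^'s \<Rightarrow> int^'r \<Rightarrow> int fls" where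
  "index_summand A B v m e k =
     fls_X_intpow (int_dot v k) *
     (\<Prod>i\<in>UNIV. tetra_index (m $ i - int_dot (column i B) k) (e $ i + int_dot (column i A) k))"

definition index_sum ::
  "int^'s^'r \<Rightarrow> int^'s^'r \<Rightarrow> int^'r \<Rightarrow> int^'s \<Rightarrow> int^'s \<Rightarrow> int fls" where
  "index_sum A B v m e = (\<Sum>\<^sub>\<infinity>k\<in>UNIV. index_summand A B v m e k)"

definition hconcat :: "'a^'m^'r \<Rightarrow> 'a^'n^'r \<Rightarrow> 'a^('m + 'n)^'r" where
  "hconcat A B = (\<chi> i j. case j of Inl c \<Rightarrow> A $ i $ c | Inr c \<Rightarrow> B $ i $ c)"

definition supports_index_structure :: "int^'s^'r \<Rightarrow> int^'s^'r \<Rightarrow> int^'r \<Rightarrow> bool" where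
  "supports_index_structure A B v \<longleftrightarrow>
     rank (map_matrix rat_of_int (hconcat A B)) = CARD('r) \<and>
     (\<forall>Q :: 's \<Rightarrow> nat. range Q \<subseteq> {1, 2, 3} \<longrightarrow>
       (\<exists>(\<alpha> :: rat^'s) (\<beta> :: rat^'s) (\<gamma> :: rat^'s).
          map_matrix rat_of_int A *v \<alpha> + map_matrix rat_of_int B *v \<gamma> = (\<chi> i. rat_of_int (v $ i)) \<and>
          \<alpha> + \<beta> + \<gamma> = (\<chi> i. 1) \<and>
          (\<forall>i. (Q i = 1 \<longrightarrow> \<alpha> $ i > 0) \<and> (Q i = 2 \<longrightarrow> \<beta> $ i > 0) \<and> (Q i = 3 \<longrightarrow> \<gamma> $ i > 0))))"


section \<open>\<open>q\<close>-holonomic functions\<close>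

text \<open>The embedding of \<open>\<rat>(q\<^sup>1\<^sup>/\<^sup>2)\<close> into \<open>\<rat>((q\<^sup>1\<^sup>/\<^sup>2))\<close> by expansion at \<open>0\<close>.\<close>

definition fls_of_fract :: "rat poly fract \<Rightarrow> rat fls" where
  "fls_of_fract c =
     (case quot_of_fract c of (a, b) \<Rightarrow> fps_to_fls (fps_of_poly a) / fps_to_fls (fps_of_poly b))"

lemma fls_of_fract_Fract:
  assumes "b \<noteq> 0"
  shows "fls_of_fract (Fract a b) = fps_to_fls (fps_of_poly a) / fps_to_fls (fps_of_poly b)"
proof -
  obtain c d where cd: "quot_of_fract (Fract a b) = (c, d)" by force
  have "d \<noteq> 0" using snd_quot_of_fract_nonzero[of "Fract a b"] cd by simp
  moreover have "Fract c d = Fract a b" using Fract_quot_of_fract[of "Fract a b"] cd by simp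
  ultimately have "c * b = a * d" using assms by (simp add: eq_fract)
  hence "fps_of_poly c * fps_of_poly b = fps_of_poly a * fps_of_poly d"
    by (metis fps_of_poly_mult)
  hence "fps_to_fls (fps_of_poly c) * fps_to_fls (fps_of_poly b)
       = fps_to_fls (fps_of_poly a) * fps_to_fls (fps_of_poly d)"
    by (metis fls_times_fps_to_fls)
  thus ?thesis using \<open>d \<noteq> 0\<close> assms cd by (simp add: fls_of_fract_def frac_eq_eq)
qed

lemma fls_of_fract_1: "fls_of_fract 1 = 1"
  by (simp add: One_fract_def fls_of_fract_Fract)

lemma fls_of_fract_add: "fls_of_fract (c + d) = fls_of_fract c + fls_of_fract d"
  by (cases c; cases d)
     (simp add: fls_of_fract_Fract fps_of_poly_add fps_of_poly_mult fls_times_fps_to_fls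
        fps_to_fls_plus add_frac_eq mult.commute)

lemma fls_of_fract_mult: "fls_of_fract (c * d) = fls_of_fract c * fls_of_fract d"
  by (cases c; cases d)
     (simp add: fls_of_fract_Fract fps_of_poly_mult fls_times_fps_to_fls)

definition q_scale :: "rat poly fract \<Rightarrow> ('a \<Rightarrow> rat fls) \<Rightarrow> 'a \<Rightarrow> rat fls" where
  "q_scale c f = (\<lambda>x. fls_of_fract c * f x)"

interpretation q_fun: vector_space "q_scale :: rat poly fract \<Rightarrow> ('a \<Rightarrow> rat fls) \<Rightarrow> 'a \<Rightarrow> rat fls"
  by standard
     (simp_all add: q_scale_def fun_eq_iff fls_of_fract_1 fls_of_fract_add fls_of_fract_mult
        algebra_simps)

definition op_M :: "'n \<Rightarrow> (int^'n \<Rightarrow> rat fls) \<Rightarrow> int^'n \<Rightarrow> rat fls" where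
  "op_M j f = (\<lambda>x. fls_X_intpow (x $ j) * f x)"

definition op_L :: "'n \<Rightarrow> (int^'n \<Rightarrow> rat fls) \<Rightarrow> int^'n \<Rightarrow> rat fls" where
  "op_L j f = (\<lambda>x. f (x + axis j 1))"

text \<open>
  \<open>op_monomial \<alpha> \<beta> f = M\<^sup>\<alpha> L\<^sup>\<beta> f\<close>, written in closed form because the products range over an
  unordered (finite) index type; the three lemmas below identify it with the iterated operators.
\<close>

definition op_monomial :: "nat^'n \<Rightarrow> nat^'n \<Rightarrow> (int^'n \<Rightarrow> rat fls) \<Rightarrow> int^'n \<Rightarrow> rat fls" where
  "op_monomial \<alpha> \<beta> f =
     (\<lambda>x. fls_X_intpow (\<Sum>j\<in>UNIV. int (\<alpha> $ j) * x $ j) * f (x + (\<chi> j. int (\<beta> $ j))))"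

lemma op_monomial_0: "op_monomial 0 0 f = f"
  by (simp add: op_monomial_def fun_eq_iff zero_vec_def[symmetric])

lemma op_monomial_L: "op_monomial 0 (\<beta> + axis j 1) f = op_L j (op_monomial 0 \<beta> f)"
proof -
  have "x + (\<chi> i. int ((\<beta> + axis j 1) $ i)) = x + axis j 1 + (\<chi> i. int (\<beta> $ i))" for x :: "int^'a"
    by (simp add: vec_eq_iff axis_def)
  thus ?thesis by (simp only: op_monomial_def op_L_def fun_eq_iff zero_index) simp
qed

lemma op_monomial_M: "op_monomial (\<alpha> + axis j 1) \<beta> f = op_M j (op_monomial \<alpha> \<beta> f)"
proof -
  have "(\<Sum>i\<in>UNIV. int ((\<alpha> + axis j 1) $ i) * x $ i) = x $ j + (\<Sum>i\<in>UNIV. int (\<alpha> $ i) * x $ i)"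
    for x :: "int^'a"
  proof -
    have "(\<Sum>i\<in>UNIV. int (axis j 1 $ i) * x $ i) = (\<Sum>i\<in>UNIV. if i = j then x $ i else 0)"
      by (intro sum.cong) (auto simp: axis_def)
    thus ?thesis by (simp add: algebra_simps sum.distrib)
  qed
  moreover have "(fls_X_intpow (a + b) :: rat fls) = fls_X_intpow a * fls_X_intpow b" for a b
    by (simp only: fls_X_intpow_times_fls_X_intpow)
  ultimately show ?thesis
    by (simp only: op_monomial_def op_M_def fun_eq_iff mult.assoc simp_thms)
qed

definition q_holonomic :: "(int^'n \<Rightarrow> rat fls) \<Rightarrow> bool" where
  "q_holonomic f \<longleftrightarrow>
     (\<lambda>N. real (q_fun.dim (q_fun.span
        {op_monomial \<alpha> \<beta> f |\<alpha> \<beta>. (\<Sum>j\<in>UNIV. \<alpha> $ j) + (\<Sum>j\<in>UNIV. \<beta> $ j) \<le> N})))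
     \<in> O(\<lambda>N. real N ^ CARD('n))"

text \<open>The inclusion of \<open>\<int>((q\<^sup>1\<^sup>/\<^sup>2))\<close> into \<open>\<rat>((q\<^sup>1\<^sup>/\<^sup>2))\<close>.\<close>

definition rat_fls_of_int_fls :: "int fls \<Rightarrow> rat fls" where
  "rat_fls_of_int_fls f = Abs_fls (\<lambda>n. rat_of_int (f $$ n))"

lemma rat_fls_of_int_fls_nth [simp]: "rat_fls_of_int_fls f $$ n = rat_of_int (f $$ n)"
  unfolding rat_fls_of_int_fls_def
  by (rule nth_Abs_fls_lower_bound[of "fls_subdegree f"]) simp

text \<open>
  \<open>\<int>\<^sup>s \<times> \<int>\<^sup>s\<close> is identified with \<open>\<int>\<^sup>2\<^sup>s\<close>: the coordinates \<open>Inl i\<close> are \<open>m\<^sub>i\<close>, the coordinates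
  \<open>Inr i\<close> are \<open>e\<^sub>i\<close>.
\<close>

definition index_function ::
  "int^'s^'r \<Rightarrow> int^'s^'r \<Rightarrow> int^'r \<Rightarrow> int^('s + 's) \<Rightarrow> rat fls" where
  "index_function A B v x =
     rat_fls_of_int_fls (index_sum A B v (\<chi> i. x $ Inl i) (\<chi> i. x $ Inr i))"

end

theory Submission
  imports Defs
begin

text \<open>
  Write \<open>X = q\<^sup>1\<^sup>/\<^sup>2\<close>, \<open>I\<close> for the tetrahedron index, \<open>a\<^sub>i, b\<^sub>i\<close> for the columns of \<open>A, B\<close>, and
  \<open>(y\<^sub>i, x\<^sub>i) = (m\<^sub>i - b\<^sub>i \<cdot> k, e\<^sub>i + a\<^sub>i \<cdot> k)\<close> for the arguments of the \<open>i\<close>-th factor of the summand at \<open>k\<close>.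

  \<^bold>\<open>Convergence.\<close> The defining series of \<open>I\<close> yields two first-order recurrences (\<open>tetra_index_rec_e\<close>,
  \<open>tetra_index_rec_m\<close>), and together with the first terms of the series they determine its exact degree
  (\<open>tetra_index_degree\<close>): the rays through \<open>(0, 1)\<close>, \<open>(-1, 0)\<close>, \<open>(1, -1)\<close> cut the \<open>(m, e)\<close>-plane into three
  cones, and in each cone twice the degree is the product of the two cone coordinates plus a linear
  form. Hence the degree of the summand at \<open>k\<close> is known exactly, and convergence says that only
  finitely many \<open>k\<close> stay below any given degree. The quadratic part is nonnegative and, away from the
  rays, dominates. So a family of \<open>k\<close> of bounded degree must keep each \<open>(y\<^sub>i, x\<^sub>i)\<close> near one of the three
  rays, and the function \<open>Q\<close> records which one. Adding \<open>v \<cdot> k = \<Sum>\<^sub>i (\<alpha>\<^sub>i a\<^sub>i \<cdot> k + \<gamma>\<^sub>i b\<^sub>i \<cdot> k)\<close> to the linear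
  part turns its coefficients along the three rays into \<open>\<alpha>\<^sub>i, \<gamma>\<^sub>i, \<beta>\<^sub>i\<close> (\<open>tetra_degree_lower\<close>), so positivity
  of the coefficient chosen by \<open>Q\<close> bounds all \<open>(y\<^sub>i, x\<^sub>i)\<close>, and the rank condition then bounds \<open>k\<close>.
  Conversely, if the linear system has no solution for some \<open>Q\<close>, then Farkas' lemma
  (\<open>strict_farkas\<close>) produces a lattice vector \<open>k \<noteq> 0\<close> such that along \<open>k, 2k, 3k, \<dots>\<close> all arguments
  stay on the rays named by \<open>Q\<close>, where the degree is linear, and that linear function is not positive;
  infinitely many summands then have degree at most \<open>0\<close>. A kernel vector of \<open>(A | B)\<close> is treated in the
  same way.

  \<^bold>\<open>Holonomicity.\<close> The recurrences express every shift of \<open>I\<close> through \<open>I(m, e)\<close> and \<open>I(m + 1, e)\<close> with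
  coefficients that are Laurent polynomials in \<open>X\<^sup>m\<close> and \<open>X\<^sup>e\<close>; there are no denominators and the exponents
  grow linearly with the shift (\<open>tetra_monomial_in_span\<close>). The monomials \<open>M\<^sup>\<alpha> L\<^sup>\<beta> I\<close> of size at most \<open>N\<close>
  thus span a space of dimension \<open>O(N\<^sup>2)\<close>. Regard the summand as a function of \<open>(k, m, e)\<close>. Its shifts and
  its products with powers of \<open>X\<close> in \<open>m\<close> and \<open>e\<close> span \<open>O(N\<^bsup>r + 2s\<^esup>)\<close> dimensions: \<open>N\<^sup>2\<close> for each of the \<open>s\<close>
  factors, and one further factor \<open>N\<^sup>r\<close> for the power of \<open>X\<close> in \<open>k\<close> that splits off
  (\<open>dim_summand_monomials\<close>). Each summation over one coordinate of \<open>k\<close> now lowers the exponent by one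
  (\<open>sum_out_growth\<close>). If \<open>L\<close> is the shift in that coordinate and \<open>S\<close> the summation, then \<open>S (L - 1) = 0\<close>, and
  \<open>L - 1\<close> is injective, because a convergent family that is constant along a line vanishes there. For the
  increasing spaces \<open>U\<^sub>N\<close> spanned by monomials of size \<open>N\<close> this gives
  \<open>dim S U\<^sub>N\<^sub>+\<^sub>1 + dim U\<^sub>N \<le> dim U\<^sub>N\<^sub>+\<^sub>1\<close>, and summing these inequalities from \<open>N\<close> to \<open>2N\<close> bounds \<open>N dim S U\<^sub>N\<close> by
  \<open>dim U\<^sub>2\<^sub>N\<^sub>+\<^sub>1\<close>. After \<open>r\<close> summations \<open>O(N\<^bsup>2s\<^esup>)\<close> remains, which is holonomicity. This argument replaces the
  general theory of holonomic modules and Bernstein's inequality.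
\<close>

section \<open>Adic sums of Laurent series\<close>

text \<open>
  The same series as \<open>fls_X_intpow\<close>, but as a constant: the simplifier would otherwise unfold
  exponent arithmetic into shifts of \<open>1\<close>.
\<close>

definition Xpow :: "int \<Rightarrow> 'a::comm_ring_1 fls" where
  "Xpow a = fls_X_intpow a"

lemma Xpow_0 [simp]: "Xpow 0 = 1"
  by (simp add: Xpow_def)

lemma Xpow_mult: "Xpow a * Xpow b = Xpow (a + b)"
  unfolding Xpow_def by (rule fls_X_intpow_times_fls_X_intpow)

lemma Xpow_mult_left: "Xpow a * (Xpow b * f) = Xpow (a + b) * f"
  by (simp only: mult.assoc [symmetric] Xpow_mult)

lemma Xpow_times_nth [simp]: "(Xpow a * f) $$ n = f $$ (n - a)"
  by (simp add: Xpow_def fls_X_intpow_times_conv_shift)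

lemma Xpow_nonzero [simp]: "(Xpow a :: 'a::comm_ring_1 fls) \<noteq> 0"
  by (simp add: Xpow_def)

lemma Xpow_prod: "(\<Prod>i\<in>A. Xpow (f i)) = (Xpow (\<Sum>i\<in>A. f i) :: 'a::comm_ring_1 fls)"
  by (induction A rule: infinite_finite_induct) (simp_all add: Xpow_mult)

lemma fls_sum_nth: "sum g Y $$ i = (\<Sum>k\<in>Y. g k $$ i)"
  by (induction Y rule: infinite_finite_induct) auto

text \<open>
  Multiplication by a fixed series is continuous for the \<open>X\<close>-adic topology.
\<close>

lemma fls_times_nth_cong:
  fixes c f g :: "'a::comm_ring_1 fls"
  assumes "\<forall>i\<le>n. f $$ i = g $$ i" "j \<le> n + fls_subdegree c"
  shows "(c * f) $$ j = (c * g) $$ j"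
proof (cases "f = g")
  case False
  have "n + 1 \<le> fls_subdegree (f - g)"
    by (rule fls_subdegree_geI) (use False assms(1) in auto)
  hence "(c * (f - g)) $$ j = 0"
    using assms(2) by (intro fls_times_nth_eq0) auto
  thus ?thesis by (simp add: right_diff_distrib)
qed simp

text \<open>
  Unconditional summability in the \<open>X\<close>-adic topology, spelled out coefficientwise. It makes sense over
  every coefficient ring, so the same rules serve integral and rational series.
\<close>

definition adic_sums :: "('k \<Rightarrow> 'a::comm_ring_1 fls) \<Rightarrow> 'k set \<Rightarrow> 'a fls \<Rightarrow> bool" where
  "adic_sums g K S \<longleftrightarrow> (\<forall>n. \<exists>F. finite F \<and> F \<subseteq> K \<and>
     (\<forall>Y. finite Y \<longrightarrow> F \<subseteq> Y \<longrightarrow> Y \<subseteq> K \<longrightarrow> (\<forall>i\<le>n. sum g Y $$ i = S $$ i)))"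

lemma adic_sumsE:
  assumes "adic_sums g K S"
  obtains F where "finite F" "F \<subseteq> K"
    "\<And>Y i. finite Y \<Longrightarrow> F \<subseteq> Y \<Longrightarrow> Y \<subseteq> K \<Longrightarrow> i \<le> n \<Longrightarrow> sum g Y $$ i = S $$ i"
  using assms unfolding adic_sums_def by meson

lemma adic_sumsI:
  assumes "\<And>n. \<exists>F. finite F \<and> F \<subseteq> K \<and>
     (\<forall>Y. finite Y \<longrightarrow> F \<subseteq> Y \<longrightarrow> Y \<subseteq> K \<longrightarrow> (\<forall>i\<le>n. sum g Y $$ i = S $$ i))"
  shows "adic_sums g K S"
  using assms unfolding adic_sums_def by blast

lemma adic_sums_unique:
  assumes "adic_sums g K S" "adic_sums g K T"
  shows "S = T"
proof (rule fls_eqI)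
  fix n
  obtain F where F: "finite F" "F \<subseteq> K"
    "\<And>Y i. finite Y \<Longrightarrow> F \<subseteq> Y \<Longrightarrow> Y \<subseteq> K \<Longrightarrow> i \<le> n \<Longrightarrow> sum g Y $$ i = S $$ i"
    by (rule adic_sumsE[OF assms(1), of n]) blast
  obtain G where G: "finite G" "G \<subseteq> K"
    "\<And>Y i. finite Y \<Longrightarrow> G \<subseteq> Y \<Longrightarrow> Y \<subseteq> K \<Longrightarrow> i \<le> n \<Longrightarrow> sum g Y $$ i = T $$ i"
    by (rule adic_sumsE[OF assms(2), of n]) blast
  have "sum g (F \<union> G) $$ n = S $$ n" using F G by (intro F(3)) auto
  moreover have "sum g (F \<union> G) $$ n = T $$ n" using F G by (intro G(3)) auto
  ultimately show "S $$ n = T $$ n" by simp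
qed

lemma adic_sums_finite:
  assumes "finite K" shows "adic_sums g K (sum g K)"
  by (rule adic_sumsI) (use assms in \<open>auto intro!: exI[of _ K] dest: subset_antisym\<close>)

lemma adic_sums_cong: "(\<And>k. k \<in> K \<Longrightarrow> g k = h k) \<Longrightarrow> adic_sums g K S \<longleftrightarrow> adic_sums h K S"
proof -
  assume eq: "\<And>k. k \<in> K \<Longrightarrow> g k = h k"
  have "sum g Y = sum h Y" if "Y \<subseteq> K" for Y
    using that eq by (intro sum.cong) auto
  thus ?thesis unfolding adic_sums_def by (simp cong: conj_cong imp_cong)
qed

lemma adic_sums_add:
  assumes "adic_sums g K S" "adic_sums h K T"
  shows "adic_sums (\<lambda>k. g k + h k) K (S + T)"
proof (rule adic_sumsI)
  fix n
  obtain F where F: "finite F" "F \<subseteq> K"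
    "\<And>Y i. finite Y \<Longrightarrow> F \<subseteq> Y \<Longrightarrow> Y \<subseteq> K \<Longrightarrow> i \<le> n \<Longrightarrow> sum g Y $$ i = S $$ i"
    by (rule adic_sumsE[OF assms(1), of n]) blast
  obtain G where G: "finite G" "G \<subseteq> K"
    "\<And>Y i. finite Y \<Longrightarrow> G \<subseteq> Y \<Longrightarrow> Y \<subseteq> K \<Longrightarrow> i \<le> n \<Longrightarrow> sum h Y $$ i = T $$ i"
    by (rule adic_sumsE[OF assms(2), of n]) blast
  show "\<exists>F. finite F \<and> F \<subseteq> K \<and> (\<forall>Y. finite Y \<longrightarrow> F \<subseteq> Y \<longrightarrow> Y \<subseteq> K \<longrightarrow>
          (\<forall>i\<le>n. (\<Sum>k\<in>Y. g k + h k) $$ i = (S + T) $$ i))"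
    by (rule exI[of _ "F \<union> G"]) (use F G in \<open>auto simp: sum.distrib\<close>)
qed

lemma adic_sums_cmult:
  assumes "adic_sums g K S"
  shows "adic_sums (\<lambda>k. c * g k) K (c * S)"
proof (rule adic_sumsI)
  fix n
  obtain F where F: "finite F" "F \<subseteq> K"
    "\<And>Y i. finite Y \<Longrightarrow> F \<subseteq> Y \<Longrightarrow> Y \<subseteq> K \<Longrightarrow> i \<le> n - fls_subdegree c \<Longrightarrow> sum g Y $$ i = S $$ i"
    by (rule adic_sumsE[OF assms, of "n - fls_subdegree c"]) blast
  show "\<exists>F. finite F \<and> F \<subseteq> K \<and> (\<forall>Y. finite Y \<longrightarrow> F \<subseteq> Y \<longrightarrow> Y \<subseteq> K \<longrightarrow>
          (\<forall>i\<le>n. (\<Sum>k\<in>Y. c * g k) $$ i = (c * S) $$ i))"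
    using F by (intro exI[of _ F])
      (auto simp: sum_distrib_left[symmetric] intro!: fls_times_nth_cong[where n = "n - fls_subdegree c"])
qed

lemma adic_sums_diff:
  assumes "adic_sums g K S" "adic_sums h K T"
  shows "adic_sums (\<lambda>k. g k - h k) K (S - T)"
  using adic_sums_add[OF assms(1) adic_sums_cmult[OF assms(2), of "-1"]] by simp

lemma adic_sums_reindex:
  assumes "bij_betw f A B" "adic_sums g B S"
  shows "adic_sums (\<lambda>a. g (f a)) A S"
proof (rule adic_sumsI)
  fix n
  obtain F where F: "finite F" "F \<subseteq> B"
    "\<And>Y i. finite Y \<Longrightarrow> F \<subseteq> Y \<Longrightarrow> Y \<subseteq> B \<Longrightarrow> i \<le> n \<Longrightarrow> sum g Y $$ i = S $$ i"
    by (rule adic_sumsE[OF assms(2), of n]) blast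
  have inj: "inj_on f A" and im: "f ` A = B" using assms(1) by (auto simp: bij_betw_def)
  have "sum (\<lambda>a. g (f a)) Y $$ i = S $$ i"
    if "finite Y" "inv_into A f ` F \<subseteq> Y" "Y \<subseteq> A" "i \<le> n" for Y i
  proof -
    have "F \<subseteq> f ` Y"
    proof
      fix b assume "b \<in> F"
      hence "b = f (inv_into A f b)" using F im by (auto simp: f_inv_into_f)
      thus "b \<in> f ` Y" using that \<open>b \<in> F\<close> by blast
    qed
    hence "sum g (f ` Y) $$ i = S $$ i" using that im by (intro F(3)) auto
    moreover have "sum g (f ` Y) = sum (\<lambda>a. g (f a)) Y"
      using inj_on_subset[OF inj that(3)] by (simp add: sum.reindex)
    ultimately show ?thesis by simp
  qed
  moreover have "inv_into A f ` F \<subseteq> A" using F im by (auto intro!: inv_into_into)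
  ultimately show "\<exists>F. finite F \<and> F \<subseteq> A \<and> (\<forall>Y. finite Y \<longrightarrow> F \<subseteq> Y \<longrightarrow> Y \<subseteq> A \<longrightarrow>
          (\<forall>i\<le>n. (\<Sum>k\<in>Y. g (f k)) $$ i = S $$ i))"
    using F(1) by (intro exI[of _ "inv_into A f ` F"]) auto
qed

lemma adic_sums_mono_neutral:
  assumes "adic_sums g K S" "K \<subseteq> L" "\<And>k. k \<in> L - K \<Longrightarrow> g k = 0"
  shows "adic_sums g L S"
proof (rule adic_sumsI)
  fix n
  obtain F where F: "finite F" "F \<subseteq> K"
    "\<And>Y i. finite Y \<Longrightarrow> F \<subseteq> Y \<Longrightarrow> Y \<subseteq> K \<Longrightarrow> i \<le> n \<Longrightarrow> sum g Y $$ i = S $$ i"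
    by (rule adic_sumsE[OF assms(1), of n]) blast
  have "sum g Y = sum g (Y \<inter> K)" if "finite Y" "Y \<subseteq> L" for Y
    using that assms(3) by (intro sum.mono_neutral_right) auto
  thus "\<exists>F. finite F \<and> F \<subseteq> L \<and> (\<forall>Y. finite Y \<longrightarrow> F \<subseteq> Y \<longrightarrow> Y \<subseteq> L \<longrightarrow>
          (\<forall>i\<le>n. (\<Sum>k\<in>Y. g k) $$ i = S $$ i))"
    using F(1,2) assms(2) by (intro exI[of _ F]) (auto intro!: F(3))
qed

text \<open>
  Iterated summation. Up to order \<open>n\<close> every series in sight is a finite sum, and one finite rectangle
  that is large enough works for all of them simultaneously.
\<close>

lemma adic_sums_Times:
  assumes "adic_sums (\<lambda>(a, b). g a b) (A \<times> B) S" "\<And>a. a \<in> A \<Longrightarrow> adic_sums (g a) B (h a)"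
  shows "adic_sums h A S"
proof (rule adic_sumsI)
  fix n
  obtain F where F: "finite F" "F \<subseteq> A \<times> B"
    "\<And>Y i. finite Y \<Longrightarrow> F \<subseteq> Y \<Longrightarrow> Y \<subseteq> A \<times> B \<Longrightarrow> i \<le> n \<Longrightarrow>
       sum (\<lambda>(a, b). g a b) Y $$ i = S $$ i"
    by (rule adic_sumsE[OF assms(1), of n]) blast
  have "sum h Z $$ i = S $$ i" if Z: "finite Z" "fst ` F \<subseteq> Z" "Z \<subseteq> A" and i: "i \<le> n" for Z i
  proof -
    have "\<exists>G. finite G \<and> G \<subseteq> B \<and> (\<forall>Y. finite Y \<longrightarrow> G \<subseteq> Y \<longrightarrow> Y \<subseteq> B \<longrightarrow> sum (g a) Y $$ i = h a $$ i)"
      if "a \<in> Z" for a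
    proof -
      have "adic_sums (g a) B (h a)" using that Z assms(2) by blast
      then obtain G where "finite G" "G \<subseteq> B"
        "\<And>Y j. finite Y \<Longrightarrow> G \<subseteq> Y \<Longrightarrow> Y \<subseteq> B \<Longrightarrow> j \<le> i \<Longrightarrow> sum (g a) Y $$ j = h a $$ j"
        by (rule adic_sumsE[where n = i]) blast
      thus ?thesis by (intro exI[of _ G]) simp
    qed
    then obtain G where G: "\<And>a. a \<in> Z \<Longrightarrow> finite (G a)" "\<And>a. a \<in> Z \<Longrightarrow> G a \<subseteq> B"
      "\<And>a Y. a \<in> Z \<Longrightarrow> finite Y \<Longrightarrow> G a \<subseteq> Y \<Longrightarrow> Y \<subseteq> B \<Longrightarrow> sum (g a) Y $$ i = h a $$ i"
      by metis
    \<comment> \<open>One finite set of second coordinates that is large enough for all rows over \<open>Z\<close> at once.\<close>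
    define W where "W = snd ` F \<union> (\<Union>a\<in>Z. G a)"
    have W: "finite W" "W \<subseteq> B" unfolding W_def using G F Z by auto
    have "sum h Z $$ i = (\<Sum>a\<in>Z. sum (g a) W $$ i)"
      unfolding fls_sum_nth[of h] by (intro sum.cong refl G(3)[symmetric]) (use W in \<open>auto simp: W_def\<close>)
    also have "\<dots> = sum (\<lambda>(a, b). g a b) (Z \<times> W) $$ i"
      by (simp add: fls_sum_nth sum.cartesian_product case_prod_unfold)
    also have "\<dots> = S $$ i"
    proof (rule F(3)[OF _ _ _ i])
      show "F \<subseteq> Z \<times> W" using that unfolding W_def by force
    qed (use W Z in auto)
    finally show ?thesis .
  qed
  moreover have "fst ` F \<subseteq> A" using F by auto
  ultimately show "\<exists>F. finite F \<and> F \<subseteq> A \<and> (\<forall>Y. finite Y \<longrightarrow> F \<subseteq> Y \<longrightarrow> Y \<subseteq> A \<longrightarrow>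
          (\<forall>i\<le>n. (\<Sum>k\<in>Y. h k) $$ i = S $$ i))"
    using F(1) by (intro exI[of _ "fst ` F"]) auto
qed

definition locally_finite :: "('k \<Rightarrow> 'a::comm_ring_1 fls) \<Rightarrow> 'k set \<Rightarrow> bool" where
  "locally_finite g K \<longleftrightarrow> (\<forall>n. finite {k \<in> K. \<exists>i\<le>n. g k $$ i \<noteq> 0})"

text \<open>
  Adjoining a single index outside a sufficiently large finite set leaves the low coefficients of the
  sum unchanged, so the new term has no low coefficients.
\<close>

lemma adic_sums_imp_locally_finite:
  assumes "adic_sums g K S"
  shows "locally_finite g K"
  unfolding locally_finite_def
proof
  fix n
  obtain F where F: "finite F" "F \<subseteq> K"
    "\<And>Y i. finite Y \<Longrightarrow> F \<subseteq> Y \<Longrightarrow> Y \<subseteq> K \<Longrightarrow> i \<le> n \<Longrightarrow> sum g Y $$ i = S $$ i"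
    by (rule adic_sumsE[OF assms(1), of n]) blast
  have "g k $$ i = 0" if "k \<in> K" "k \<notin> F" "i \<le> n" for k i
    using F(3)[of F i] F(3)[of "insert k F" i] F(1,2) that by auto
  hence "{k \<in> K. \<exists>i\<le>n. g k $$ i \<noteq> 0} \<subseteq> F" by auto
  thus "finite {k \<in> K. \<exists>i\<le>n. g k $$ i \<noteq> 0}" using F(1) finite_subset by blast
qed

lemma locally_finite_adic_sumsI:
  assumes "locally_finite g K" "\<And>n. S $$ n = (\<Sum>k | k \<in> K \<and> g k $$ n \<noteq> 0. g k $$ n)"
  shows "adic_sums g K S"
proof (rule adic_sumsI)
  fix n
  have "sum g Y $$ i = S $$ i"
    if "finite Y" "{k \<in> K. \<exists>i\<le>n. g k $$ i \<noteq> 0} \<subseteq> Y" "Y \<subseteq> K" "i \<le> n" for Y i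
    unfolding assms(2) fls_sum_nth using that by (intro sum.mono_neutral_right) auto
  thus "\<exists>F. finite F \<and> F \<subseteq> K \<and> (\<forall>Y. finite Y \<longrightarrow> F \<subseteq> Y \<longrightarrow> Y \<subseteq> K \<longrightarrow>
          (\<forall>i\<le>n. sum g Y $$ i = S $$ i))"
    using assms(1) unfolding locally_finite_def
    by (intro exI[of _ "{k \<in> K. \<exists>i\<le>n. g k $$ i \<noteq> 0}"]) auto
qed

lemma locally_finite_imp_adic_sums:
  assumes "locally_finite g K"
  shows "\<exists>S. adic_sums g K S"
proof -
  define c where "c n = (\<Sum>k | k \<in> K \<and> g k $$ n \<noteq> 0. g k $$ n)" for n
  define Z where "Z = {k \<in> K. \<exists>i\<le>0. g k $$ i \<noteq> 0}"
  have finZ: "finite Z" using assms by (simp add: Z_def locally_finite_def)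
  \<comment> \<open>A common lower bound for all exponents: only the finitely many members of \<open>Z\<close> reach below \<open>1\<close>.\<close>
  define b where "b = Min (insert 0 ((\<lambda>k. fls_subdegree (g k)) ` Z))"
  have "c n = 0" if "n < b" for n
  proof -
    have "b \<le> 0" unfolding b_def using finZ by simp
    have "g k $$ n = 0" if "k \<in> K" for k
    proof (rule ccontr)
      assume nz: "g k $$ n \<noteq> 0"
      hence "k \<in> Z" using \<open>n < b\<close> \<open>b \<le> 0\<close> that by (auto simp: Z_def intro!: exI[of _ n])
      hence "b \<le> fls_subdegree (g k)" unfolding b_def using finZ by (intro Min_le) auto
      also have "\<dots> \<le> n" using nz by (intro fls_subdegree_leI)
      finally show False using \<open>n < b\<close> by simp
    qed
    thus ?thesis unfolding c_def by (intro sum.neutral) auto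
  qed
  hence "Abs_fls c $$ n = c n" for n by (intro nth_Abs_fls_lower_bound[of b]) auto
  thus ?thesis using locally_finite_adic_sumsI[OF assms, of "Abs_fls c"] by (auto simp: c_def)
qed

lemma locally_finite_iff_adic_sums: "locally_finite g K \<longleftrightarrow> (\<exists>S. adic_sums g K S)"
  using adic_sums_imp_locally_finite locally_finite_imp_adic_sums by blast

lemma locally_finite_subset: "locally_finite g K \<Longrightarrow> L \<subseteq> K \<Longrightarrow> locally_finite g L"
  unfolding locally_finite_def
proof
  fix n assume "\<forall>n. finite {k \<in> K. \<exists>i\<le>n. g k $$ i \<noteq> 0}" and sub: "L \<subseteq> K"
  hence "finite {k \<in> K. \<exists>i\<le>n. g k $$ i \<noteq> 0}" by blast
  thus "finite {k \<in> L. \<exists>i\<le>n. g k $$ i \<noteq> 0}"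
    by (rule finite_subset[rotated]) (use sub in blast)
qed

lemma laurent_sum_converges_iff_locally_finite:
  "laurent_sum_converges g K \<longleftrightarrow> locally_finite g K"
proof
  assume "laurent_sum_converges g K"
  thus "locally_finite g K" unfolding locally_finite_def using laurent_sum_converges_finite_nth by blast
next
  assume lf: "locally_finite g K"
  show "laurent_sum_converges g K"
    unfolding laurent_sum_converges_def
  proof
    fix N :: real
    have "\<exists>i\<le>\<lceil>2 * N\<rceil>. g k $$ i \<noteq> 0" if "q_degree (g k) < ereal N" for k
    proof -
      have "g k \<noteq> 0" using that by (auto simp: q_degree_def)
      moreover have "real_of_int (fls_subdegree (g k)) < 2 * N"
        using that \<open>g k \<noteq> 0\<close> by (simp add: q_degree_def)
      hence "fls_subdegree (g k) \<le> \<lceil>2 * N\<rceil>" by linarith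
      ultimately show ?thesis using nth_fls_subdegree_nonzero by blast
    qed
    hence "{k \<in> K. q_degree (g k) < ereal N} \<subseteq> {k \<in> K. \<exists>i\<le>\<lceil>2 * N\<rceil>. g k $$ i \<noteq> 0}" by blast
    thus "finite {k \<in> K. q_degree (g k) < ereal N}"
      using lf finite_subset unfolding locally_finite_def by blast
  qed
qed

lemma adic_sums_infsum:
  fixes g :: "'k \<Rightarrow> int fls"
  assumes "locally_finite g K"
  shows "adic_sums g K (infsum g K)"
proof (rule locally_finite_adic_sumsI[OF assms])
  have "laurent_sum_converges g K" using assms by (simp add: laurent_sum_converges_iff_locally_finite)
  thus "infsum g K $$ n = (\<Sum>k | k \<in> K \<and> g k $$ n \<noteq> 0. g k $$ n)" for n
    by (rule laurent_infsum_nth)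
qed

section \<open>Recurrences of the tetrahedron index\<close>

text \<open>
  \<open>1 / (q)\<^sub>k\<close> for \<open>k \<ge> 0\<close>. The convention \<open>1 / (q)\<^sub>k = 0\<close> for \<open>k < 0\<close> is the one for which
  \<open>(1 - q\<^sup>k) / (q)\<^sub>k = 1 / (q)\<^sub>k\<^sub>-\<^sub>1\<close> holds for all integers, and it lets the series of the tetrahedron
  index run over all \<open>n\<close> independently of \<open>e\<close>.
\<close>

definition inv_q_poch :: "int \<Rightarrow> int fls" where
  "inv_q_poch k = (if k < 0 then 0 else fps_to_fls (fps_right_inverse (q_poch (nat k)) 1))"

lemma inv_q_poch_neg [simp]: "k < 0 \<Longrightarrow> inv_q_poch k = 0"
  by (simp add: inv_q_poch_def)

lemma q_poch_times_inv_q_poch: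
  "fps_to_fls (q_poch n) * inv_q_poch (int n) = 1"
proof -
  have "q_poch n * fps_right_inverse (q_poch n) 1 = 1"
    by (rule fps_right_inverse) simp
  thus ?thesis by (simp add: inv_q_poch_def flip: fls_times_fps_to_fls)
qed

lemma inv_q_poch_mult:
  "fps_to_fls (fps_right_inverse (q_poch a * q_poch b) 1) = inv_q_poch (int a) * inv_q_poch (int b)"
proof -
  define r where "r = fps_to_fls (fps_right_inverse (q_poch a * q_poch b) 1)"
  define A where "A = fps_to_fls (q_poch a)"
  define B where "B = fps_to_fls (q_poch b)"
  have 1: "(A * B) * r = 1"
    unfolding A_def B_def r_def by (simp add: q_poch_mult_right_inverse flip: fls_times_fps_to_fls)
  have 2: "A * inv_q_poch (int a) = 1" "B * inv_q_poch (int b) = 1"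
    unfolding A_def B_def by (rule q_poch_times_inv_q_poch)+
  have "r = r * ((A * inv_q_poch (int a)) * (B * inv_q_poch (int b)))" using 2 by simp
  also have "\<dots> = ((A * B) * r) * (inv_q_poch (int a) * inv_q_poch (int b))" by (simp only: mult_ac)
  also have "\<dots> = inv_q_poch (int a) * inv_q_poch (int b)" unfolding 1 by simp
  finally show ?thesis by (simp only: r_def)
qed

lemma fps_to_fls_X_power: "fps_to_fls (fps_X ^ k) = (Xpow (int k) :: 'a::comm_ring_1 fls)"
  by (rule fls_eqI) (auto simp: Xpow_def nat_eq_iff)

lemma inv_q_poch_rec: "(1 - Xpow (2 * k)) * inv_q_poch k = inv_q_poch (k - 1)"
proof (cases "k \<le> 0")
  case True
  thus ?thesis by (cases "k = 0") auto
next
  case False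
  then obtain n where k: "k = int (Suc n)"
    by (metis gr0_implies_Suc not_le of_nat_0_less_iff zero_less_imp_eq_int)
  define P where "P = fps_to_fls (q_poch n)"
  have "q_poch (Suc n) = q_poch n * (1 - fps_X ^ (2 * Suc n))"
    by (simp add: q_poch_def)
  hence S: "fps_to_fls (q_poch (Suc n)) = P * (1 - Xpow (2 * k))"
    by (simp only: fls_times_fps_to_fls fps_to_fls_minus fps_one_to_fls fps_to_fls_X_power P_def k)
       simp
  have 1: "P * (1 - Xpow (2 * k)) * inv_q_poch k = 1"
    using q_poch_times_inv_q_poch[of "Suc n"] by (simp only: S k)
  have 2: "P * inv_q_poch (k - 1) = 1" using q_poch_times_inv_q_poch[of n] by (simp add: P_def k)
  have "inv_q_poch (k - 1) = (P * (1 - Xpow (2 * k)) * inv_q_poch k) * inv_q_poch (k - 1)" using 1 by simp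
  also have "\<dots> = (P * inv_q_poch (k - 1)) * ((1 - Xpow (2 * k)) * inv_q_poch k)" by (simp only: mult_ac)
  finally show ?thesis using 2 by simp
qed

lemma inv_q_poch_mult_nth_neg: "i < 0 \<Longrightarrow> (inv_q_poch k * inv_q_poch l) $$ i = 0"
  by (auto simp: inv_q_poch_def simp flip: fls_times_fps_to_fls)

lemma inv_q_poch_mult_nth_0: "k \<ge> 0 \<Longrightarrow> l \<ge> 0 \<Longrightarrow> (inv_q_poch k * inv_q_poch l) $$ 0 = 1"
  by (auto simp: inv_q_poch_def simp flip: fls_times_fps_to_fls)

definition term_exponent :: "int \<Rightarrow> int \<Rightarrow> nat \<Rightarrow> int" where
  "term_exponent m e n = int n * (int n + 1) - (2 * int n + e) * m"

text \<open>
  The summand of the tetrahedron index, extended by \<open>0\<close> to those \<open>n\<close> with \<open>n + e < 0\<close>.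
\<close>

definition ext_term :: "int \<Rightarrow> int \<Rightarrow> nat \<Rightarrow> int fls" where
  "ext_term m e n = (-1) ^ n * (Xpow (term_exponent m e n) * (inv_q_poch (int n) * inv_q_poch (int n + e)))"

lemma ext_term_nth: "ext_term m e n $$ i = (-1) ^ n * (inv_q_poch (int n) * inv_q_poch (int n + e)) $$ (i - term_exponent m e n)"
  by (cases "even n") (simp_all add: ext_term_def)

lemma ext_term_eq_tetra_term:
  assumes "int n + e \<ge> 0"
  shows "ext_term m e n = tetra_term m e n"
  using assms inv_q_poch_mult[of n "nat (int n + e)"]
  by (simp add: ext_term_def tetra_term_def term_exponent_def Xpow_def algebra_simps)

lemma adic_sums_ext_term: "adic_sums (ext_term m e) UNIV (tetra_index m e)"
proof (rule adic_sums_mono_neutral)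
  let ?K = "{nat (max 0 (- e))..}"
  have "adic_sums (tetra_term m e) ?K (tetra_index m e)"
    unfolding tetra_index_def
    by (intro adic_sums_infsum) (simp add: tetra_term_converges flip: laurent_sum_converges_iff_locally_finite)
  moreover have "ext_term m e n = tetra_term m e n" if "n \<in> ?K" for n
    using that by (intro ext_term_eq_tetra_term) auto
  ultimately show "adic_sums (ext_term m e) ?K (tetra_index m e)" using adic_sums_cong by metis
qed (auto simp: ext_term_def)

text \<open>
  The recurrence holds term by term: after the common factors are removed it says
  \<open>1 / (q)\<^sub>n\<^sub>+\<^sub>e = 1 / (q)\<^sub>n\<^sub>+\<^sub>e\<^sub>-\<^sub>1 + q\<^sup>n\<^sup>+\<^sup>e / (q)\<^sub>n\<^sub>+\<^sub>e\<close>.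
\<close>

lemma tetra_index_rec_e:
  "tetra_index m e = Xpow (- m) * tetra_index m (e - 1) + Xpow e * tetra_index (m - 1) e"
proof -
  have "ext_term m e n = Xpow (- m) * ext_term m (e - 1) n + Xpow e * ext_term (m - 1) e n" for n
  proof -
    define k where "k = int n + e"
    have k: "int n + (e - 1) = k - 1" "int n + e = k" by (simp_all add: k_def)
    have x1: "- m + term_exponent m (e - 1) n = term_exponent m e n"
      by (simp add: term_exponent_def algebra_simps)
    have x2: "e + term_exponent (m - 1) e n = term_exponent m e n + 2 * k"
      by (simp add: term_exponent_def k_def algebra_simps)
    have "Xpow (- m) * ext_term m (e - 1) n + Xpow e * ext_term (m - 1) e n
        = (-1) ^ n * ((Xpow (- m) * Xpow (term_exponent m (e - 1) n)) * (inv_q_poch (int n) * inv_q_poch (k - 1))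
            + (Xpow e * Xpow (term_exponent (m - 1) e n)) * (inv_q_poch (int n) * inv_q_poch k))"
      unfolding ext_term_def k by (simp only: algebra_simps)
    also have "\<dots> = (-1) ^ n * (Xpow (term_exponent m e n) * (inv_q_poch (int n) * (inv_q_poch (k - 1) + Xpow (2 * k) * inv_q_poch k)))"
      unfolding Xpow_mult x1 x2 by (simp only: algebra_simps flip: Xpow_mult)
    also have "inv_q_poch (k - 1) + Xpow (2 * k) * inv_q_poch k = inv_q_poch k"
      unfolding inv_q_poch_rec[symmetric] by (simp add: algebra_simps)
    finally show ?thesis by (simp only: ext_term_def k)
  qed
  hence "adic_sums (ext_term m e) UNIV (Xpow (- m) * tetra_index m (e - 1) + Xpow e * tetra_index (m - 1) e)"
    by (subst adic_sums_cong) (assumption, intro adic_sums_add adic_sums_cmult adic_sums_ext_term)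
  thus ?thesis by (rule adic_sums_unique[OF adic_sums_ext_term])
qed

text \<open>
  Here the terms match only after a shift of the summation index. The difference of the terms for \<open>m\<close>
  and \<open>m + 1\<close> carries the factor \<open>(1 - q\<^sup>n) / (q)\<^sub>n = 1 / (q)\<^sub>n\<^sub>-\<^sub>1\<close>, which turns the \<open>n\<close>-th term into the
  \<open>(n - 1)\<close>-st term for \<open>(m, e + 1)\<close>.
\<close>

lemma tetra_index_rec_m:
  "tetra_index m e = Xpow e * tetra_index (m + 1) e + Xpow (- m) * tetra_index m (e + 1)"
proof -
  define h where "h n = ext_term m e n - Xpow e * ext_term (m + 1) e n" for n
  have h: "h n = - ((-1) ^ n * (Xpow (term_exponent m e n - 2 * int n) * (inv_q_poch (int n - 1) * inv_q_poch (int n + e))))" for n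
  proof -
    have x: "e + term_exponent (m + 1) e n = term_exponent m e n - 2 * int n"
      by (simp add: term_exponent_def algebra_simps)
    define z where "z = term_exponent m e n - 2 * int n"
    have z: "term_exponent m e n = z + 2 * int n" by (simp add: z_def)
    have "Xpow e * ext_term (m + 1) e n =
        (-1) ^ n * ((Xpow e * Xpow (term_exponent (m + 1) e n)) * (inv_q_poch (int n) * inv_q_poch (int n + e)))"
      unfolding ext_term_def by (simp only: mult_ac)
    also have "\<dots> = (-1) ^ n * (Xpow z * (inv_q_poch (int n) * inv_q_poch (int n + e)))"
      unfolding Xpow_mult x z_def ..
    finally have t: "Xpow e * ext_term (m + 1) e n = (-1) ^ n * (Xpow z * (inv_q_poch (int n) * inv_q_poch (int n + e)))" .
    have "h n = - ((-1) ^ n * (Xpow z * (((1 - Xpow (2 * int n)) * inv_q_poch (int n)) * inv_q_poch (int n + e))))"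
      unfolding h_def t unfolding ext_term_def z by (simp add: algebra_simps flip: Xpow_mult)
    thus ?thesis unfolding inv_q_poch_rec z_def .
  qed
  have Suc: "h (Suc n) = Xpow (- m) * ext_term m (e + 1) n" for n
  proof -
    have 1: "term_exponent m e (Suc n) - 2 * int (Suc n) = - m + term_exponent m (e + 1) n"
      by (simp add: term_exponent_def algebra_simps)
    have 2: "int (Suc n) - 1 = int n" "int (Suc n) + e = int n + (e + 1)" by simp_all
    show ?thesis unfolding h ext_term_def 1 2 Xpow_mult[symmetric] power_Suc by (simp only: mult_ac mult_minus_left mult_minus_right mult_1 minus_minus)
  qed
  \<comment> \<open>The term \<open>h 0\<close> vanishes because \<open>1 / (q)\<^sub>-\<^sub>1 = 0\<close>, so the sum of \<open>h\<close> starts at \<open>1\<close>.\<close>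
  have "bij_betw (\<lambda>n. n - 1) {1::nat..} UNIV"
    by (rule bij_betw_byWitness[where f' = Suc]) auto
  moreover have "adic_sums (\<lambda>n. h (Suc n)) UNIV (Xpow (- m) * tetra_index m (e + 1))"
    unfolding Suc by (intro adic_sums_cmult adic_sums_ext_term)
  ultimately have "adic_sums (\<lambda>n. h (Suc (n - 1))) {1..} (Xpow (- m) * tetra_index m (e + 1))"
    by (rule adic_sums_reindex)
  hence "adic_sums h {1..} (Xpow (- m) * tetra_index m (e + 1))"
    by (rule adic_sums_cong[THEN iffD1, rotated]) auto
  hence "adic_sums h UNIV (Xpow (- m) * tetra_index m (e + 1))"
    by (rule adic_sums_mono_neutral) (auto simp: h not_le)
  moreover have "adic_sums h UNIV (tetra_index m e - Xpow e * tetra_index (m + 1) e)"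
    unfolding h_def by (intro adic_sums_diff adic_sums_cmult adic_sums_ext_term)
  ultimately have "tetra_index m e - Xpow e * tetra_index (m + 1) e = Xpow (- m) * tetra_index m (e + 1)"
    by (rule adic_sums_unique[rotated])
  thus ?thesis by (simp add: algebra_simps)
qed

lemma adic_sums_dominant_term:
  assumes "adic_sums g K S" "k0 \<in> K" "\<And>k i. k \<in> K \<Longrightarrow> k \<noteq> k0 \<Longrightarrow> i \<le> d \<Longrightarrow> g k $$ i = 0" "i \<le> d"
  shows "S $$ i = g k0 $$ i"
proof -
  obtain F where F: "finite F" "F \<subseteq> K"
    "\<And>Y i. finite Y \<Longrightarrow> F \<subseteq> Y \<Longrightarrow> Y \<subseteq> K \<Longrightarrow> i \<le> d \<Longrightarrow> sum g Y $$ i = S $$ i"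
    by (rule adic_sumsE[OF assms(1), of d]) blast
  have "S $$ i = sum g (insert k0 F) $$ i"
    using F assms by (intro F(3)[symmetric]) auto
  also have "\<dots> = g k0 $$ i + (\<Sum>k\<in>F - {k0}. g k $$ i)"
    using F(1) by (simp add: fls_sum_nth sum.insert_remove)
  also have "(\<Sum>k\<in>F - {k0}. g k $$ i) = 0"
    using F(2) assms by (intro sum.neutral) auto
  finally show ?thesis by simp
qed

section \<open>The degree of the tetrahedron index\<close>

text \<open>
  Exponents are counted in \<open>X = q\<^sup>1\<^sup>/\<^sup>2\<close>, so this is twice the degree in \<open>q\<close>.
\<close>

definition has_degree :: "int fls \<Rightarrow> int \<Rightarrow> bool" where
  "has_degree f d \<longleftrightarrow> f $$ d \<noteq> 0 \<and> (\<forall>i<d. f $$ i = 0)"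

lemma has_degree_alt: "has_degree f d \<longleftrightarrow> f \<noteq> 0 \<and> fls_subdegree f = d"
  unfolding has_degree_def by (auto intro: fls_subdegree_eqI)

lemma has_degree_Xpow: "has_degree f d \<Longrightarrow> has_degree (Xpow a * f) (a + d)"
  by (auto simp: has_degree_def)

lemma has_degree_diff_right: "has_degree f d \<Longrightarrow> has_degree g d' \<Longrightarrow> d' < d \<Longrightarrow> has_degree (f - g) d'"
  by (auto simp: has_degree_def)

text \<open>
  From index \<open>m\<close> on, the exponents of the terms increase strictly with \<open>n\<close>. If the first nonzero term already
  has such an index, it cannot be cancelled. Otherwise the terms for \<open>n = m - 1\<close> and \<open>n = m\<close> both have
  the lowest exponent and opposite signs, and the degree has to be found differently.
\<close>

lemma tetra_index_degree_first_term:
  assumes "m \<le> max 0 (- e)" "n0 = nat (max 0 (- e))"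
  shows "has_degree (tetra_index m e) (term_exponent m e n0)"
proof -
  have n0: "m \<le> int n0" using assms by simp
  have mono: "term_exponent m e n0 < term_exponent m e n" if "n0 < n" for n
  proof -
    have "0 < (int n - int n0) * (int n + int n0 + 1 - 2 * m)"
      using that n0 by (intro mult_pos_pos) auto
    also have "\<dots> = term_exponent m e n - term_exponent m e n0"
      by (simp add: term_exponent_def algebra_simps)
    finally show ?thesis by simp
  qed
  have "tetra_index m e $$ i = ext_term m e n0 $$ i" if "i \<le> term_exponent m e n0" for i
  proof (rule adic_sums_dominant_term[OF adic_sums_ext_term UNIV_I _ that])
    fix n j assume n: "n \<noteq> n0" and j: "j \<le> term_exponent m e n0"
    show "ext_term m e n $$ j = 0"
    proof (cases "n < n0")
      case True
      thus ?thesis using assms by (simp add: ext_term_nth)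
    next
      case False
      hence "term_exponent m e n0 < term_exponent m e n" using mono n by simp
      thus ?thesis using j by (simp add: ext_term_nth inv_q_poch_mult_nth_neg)
    qed
  qed
  thus ?thesis
    using assms by (auto simp: has_degree_def ext_term_nth inv_q_poch_mult_nth_neg inv_q_poch_mult_nth_0)
qed

text \<open>
  Twice the degree of the tetrahedron index. The three branches belong to the cones spanned by
  \<open>(0, 1), (1, -1)\<close>, by \<open>(0, 1), (-1, 0)\<close> and by \<open>(-1, 0), (1, -1)\<close>; they agree on the common rays.
\<close>

definition tetra_degree :: "int \<Rightarrow> int \<Rightarrow> int" where
  "tetra_degree m e =
     (if m \<ge> 0 \<and> m + e \<ge> 0 then m * (m + e + 1)
      else if m \<le> 0 \<and> e \<ge> 0 then - (m * e) else e * (e + m - 1))"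

lemma tetra_degree_I: "m \<ge> 0 \<Longrightarrow> m + e \<ge> 0 \<Longrightarrow> tetra_degree m e = m * (m + e + 1)"
  by (simp add: tetra_degree_def)

lemma tetra_degree_II: "m \<le> 0 \<Longrightarrow> e \<ge> 0 \<Longrightarrow> tetra_degree m e = - (m * e)"
  by (auto simp: tetra_degree_def)

lemma tetra_degree_III: "e \<le> 0 \<Longrightarrow> m + e \<le> 0 \<Longrightarrow> tetra_degree m e = e * (e + m - 1)"
proof -
  assume "e \<le> 0" "m + e \<le> 0"
  hence "m \<ge> 0 \<and> m + e \<ge> 0 \<Longrightarrow> m = - e" "m \<le> 0 \<and> e \<ge> 0 \<Longrightarrow> e = 0" by auto
  thus ?thesis by (auto simp: tetra_degree_def)
qed

text \<open>
  The hypothesis describes two of the three cones; in them the first term decides.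
\<close>

lemma tetra_index_degree_II_III:
  assumes "m \<le> 0 \<or> m + e \<le> 0"
  shows "has_degree (tetra_index m e) (tetra_degree m e)"
proof (cases "e \<ge> 0")
  case True
  hence "m \<le> 0" using assms by linarith
  thus ?thesis using tetra_index_degree_first_term[OF _ refl, of m e] True
    by (simp add: tetra_degree_II term_exponent_def mult.commute)
next
  case False
  hence "m + e \<le> 0" using assms by linarith
  thus ?thesis using tetra_index_degree_first_term[OF _ refl, of m e] False
    by (simp add: tetra_degree_III term_exponent_def algebra_simps)
qed

text \<open>
  After multiplication by \<open>X\<^sup>e\<^sup>m\<close> the values converge for \<open>e \<rightarrow> \<infinity>\<close>, since consecutive ones differ by
  \<open>q\<^sup>e\<^sup>+\<^sup>1\<close> times a value at \<open>m - 1\<close>.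
\<close>

definition scaled_index :: "int \<Rightarrow> int \<Rightarrow> int fls" where
  "scaled_index m e = Xpow (e * m) * tetra_index m e"

lemma scaled_index_step_e: "scaled_index m e = scaled_index m (e + 1) - Xpow (2 * (e + 1)) * scaled_index (m - 1) (e + 1)"
proof -
  have "scaled_index m (e + 1) = Xpow ((e + 1) * m) * (Xpow (- m) * tetra_index m e + Xpow (e + 1) * tetra_index (m - 1) (e + 1))"
    using tetra_index_rec_e[of m "e + 1"] by (simp add: scaled_index_def)
  also have "\<dots> = Xpow ((e + 1) * m + - m) * tetra_index m e + Xpow ((e + 1) * m + (e + 1)) * tetra_index (m - 1) (e + 1)"
    by (simp only: distrib_left Xpow_mult_left)
  also have "(e + 1) * m + - m = e * m" by (simp add: algebra_simps)
  also have "(e + 1) * m + (e + 1) = (e + 1) * (m + 1)" by (simp add: algebra_simps)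
  also have "(e + 1) * (m + 1) = 2 * (e + 1) + (e + 1) * (m - 1)" by (simp add: algebra_simps)
  finally show ?thesis by (simp add: scaled_index_def Xpow_mult_left)
qed

lemma scaled_index_step_m: "scaled_index (m + 1) e = scaled_index m e - Xpow (- 2 * m) * scaled_index m (e + 1)"
proof -
  have "scaled_index m e = Xpow (e * m) * (Xpow e * tetra_index (m + 1) e + Xpow (- m) * tetra_index m (e + 1))"
    using tetra_index_rec_m[of m e] by (simp add: scaled_index_def)
  also have "\<dots> = Xpow (e * m + e) * tetra_index (m + 1) e + Xpow (e * m + - m) * tetra_index m (e + 1)"
    by (simp only: distrib_left Xpow_mult_left)
  also have "e * m + e = e * (m + 1)" by (simp add: algebra_simps)
  also have "e * m + - m = - 2 * m + (e + 1) * m" by (simp add: algebra_simps)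
  finally show ?thesis by (simp add: scaled_index_def Xpow_mult_left)
qed

text \<open>
  The limit for \<open>e \<rightarrow> \<infinity>\<close> is \<open>0\<close> for every \<open>m \<ge> 1\<close>. (It is \<open>(q\<^sup>1\<^sup>-\<^sup>m)\<^sub>\<infinity> / (q)\<^sub>\<infinity>\<close>, which contains the factor
  \<open>1 - q\<^sup>0\<close>.) For \<open>m = 1\<close> the two recurrences combine to express the value through \<open>m = -1\<close>, where
  the degree is known; the step from \<open>m\<close> to \<open>m + 1\<close> preserves convergence to \<open>0\<close>.
\<close>

lemma scaled_index_vanishes:
  assumes "m \<ge> 1"
  shows "\<exists>E. \<forall>e\<ge>E. \<forall>i\<le>p. scaled_index m e $$ i = 0"
  using assms
proof (induction m arbitrary: p rule: int_ge_induct)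
  case base
  show ?case
  proof (intro exI allI impI)
    fix e i :: int assume ei: "\<bar>p\<bar> \<le> e" "i \<le> p"
    \<comment> \<open>Both recurrences at \<open>m = 0\<close>; the values at \<open>m = 0\<close> cancel.\<close>
    have eq: "scaled_index 1 e = - (Xpow (2 * (e + 1)) * scaled_index (-1) (e + 1))"
      using scaled_index_step_m[of 0 e] scaled_index_step_e[of 0 e] by simp
    have "has_degree (tetra_index (-1) (e + 1)) (e + 1)"
      using tetra_index_degree_II_III[of "-1" "e + 1"] ei by (simp add: tetra_degree_II add.commute)
    hence "has_degree (scaled_index (-1) (e + 1)) 0"
      unfolding scaled_index_def by (drule_tac has_degree_Xpow[of _ _ "- (e + 1)"]) simp
    thus "scaled_index 1 e $$ i = 0" using ei unfolding eq by (simp add: has_degree_def)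
  qed
next
  case (step m)
  obtain E1 where E1: "\<forall>e\<ge>E1. \<forall>i\<le>p. scaled_index m e $$ i = 0" using step.IH by blast
  obtain E2 where E2: "\<forall>e\<ge>E2. \<forall>i\<le>p + 2 * m. scaled_index m e $$ i = 0" using step.IH by blast
  show ?case
    by (rule exI[of _ "max E1 E2"]) (use E1 E2 in \<open>simp add: scaled_index_step_m\<close>)
qed

text \<open>
  Since the limit vanishes, \<open>F(m + 1, e) = - \<Sum>\<^sub>j\<^sub>>\<^sub>e q\<^sup>j F(m, j)\<close>, and by induction the degrees of the
  summands increase with \<open>j\<close>, so the first one determines the degree. This is the only place where the
  cancellation for \<open>m > 0\<close> has to be resolved.
\<close>

lemma scaled_index_degree:
  assumes "m \<ge> 0" "e \<ge> 0"
  shows "has_degree (scaled_index m e) (2 * m * e + m * (m + 1))"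
  using assms
proof (induction m arbitrary: e rule: int_ge_induct)
  case base
  thus ?case using tetra_index_degree_II_III[of 0 e] by (simp add: scaled_index_def tetra_degree_II)
next
  case (step m)
  \<comment> \<open>The claimed degree at \<open>m + 1\<close>; by the induction hypothesis it is also that of the correction term.\<close>
  define d where "d e = 2 * (m + 1) * e + (m + 1) * (m + 2)" for e
  have corr: "has_degree (Xpow (2 * (e + 1)) * scaled_index m (e + 1)) (d e)" if "e \<ge> 0" for e
  proof -
    have "has_degree (Xpow (2 * (e + 1)) * scaled_index m (e + 1)) (2 * (e + 1) + (2 * m * (e + 1) + m * (m + 1)))"
      using that by (intro has_degree_Xpow step.IH) auto
    moreover have "2 * (e + 1) + (2 * m * (e + 1) + m * (m + 1)) = d e" by (simp add: d_def algebra_simps)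
    ultimately show ?thesis by simp
  qed
  have d_mono: "d e < d (e + 1)" for e using step.hyps by (simp add: d_def algebra_simps)
  have eq: "scaled_index (m + 1) e $$ i = scaled_index (m + 1) (e + 1) $$ i - (Xpow (2 * (e + 1)) * scaled_index m (e + 1)) $$ i" for e i
    using scaled_index_step_e[of "m + 1" e] by simp
  have const: "scaled_index (m + 1) (e + int t) $$ i = scaled_index (m + 1) e $$ i" if "e \<ge> 0" "i < d e" for e i t
  proof (induction t)
    case (Suc t)
    have "d e \<le> d (e + int t)" using step.hyps by (simp add: d_def mult_left_mono)
    hence "(Xpow (2 * ((e + int t) + 1)) * scaled_index m ((e + int t) + 1)) $$ i = 0"
      using corr[of "e + int t"] that unfolding has_degree_def by simp
    hence "scaled_index (m + 1) (e + int t) $$ i = scaled_index (m + 1) (e + int t + 1) $$ i"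
      unfolding eq[of "e + int t"] by simp
    moreover have "e + int t + 1 = e + int (Suc t)" by simp
    ultimately show ?case using Suc by metis
  qed simp
  have zero: "scaled_index (m + 1) e $$ i = 0" if e: "e \<ge> 0" and i: "i < d e" for e i
  proof -
    obtain E where E: "\<forall>e\<ge>E. \<forall>j\<le>i. scaled_index (m + 1) e $$ j = 0"
      using scaled_index_vanishes[of "m + 1" i] step.hyps by auto
    have "scaled_index (m + 1) (e + int (nat (\<bar>E\<bar>))) $$ i = 0" using E e by simp
    thus ?thesis unfolding const[OF e i] .
  qed
  have "has_degree (scaled_index (m + 1) e) (d e)"
    unfolding has_degree_def
  proof (intro conjI allI impI)
    have "scaled_index (m + 1) (e + 1) $$ d e = 0" using zero step.prems d_mono by simp
    thus "scaled_index (m + 1) e $$ d e \<noteq> 0" using eq[of e "d e"] corr[OF step.prems] by (simp add: has_degree_def)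
  qed (use zero step.prems in auto)
  thus ?case by (simp add: d_def algebra_simps)
qed

lemma tetra_index_degree_quadrant:
  assumes "m \<ge> 0" "e \<ge> 0"
  shows "has_degree (tetra_index m e) (tetra_degree m e)"
proof -
  have "tetra_index m e = Xpow (- (e * m)) * scaled_index m e"
    by (simp add: scaled_index_def Xpow_mult_left)
  thus ?thesis using has_degree_Xpow[OF scaled_index_degree[OF assms], of "- (e * m)"] assms
    by (simp add: tetra_degree_I algebra_simps)
qed

text \<open>
  Below the half-axis \<open>e = 0, m \<ge> 0\<close> the recurrence in \<open>e\<close> has two terms of different degrees, so no
  cancellation is possible and the induction on \<open>-e\<close> goes through inside the cone.
\<close>

lemma tetra_index_degree_I:
  assumes "e \<le> 0" "m + e \<ge> 0"
  shows "has_degree (tetra_index m e) (tetra_degree m e)"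
  using assms
proof (induction e arbitrary: m rule: int_le_induct)
  case base
  thus ?case by (intro tetra_index_degree_quadrant) auto
next
  case (step e)
  have m: "m \<ge> 1" "m + e \<ge> 1" using step by auto
  have eq: "tetra_index m (e - 1) = Xpow m * (tetra_index m e - Xpow e * tetra_index (m - 1) e)"
    using tetra_index_rec_e[of m e] by (simp add: Xpow_mult_left)
  have "has_degree (tetra_index m e) (m * (m + e + 1))"
    using step.IH[of m] m by (simp add: tetra_degree_I)
  moreover have "has_degree (tetra_index (m - 1) e) ((m - 1) * (m + e))"
    using step.IH[of "m - 1"] m by (simp add: tetra_degree_I)
  hence "has_degree (Xpow e * tetra_index (m - 1) e) (e + (m - 1) * (m + e))"
    by (rule has_degree_Xpow)
  moreover have "e + (m - 1) * (m + e) < m * (m + e + 1)" using m by (simp add: algebra_simps)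
  ultimately have "has_degree (tetra_index m (e - 1)) (m + (e + (m - 1) * (m + e)))"
    unfolding eq by (blast intro: has_degree_Xpow has_degree_diff_right)
  moreover have "m + (e + (m - 1) * (m + e)) = tetra_degree m (e - 1)"
    using m by (simp add: tetra_degree_I algebra_simps)
  ultimately show ?case by simp
qed

theorem tetra_index_degree: "has_degree (tetra_index m e) (tetra_degree m e)"
  using tetra_index_degree_II_III tetra_index_degree_quadrant tetra_index_degree_I
  by (metis linorder_linear)

section \<open>Farkas' lemma with strict inequalities\<close>

definition vdot :: "'a::comm_ring_1^'n \<Rightarrow> 'a^'n \<Rightarrow> 'a" where
  "vdot x y = (\<Sum>j\<in>UNIV. x $ j * y $ j)"

lemma vdot_add_left: "vdot (x + y) z = vdot x z + vdot y z"
  and vdot_add_right: "vdot z (x + y) = vdot z x + vdot z y"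
  and vdot_diff_left: "vdot (x - y) z = vdot x z - vdot y z"
  and vdot_diff_right: "vdot z (x - y) = vdot z x - vdot z y"
  by (simp_all add: vdot_def algebra_simps sum.distrib sum_subtractf)

lemma vdot_minus_left [simp]: "vdot (- x) z = - vdot x z"
  and vdot_minus_right [simp]: "vdot z (- x) = - vdot z x"
  by (simp_all add: vdot_def sum_negf)

lemma vdot_zero_left [simp]: "vdot 0 z = 0"
  and vdot_zero_right [simp]: "vdot z 0 = 0"
  by (simp_all add: vdot_def)

lemma vdot_scale_left [simp]: "vdot (c *s x) z = c * vdot x z"
  and vdot_scale_right [simp]: "vdot z (c *s x) = c * vdot z x"
  by (simp_all add: vdot_def sum_distrib_left mult_ac)

lemma vdot_sum_left: "vdot (\<Sum>i\<in>I. f i) z = (\<Sum>i\<in>I. vdot (f i) z)"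
  by (induction I rule: infinite_finite_induct) (simp_all add: vdot_add_left)

lemma vdot_axis: "vdot x (axis j 1) = x $ j"
proof -
  have "vdot x (axis j 1) = (\<Sum>i\<in>UNIV. if i = j then x $ i else 0)"
    unfolding vdot_def by (intro sum.cong) (auto simp: axis_def)
  thus ?thesis by simp
qed

text \<open>
  Bartl's induction on the number of functionals, valid over every ordered field. If the first
  functionals do not generate \<open>g\<close>, take a separating \<open>x\<close>. If the new functional \<open>f a\<close> is negative at \<open>x\<close>,
  project all functionals along \<open>f a\<close> to those vanishing at \<open>x\<close> and apply the induction hypothesis again.
\<close>

theorem farkas:
  fixes f :: "'i \<Rightarrow> 'a::linordered_field^'n"
  assumes "finite I"
  shows "(\<exists>c. (\<forall>i\<in>I. 0 \<le> c i) \<and> g = (\<Sum>i\<in>I. c i *s f i)) \<or>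
         (\<exists>x. (\<forall>i\<in>I. 0 \<le> vdot (f i) x) \<and> vdot g x < 0)"
  using assms
proof (induction I arbitrary: f g rule: finite_induct)
  case empty
  show ?case
  proof (cases "g = 0")
    case False
    then obtain j where j: "g $ j \<noteq> 0" by (auto simp: vec_eq_iff)
    \<comment> \<open>With no functionals to respect, any vector on which \<open>g\<close> is negative separates.\<close>
    have "vdot g (- (g $ j) *s axis j 1) = - (g $ j * g $ j)"
      by (simp add: vdot_axis)
    hence "vdot g (- (g $ j) *s axis j 1) < 0" using j by (simp add: zero_less_mult_iff) linarith
    thus ?thesis by blast
  qed auto
next
  case (insert a I)
  show ?case
  proof (cases "\<exists>c. (\<forall>i\<in>I. 0 \<le> c i) \<and> g = (\<Sum>i\<in>I. c i *s f i)")
    case True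
    then obtain c where c: "\<forall>i\<in>I. 0 \<le> c i" "g = (\<Sum>i\<in>I. c i *s f i)" by blast
    have "g = (\<Sum>i\<in>insert a I. (c(a := 0)) i *s f i)"
      using insert.hyps c(2) by (auto intro!: sum.cong)
    thus ?thesis using c(1) by (intro disjI1 exI[of _ "c(a := 0)"]) auto
  next
    case False
    then obtain x where x: "\<forall>i\<in>I. 0 \<le> vdot (f i) x" "vdot g x < 0"
      using insert.IH[of g f] by blast
    show ?thesis
    proof (cases "0 \<le> vdot (f a) x")
      case True
      thus ?thesis using x by blast
    next
      case ax: False
      define r where "r = vdot (f a) x"
      have r: "r < 0" using ax by (simp add: r_def)
      \<comment> \<open>Every \<open>p h\<close> vanishes at \<open>x\<close>, and \<open>p (f a) = 0\<close>.\<close>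
      define p where "p h = h - (vdot h x / r) *s f a" for h
      have dot_p: "vdot (p h) y = vdot h (y - (vdot (f a) y / r) *s x)" for h y
        by (simp add: p_def vdot_diff_left vdot_diff_right)
      from insert.IH[of "p g" "\<lambda>i. p (f i)"] show ?thesis
      proof
        assume "\<exists>c. (\<forall>i\<in>I. 0 \<le> c i) \<and> p g = (\<Sum>i\<in>I. c i *s p (f i))"
        then obtain c where c: "\<forall>i\<in>I. 0 \<le> c i" "p g = (\<Sum>i\<in>I. c i *s p (f i))" by blast
        define t where "t = vdot g x / r + (\<Sum>i\<in>I. c i * (- (vdot (f i) x / r)))"
        have "0 \<le> vdot g x / r" using x r by (simp add: divide_nonpos_neg)
        moreover have "0 \<le> (\<Sum>i\<in>I. c i * (- (vdot (f i) x / r)))"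
          using x r c(1) by (intro sum_nonneg mult_nonneg_nonneg) (auto simp: divide_nonneg_neg)
        ultimately have t: "0 \<le> t" by (simp add: t_def)
        have "g = p g + (vdot g x / r) *s f a" by (simp add: p_def)
        also have "p g = (\<Sum>i\<in>I. c i *s f i + (c i * (- (vdot (f i) x / r))) *s f a)"
          unfolding c(2) by (intro sum.cong) (auto simp: p_def vec_eq_iff algebra_simps)
        also have "\<dots> = (\<Sum>i\<in>I. c i *s f i) + (\<Sum>i\<in>I. c i * (- (vdot (f i) x / r))) *s f a"
          by (simp only: sum.distrib vec.scale_sum_left)
        finally have "g = t *s f a + (\<Sum>i\<in>I. c i *s f i)"
          by (simp add: t_def vec.scale_left_distrib add_ac)
        also have "\<dots> = (\<Sum>i\<in>insert a I. (c(a := t)) i *s f i)"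
          using insert.hyps by (auto intro!: sum.cong)
        finally show ?thesis using c(1) t by (intro disjI1 exI[of _ "c(a := t)"]) auto
      next
        assume "\<exists>y. (\<forall>i\<in>I. 0 \<le> vdot (p (f i)) y) \<and> vdot (p g) y < 0"
        then obtain y where y: "\<forall>i\<in>I. 0 \<le> vdot (p (f i)) y" "vdot (p g) y < 0" by blast
        have "vdot (f a) (y - (vdot (f a) y / r) *s x) = 0"
          using r by (simp add: vdot_diff_right r_def)
        thus ?thesis using y unfolding dot_p
          by (intro disjI2 exI[of _ "y - (vdot (f a) y / r) *s x"]) auto
      qed
    qed
  qed
qed

text \<open>
  A coefficient without sign condition is a difference of two nonnegative ones, so each \<open>w i\<close> enters
  twice, once with each sign.
\<close>

lemma farkas_free:
  fixes u w :: "'i::finite \<Rightarrow> 'a::linordered_field^'n"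
  assumes "\<And>x. (\<And>i. 0 \<le> vdot (u i) x) \<Longrightarrow> (\<And>i. vdot (w i) x = 0) \<Longrightarrow> 0 \<le> vdot g x"
  obtains l n where "\<And>i. 0 \<le> l i" "g = (\<Sum>i\<in>UNIV. l i *s u i) + (\<Sum>i\<in>UNIV. n i *s w i)"
proof -
  define f where "f = (\<lambda>(i, s). if s = (0::nat) then u i else if s = 1 then w i else - w i)"
  let ?I = "(UNIV :: 'i set) \<times> {0, 1, 2::nat}"
  have "\<not> (\<exists>x. (\<forall>i\<in>?I. 0 \<le> vdot (f i) x) \<and> vdot g x < 0)"
  proof
    assume "\<exists>x. (\<forall>i\<in>?I. 0 \<le> vdot (f i) x) \<and> vdot g x < 0"
    then obtain x where x: "\<And>i. i \<in> ?I \<Longrightarrow> 0 \<le> vdot (f i) x" "vdot g x < 0" by blast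
    have "0 \<le> vdot (u i) x" "vdot (w i) x = 0" for i
      using x(1)[of "(i, 0)"] x(1)[of "(i, 1)"] x(1)[of "(i, 2)"] by (auto simp: f_def)
    thus False using assms[of x] x(2) by fastforce
  qed
  then obtain c where c: "\<forall>i\<in>?I. 0 \<le> c i" "g = (\<Sum>i\<in>?I. c i *s f i)"
    using farkas[where I = ?I and f = f and g = g] by auto
  have "g = (\<Sum>i\<in>UNIV. \<Sum>s\<in>{0, 1, 2}. c (i, s) *s f (i, s))"
    unfolding c(2) by (simp only: sum.cartesian_product case_prod_unfold prod.collapse)
  also have "\<dots> = (\<Sum>i\<in>UNIV. c (i, 0) *s u i + (c (i, 1) - c (i, 2)) *s w i)"
    by (intro sum.cong) (auto simp: f_def vec_eq_iff algebra_simps)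
  finally show thesis
    using c(1) by (intro that[of "\<lambda>i. c (i, 0)" "\<lambda>i. c (i, 1) - c (i, 2)"]) (auto simp: sum.distrib)
qed

text \<open>
  Strictly positive coefficients. It suffices to make one coefficient positive at a time, since the
  average of the resulting representations has all of them positive. To make the \<open>j\<close>-th one positive,
  represent \<open>- u j\<close> with \<open>- g\<close> as an additional generator and solve for \<open>g\<close>.
\<close>

lemma strict_farkas:
  fixes u w :: "'i::finite \<Rightarrow> 'a::linordered_field^'n"
  assumes none: "\<And>x. x \<noteq> 0 \<Longrightarrow> (\<And>i. 0 \<le> vdot (u i) x) \<Longrightarrow> (\<And>i. vdot (w i) x = 0) \<Longrightarrow> 0 < vdot g x"
  obtains l n where "\<And>i. 0 < l i" "g = (\<Sum>i\<in>UNIV. l i *s u i) + (\<Sum>i\<in>UNIV. n i *s w i)"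
proof -
  let ?C = "\<lambda>l n. (\<Sum>i\<in>UNIV. l i *s u i) + (\<Sum>i\<in>UNIV. n i *s w i)"
  have C_add: "?C l n + ?C l' n' = ?C (\<lambda>i. l i + l' i) (\<lambda>i. n i + n' i)" for l n l' n'
    by (simp add: vec.scale_left_distrib sum.distrib)
  have C_scale: "t *s ?C l n = ?C (\<lambda>i. t * l i) (\<lambda>i. t * n i)" for t l n
    by (simp add: vec.scale_right_distrib vec.scale_sum_right)
  have C_single: "u j = ?C (\<lambda>i. if i = j then 1 else 0) (\<lambda>_. 0)" for j
  proof -
    have "(\<Sum>i\<in>UNIV. (if i = j then 1 else 0) *s u i) = (\<Sum>i\<in>UNIV. if i = j then u i else 0)"
      by (intro sum.cong) auto
    thus ?thesis by simp
  qed
  obtain l0 n0 where ln0: "\<And>i. 0 \<le> l0 i" "g = ?C l0 n0"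
  proof (rule farkas_free[of u w g])
    fix x assume "\<And>i. 0 \<le> vdot (u i) x" "\<And>i. vdot (w i) x = 0"
    thus "0 \<le> vdot g x" using none[of x] by (cases "x = 0") (auto simp: less_imp_le)
  qed blast
  have "\<forall>j. \<exists>l n. (\<forall>i. 0 \<le> l i) \<and> 0 < l j \<and> g = ?C l n"
  proof
    fix j
    define u' where "u' = case_option (- g) u"
    define w' where "w' = case_option 0 w"
    obtain l n where ln: "\<And>i. 0 \<le> l i"
      "- u j = (\<Sum>i\<in>UNIV. l i *s u' i) + (\<Sum>i\<in>UNIV. n i *s w' i)"
    proof (rule farkas_free[of u' w' "- u j"])
      fix x assume 1: "\<And>i. 0 \<le> vdot (u' i) x" "\<And>i. vdot (w' i) x = 0"
      have 2: "0 \<le> vdot (u i) x" "vdot (w i) x = 0" "vdot g x \<le> 0" for i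
        using 1[of "Some i"] 1[of None] by (auto simp: u'_def w'_def)
      hence "x = 0" using none[of x] by fastforce
      thus "0 \<le> vdot (- u j) x" by simp
    qed blast
    have "- u j = - (l None *s g) + ?C (l \<circ> Some) (n \<circ> Some)"
      unfolding ln(2) by (simp add: UNIV_option_conv sum.reindex u'_def w'_def)
    hence "l None *s g = u j + ?C (l \<circ> Some) (n \<circ> Some)"
      by (simp add: algebra_simps)
    also have "\<dots> = ?C (\<lambda>i. (if i = j then 1 else 0) + l (Some i)) (\<lambda>i. n (Some i))"
      by (subst C_single[of j], subst C_add) simp
    finally have eq: "l None *s g = ?C (\<lambda>i. (if i = j then 1 else 0) + l (Some i)) (\<lambda>i. n (Some i))" .
    have nn: "0 \<le> (if i = j then 1 else 0) + l (Some i)" for i using ln(1)[of "Some i"] by simp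
    have pj: "0 < 1 + l (Some j)" using ln(1)[of "Some j"] by linarith
    \<comment> \<open>If \<open>g\<close> does not occur, then \<open>eq\<close> represents \<open>0\<close> with a positive \<open>j\<close>-th coefficient and can be added
      to any representation of \<open>g\<close>; otherwise divide by its coefficient.\<close>
    show "\<exists>l n. (\<forall>i. 0 \<le> l i) \<and> 0 < l j \<and> g = ?C l n"
    proof (cases "l None = 0")
      case True
      have "g = ?C l0 n0 + l None *s g" using ln0(2) True by simp
      also have "\<dots> = ?C (\<lambda>i. l0 i + ((if i = j then 1 else 0) + l (Some i))) (\<lambda>i. n0 i + n (Some i))"
        unfolding eq C_add ..
      finally have e: "g = \<dots>" .
      have "0 \<le> l0 i + ((if i = j then 1 else 0) + l (Some i))" for i
        using nn[of i] ln0(1)[of i] by linarith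
      moreover have "0 < l0 j + ((if j = j then 1 else 0) + l (Some j))"
        using pj ln0(1)[of j] by simp
      ultimately show ?thesis by (intro exI conjI allI) (assumption | rule e)+
    next
      case False
      hence pos: "0 < l None" using ln(1)[of None] by simp
      have "g = (1 / l None) *s (l None *s g)" using False by simp
      also have "\<dots> = ?C (\<lambda>i. 1 / l None * ((if i = j then 1 else 0) + l (Some i))) (\<lambda>i. 1 / l None * n (Some i))"
        unfolding eq C_scale ..
      finally have e: "g = \<dots>" .
      have "0 \<le> 1 / l None * ((if i = j then 1 else 0) + l (Some i))" for i
        using nn[of i] pos by (intro mult_nonneg_nonneg) auto
      moreover have "0 < 1 / l None * ((if j = j then 1 else 0) + l (Some j))"
        using pj pos by simp
      ultimately show ?thesis by (intro exI conjI allI) (assumption | rule e)+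
    qed
  qed
  from choice[OF this] obtain l where
    "\<forall>j. \<exists>n. (\<forall>i. 0 \<le> l j i) \<and> 0 < l j j \<and> g = ?C (l j) n" ..
  from choice[OF this] obtain n where
    "\<forall>j. (\<forall>i. 0 \<le> l j i) \<and> 0 < l j j \<and> g = ?C (l j) (n j)" ..
  hence ln: "0 \<le> l j i" "0 < l j j" "g = ?C (l j) (n j)" for j i by auto
  \<comment> \<open>The average of the representations found for the individual \<open>j\<close>.\<close>
  define c where "c = (1 / of_nat CARD('i) :: 'a)"
  have c: "0 < c" by (simp add: c_def)
  have "g = c *s (\<Sum>j\<in>(UNIV :: 'i set). g)"
    unfolding vec_eq_iff vector_smult_component sum_component by (simp add: c_def)
  also have "(\<Sum>j\<in>(UNIV :: 'i set). g) = (\<Sum>j\<in>UNIV. ?C (l j) (n j))"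
    by (intro sum.cong refl ln(3))
  also have "\<dots> = ?C (\<lambda>i. \<Sum>j\<in>UNIV. l j i) (\<lambda>i. \<Sum>j\<in>UNIV. n j i)"
    unfolding sum.distrib vec.scale_sum_left by (intro arg_cong2[of _ _ _ _ "(+)"] sum.swap)
  also have "c *s \<dots> = ?C (\<lambda>i. c * (\<Sum>j\<in>UNIV. l j i)) (\<lambda>i. c * (\<Sum>j\<in>UNIV. n j i))"
    by (rule C_scale)
  finally have "g = \<dots>" .
  moreover have "0 < c * (\<Sum>j\<in>UNIV. l j i)" for i
    using ln c by (intro mult_pos_pos sum_pos2[of _ i]) auto
  ultimately show thesis by (rule that[rotated])
qed

section \<open>Integral points and rank\<close>

lemma common_denominator:
  fixes k :: "rat^'n"
  obtains D :: int and k' :: "int^'n" where "0 < D" "\<And>j. of_int (k' $ j) = of_int D * k $ j"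
proof -
  define d where "d j = snd (quotient_of (k $ j))" for j
  define a where "a j = fst (quotient_of (k $ j))" for j
  have d: "0 < d j" for j by (simp add: d_def quotient_of_denom_pos')
  have k: "k $ j = of_int (a j) / of_int (d j)" for j
    using quotient_of_div[of "k $ j" "a j" "d j"] by (simp add: a_def d_def)
  define D where "D = (\<Prod>j\<in>UNIV. d j)"
  have D: "D = d j * (\<Prod>i\<in>UNIV - {j}. d i)" for j
    unfolding D_def by (rule prod.remove) auto
  show thesis
  proof (rule that[of D "\<chi> j. a j * (\<Prod>i\<in>UNIV - {j}. d i)"])
    show "0 < D" unfolding D_def using d by (intro prod_pos) auto
    show "of_int ((\<chi> j. a j * (\<Prod>i\<in>UNIV - {j}. d i)) $ j) = of_int D * k $ j" for j
      using d[of j] by (simp add: D[of j] k)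
  qed
qed

text \<open>
  Full row rank is linear independence of the family of rows, stated over an arbitrary field.
\<close>

lemma rank_eq_card_rows:
  fixes M :: "'a::field^'n^'m"
  shows "rank M = CARD('m) \<longleftrightarrow> (\<forall>c. (\<Sum>i\<in>UNIV. c i *s row i M) = 0 \<longrightarrow> (\<forall>i. c i = 0))"
proof
  assume rk: "rank M = CARD('m)"
  have rows: "rows M = range (\<lambda>i. row i M)" by (auto simp: rows_def)
  have "vec.dim (rows M) \<le> card (rows M)"
    by (intro vec.dim_le_card) (auto simp: vec.span_superset rows)
  moreover have "card (rows M) \<le> CARD('m)" unfolding rows by (rule card_image_le) simp
  ultimately have card: "card (rows M) = CARD('m)" using rk by (simp add: row_rank_def_gen)
  hence inj: "inj (\<lambda>i. row i M)" unfolding rows by (simp add: eq_card_imp_inj_on)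
  have ind: "vec.independent (rows M)"
    using vec.card_eq_dim[of "rows M" "rows M"] card rk
    by (auto simp: row_rank_def_gen rows vec.span_superset)
  show "\<forall>c. (\<Sum>i\<in>UNIV. c i *s row i M) = 0 \<longrightarrow> (\<forall>i. c i = 0)"
  proof (intro allI impI)
    fix c i assume 0: "(\<Sum>i\<in>UNIV. c i *s row i M) = 0"
    \<comment> \<open>Distinct indices have distinct rows, so coefficients indexed by \<open>i\<close> become coefficients on the set of rows.\<close>
    define b where "b x = c (inv (\<lambda>i. row i M) x)" for x
    have b: "b (row i M) = c i" for i unfolding b_def by (subst inv_f_f[OF inj]) (rule refl)
    have "(\<Sum>x\<in>rows M. b x *s x) = 0"
      unfolding rows using 0 by (subst sum.reindex[OF inj]) (simp add: b)
    hence "b (row i M) = 0"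
      using vec.independentD[OF ind, of "rows M" b "row i M"] by (auto simp: rows)
    thus "c i = 0" by (simp add: b)
  qed
next
  assume ind: "\<forall>c. (\<Sum>i\<in>UNIV. c i *s row i M) = 0 \<longrightarrow> (\<forall>i. c i = 0)"
  have rows: "rows M = range (\<lambda>i. row i M)" by (auto simp: rows_def)
  have inj: "inj (\<lambda>i. row i M)"
  proof (rule injI, rule ccontr)
    fix i j assume eq: "row i M = row j M" and ne: "i \<noteq> j"
    define c where "c x = (if x = i then 1 else if x = j then -1 else (0::'a))" for x
    have "(\<Sum>x\<in>UNIV. c x *s row x M) = (\<Sum>x\<in>{i, j}. c x *s row x M)"
      by (intro sum.mono_neutral_right) (auto simp: c_def)
    also have "\<dots> = 0" using ne eq by (simp add: c_def)
    finally have "c i = 0" using ind by blast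
    thus False by (simp add: c_def)
  qed
  have "vec.independent (rows M)"
  proof (rule vec.independent_if_scalars_zero)
    fix b x assume 0: "(\<Sum>x\<in>rows M. b x *s x) = 0" and x: "x \<in> rows M"
    have "(\<Sum>i\<in>UNIV. b (row i M) *s row i M) = 0"
      using 0 unfolding rows by (subst (asm) sum.reindex[OF inj]) simp
    thus "b x = 0" using ind x by (auto simp: rows)
  qed (simp add: rows)
  hence "rank M = card (rows M)" by (simp add: row_rank_def_gen vec.dim_eq_card_independent)
  thus "rank M = CARD('m)" unfolding rows by (simp add: card_image[OF inj])
qed

section \<open>Convergence and index structures\<close>

lemma has_degree_mult: "has_degree f a \<Longrightarrow> has_degree g b \<Longrightarrow> has_degree (f * g) (a + b)"
  by (auto simp: has_degree_alt)

lemma has_degree_prod: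
  "(\<And>i. i \<in> I \<Longrightarrow> has_degree (f i) (d i)) \<Longrightarrow> has_degree (\<Prod>i\<in>I. f i) (\<Sum>i\<in>I. d i)"
  by (induction I rule: infinite_finite_induct) (auto intro: has_degree_mult simp: has_degree_alt)

definition summand_degree ::
  "int^'s^'r \<Rightarrow> int^'s^'r \<Rightarrow> int^'r \<Rightarrow> int^'s \<Rightarrow> int^'s \<Rightarrow> int^'r \<Rightarrow> int" where
  "summand_degree A B v m e k = int_dot v k +
     (\<Sum>i\<in>UNIV. tetra_degree (m $ i - int_dot (column i B) k) (e $ i + int_dot (column i A) k))"

lemma index_summand_degree: "has_degree (index_summand A B v m e k) (summand_degree A B v m e k)"
  unfolding index_summand_def summand_degree_def
  by (intro has_degree_mult has_degree_prod tetra_index_degree) (simp add: has_degree_alt)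

lemma locally_finite_iff_degree:
  assumes "\<And>k. has_degree (g k) (d k)"
  shows "locally_finite g UNIV \<longleftrightarrow> (\<forall>n. finite {k. d k \<le> n})"
proof -
  have "(\<exists>i\<le>n. g k $$ i \<noteq> 0) \<longleftrightarrow> d k \<le> n" for k n
    using assms[of k] unfolding has_degree_def by (meson leI order.trans)
  thus ?thesis by (simp add: locally_finite_def)
qed

lemma int_dot_vdot: "int_dot x y = vdot x y"
  by (simp add: int_dot_def vdot_def)

abbreviation rat_vec :: "int^'n \<Rightarrow> rat^'n" where
  "rat_vec x \<equiv> (\<chi> i. of_int (x $ i))"

lemma vdot_rat_vec: "vdot (rat_vec x) (rat_vec y) = of_int (int_dot x y)"
  by (simp add: vdot_def int_dot_def)

lemma mat_vec_columns: "M *v x = (\<Sum>i\<in>UNIV. x $ i *s column i M)"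
  for M :: "'a::comm_ring_1^'n^'m"
  by (simp add: vec_eq_iff matrix_vector_mult_def column_def sum_component mult.commute)

lemma column_map_of_int: "column i (map_matrix rat_of_int A) = rat_vec (column i A)"
  by (simp add: column_def map_matrix_def vec_eq_iff)

definition kernel_free :: "int^'s^'r \<Rightarrow> int^'s^'r \<Rightarrow> bool" where
  "kernel_free A B \<longleftrightarrow>
     (\<forall>k. (\<forall>i. int_dot (column i A) k = 0 \<and> int_dot (column i B) k = 0) \<longrightarrow> k = 0)"

text \<open>
  A rational relation between the rows can be cleared of denominators, so the rank condition only
  concerns lattice vectors.
\<close>

lemma rank_hconcat:
  fixes A B :: "int^'s^'r"
  shows "rank (map_matrix rat_of_int (hconcat A B)) = CARD('r) \<longleftrightarrow> kernel_free A B"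
proof -
  let ?M = "map_matrix rat_of_int (hconcat A B)"
  have eq: "(\<Sum>i\<in>UNIV. c i *s row i ?M) = 0 \<longleftrightarrow>
      (\<forall>i. vdot (rat_vec (column i A)) (\<chi> j. c j) = 0 \<and> vdot (rat_vec (column i B)) (\<chi> j. c j) = 0)"
    for c :: "'r \<Rightarrow> rat"
  proof -
    have "(\<Sum>i\<in>UNIV. c i *s row i ?M) $ j = (case j of
        Inl i \<Rightarrow> vdot (rat_vec (column i A)) (\<chi> j. c j) | Inr i \<Rightarrow> vdot (rat_vec (column i B)) (\<chi> j. c j))" for j
      by (cases j) (simp_all add: sum_component row_def hconcat_def map_matrix_def vdot_def column_def mult.commute)
    thus ?thesis unfolding vec_eq_iff by (auto simp: split_sum_all)
  qed
  show ?thesis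
    unfolding rank_eq_card_rows eq kernel_free_def
  proof safe
    fix k assume *: "\<forall>c. (\<forall>i. vdot (rat_vec (column i A)) (\<chi> j. c j) = 0 \<and>
        vdot (rat_vec (column i B)) (\<chi> j. c j) = 0) \<longrightarrow> (\<forall>i. c i = 0)"
      and k: "\<forall>i. int_dot (column i A) k = 0 \<and> int_dot (column i B) k = 0"
    have "\<forall>j. rat_of_int (k $ j) = 0"
      using *[rule_format, of "\<lambda>j. of_int (k $ j)"] k by (auto simp: vdot_rat_vec)
    thus "k = 0" by (simp add: vec_eq_iff)
  next
    fix c j assume *: "\<forall>k. (\<forall>i. int_dot (column i A) k = 0 \<and> int_dot (column i B) k = 0) \<longrightarrow> k = 0"
      and c: "\<forall>i. vdot (rat_vec (column i A)) (\<chi> j. c j) = 0 \<and> vdot (rat_vec (column i B)) (\<chi> j. c j) = 0"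
    obtain D k where D: "0 < D" "\<And>j. of_int (k $ j) = of_int D * (\<chi> j. c j) $ j"
      using common_denominator[of "\<chi> j. c j"] by blast
    have "rat_vec k = of_int D *s (\<chi> j. c j)" using D(2) by (simp add: vec_eq_iff)
    hence "of_int (int_dot (column i A) k) = (0::rat) \<and> of_int (int_dot (column i B) k) = (0::rat)" for i
      using c unfolding vdot_rat_vec[symmetric] by simp
    hence "k = 0" using * by simp
    thus "c j = 0" using D(2)[of j] D(1) by simp
  qed
qed

text \<open>
  Behaviour near the ray on which \<open>r = 0\<close>: even if \<open>d\<close> is negative, the product \<open>p * r\<close> outweighs \<open>d * r\<close> as soon as
  \<open>p > - d\<close>, and otherwise \<open>r \<le> p\<close> is bounded.
\<close>

lemma sector_bound:
  fixes p r :: rat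
  assumes "0 \<le> r" "r \<le> p" "0 < c" "x \<le> p"
  shows "c * x - d\<^sup>2 \<le> p * r + c * p + d * r"
proof -
  have "- (d\<^sup>2) \<le> r * (p + d)"
  proof (cases "0 \<le> p + d")
    case True
    have "- (d\<^sup>2) \<le> 0" by simp
    also have "0 \<le> r * (p + d)" using True assms by simp
    finally show ?thesis .
  next
    case False
    have "- (d\<^sup>2) = (- d) * d" by (simp add: power2_eq_square)
    also have "\<dots> \<le> r * d" using False assms by (intro mult_right_mono_neg) auto
    also have "\<dots> \<le> r * (p + d)" using assms by (intro mult_left_mono) auto
    finally show ?thesis .
  qed
  moreover have "c * x \<le> c * p" using assms by simp
  ultimately show ?thesis by (simp add: algebra_simps)
qed

text \<open>
  The coefficient that an index structure is required to make positive: \<open>1, 2, 3\<close> name the rays through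
  \<open>(m, e) = (0, 1)\<close>, \<open>(1, -1)\<close> and \<open>(-1, 0)\<close>.
\<close>

definition ray_coeff :: "nat \<Rightarrow> rat \<Rightarrow> rat \<Rightarrow> rat \<Rightarrow> rat" where
  "ray_coeff q a b c = (if q = 1 then a else if q = 2 then b else c)"

text \<open>
  The ray \<open>q\<close> is the one nearest to \<open>(m, e)\<close>, and it does not depend on the weights \<open>a, b, c\<close>. In each cone,
  adding \<open>a e - c m\<close> and using \<open>a + b + c = 1\<close> gives \<open>p r\<close> plus a linear form in the cone coordinates
  \<open>p, r\<close> whose coefficients are the weights of the two bounding rays.
\<close>

lemma tetra_degree_lower:
  "\<exists>q\<in>{1, 2, 3}. \<forall>a b c. a + b + c = 1 \<longrightarrow> 0 < ray_coeff q a b c \<longrightarrow>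
     ray_coeff q a b c * of_int (max \<bar>m\<bar> \<bar>e\<bar>) - (a\<^sup>2 + b\<^sup>2 + c\<^sup>2)
       \<le> of_int (tetra_degree m e) + a * of_int e - c * of_int m"
    (is "\<exists>q\<in>_. \<forall>a b c. _ \<longrightarrow> _ \<longrightarrow> _ * ?x - _ \<le> _")
proof -
  have main: ?thesis
    if q: "q \<in> {1, 2, 3}" and pr: "0 \<le> r" "r \<le> p" "max \<bar>m\<bar> \<bar>e\<bar> \<le> p"
      and d: "\<And>a b c. d a b c \<in> {a, b, c}"
      and eq: "\<And>a b::rat. of_int (tetra_degree m e) + a * of_int e - (1 - a - b) * of_int m
        = of_int p * of_int r + ray_coeff q a b (1 - a - b) * of_int p + d a b (1 - a - b) * of_int r" for q p r d
  proof (intro bexI[of _ q] allI impI)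
    fix a b c :: rat assume s: "a + b + c = 1" "0 < ray_coeff q a b c"
    have c1: "c = 1 - a - b" using s(1) by simp
    have "ray_coeff q a b c * ?x - (d a b c)\<^sup>2 \<le> of_int (tetra_degree m e) + a * of_int e - c * of_int m"
      unfolding eq[of a b, folded c1] using pr s by (intro sector_bound) (simp_all only: of_int_le_iff of_int_0_le_iff)
    moreover have "(d a b c)\<^sup>2 \<le> a\<^sup>2 + b\<^sup>2 + c\<^sup>2" using d[of a b c] by auto
    ultimately show "ray_coeff q a b c * ?x - (a\<^sup>2 + b\<^sup>2 + c\<^sup>2)
        \<le> of_int (tetra_degree m e) + a * of_int e - c * of_int m" by linarith
  qed (use q in auto)
  \<comment> \<open>Three cones, each divided according to the larger cone coordinate \<open>p\<close>, whose ray is the nearer one.\<close>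
  consider "m \<ge> 0" "m + e \<ge> 0" "m \<le> m + e" | "m \<ge> 0" "m + e \<ge> 0" "m + e \<le> m"
    | "m \<le> 0" "e \<ge> 0" "- m \<le> e" | "m \<le> 0" "e \<ge> 0" "e \<le> - m"
    | "e \<le> 0" "m + e \<le> 0" "- e \<le> - m - e" | "e \<le> 0" "m + e \<le> 0" "- m - e \<le> - e"
    by linarith
  thus ?thesis
  proof cases
    case 1
    show ?thesis by (rule main[of 1 m "m + e" "\<lambda>a b c. b"])
      (use 1 in \<open>auto simp: tetra_degree_I ray_coeff_def algebra_simps\<close>)
  next
    case 2
    show ?thesis by (rule main[of 2 "m + e" m "\<lambda>a b c. a"])
      (use 2 in \<open>auto simp: tetra_degree_I ray_coeff_def algebra_simps\<close>)
  next
    case 3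
    show ?thesis by (rule main[of 1 "- m" e "\<lambda>a b c. c"])
      (use 3 in \<open>auto simp: tetra_degree_II ray_coeff_def algebra_simps\<close>)
  next
    case 4
    show ?thesis by (rule main[of 3 e "- m" "\<lambda>a b c. a"])
      (use 4 in \<open>auto simp: tetra_degree_II ray_coeff_def algebra_simps\<close>)
  next
    case 5
    show ?thesis by (rule main[of 3 "- e" "- m - e" "\<lambda>a b c. b"])
      (use 5 in \<open>auto simp: tetra_degree_III ray_coeff_def algebra_simps\<close>)
  next
    case 6
    show ?thesis by (rule main[of 2 "- m - e" "- e" "\<lambda>a b c. c"])
      (use 6 in \<open>auto simp: tetra_degree_III ray_coeff_def algebra_simps\<close>)
  qed
qed

lemma finite_bounded_dots:
  fixes A B :: "int^'s^'r"
  assumes "kernel_free A B"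
  shows "finite {k. \<forall>i. \<bar>m $ i - int_dot (column i B) k\<bar> \<le> R \<and> \<bar>e $ i + int_dot (column i A) k\<bar> \<le> R}"
    (is "finite ?K")
proof (rule finite_imageD)
  let ?f = "\<lambda>k i. (m $ i - int_dot (column i B) k, e $ i + int_dot (column i A) k)"
  have "?f ` ?K \<subseteq> (\<Pi>\<^sub>E i\<in>UNIV. {- R..R} \<times> {- R..R})"
    by (rule image_subsetI, simp only: PiE_UNIV_domain Pi_iff mem_Collect_eq mem_Times_iff
          fst_conv snd_conv atLeastAtMost_iff abs_le_iff) (meson minus_le_iff)
  thus "finite (?f ` ?K)" by (rule finite_subset) (simp add: finite_PiE)
  show "inj_on ?f ?K"
  proof (rule inj_onI)
    fix k l assume eq: "?f k = ?f l"
    have "int_dot (column i A) (k - l) = 0 \<and> int_dot (column i B) (k - l) = 0" for i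
      using fun_cong[OF eq, of i] by (simp add: int_dot_vdot vdot_diff_right)
    hence "k - l = 0" using assms unfolding kernel_free_def by blast
    thus "k = l" by simp
  qed
qed

text \<open>
  There are finitely many choices \<open>Q\<close> of nearest rays, and for each of them the index structure
  belonging to \<open>Q\<close> bounds all arguments of the tetrahedron indices.
\<close>

lemma supports_imp_finite_degree:
  fixes A B :: "int^'s^'r"
  assumes "supports_index_structure A B v"
  shows "finite {k. summand_degree A B v m e k \<le> n}"
proof -
  define y where "y k i = m $ i - int_dot (column i B) k" for k i
  define x where "x k i = e $ i + int_dot (column i A) k" for k i
  define good where "good q m e \<longleftrightarrow> (\<forall>a b c. a + b + c = 1 \<longrightarrow> 0 < ray_coeff q a b c \<longrightarrow>
     ray_coeff q a b c * of_int (max \<bar>m\<bar> \<bar>e\<bar>) - (a\<^sup>2 + b\<^sup>2 + c\<^sup>2)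
       \<le> of_int (tetra_degree m e) + a * of_int e - c * of_int m)" for q m e
  have kf: "kernel_free A B"
    using assms unfolding supports_index_structure_def rank_hconcat by blast
  define QQ where "QQ = (\<Pi>\<^sub>E i\<in>(UNIV::'s set). {1, 2, 3::nat})"
  have "\<exists>Q\<in>QQ. \<forall>i. good (Q i) (y k i) (x k i)" for k
  proof -
    have "\<forall>i. \<exists>q. q \<in> {1, 2, 3} \<and> good q (y k i) (x k i)"
      using tetra_degree_lower unfolding good_def by blast
    from choice[OF this] obtain Q where "\<forall>i. Q i \<in> {1, 2, 3} \<and> good (Q i) (y k i) (x k i)" ..
    thus ?thesis unfolding QQ_def by (intro bexI[of _ Q]) auto
  qed
  hence "{k. summand_degree A B v m e k \<le> n} \<subseteq>
      (\<Union>Q\<in>QQ. {k. summand_degree A B v m e k \<le> n \<and> (\<forall>i. good (Q i) (y k i) (x k i))})"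
    by blast
  moreover have "finite (\<Union>Q\<in>QQ. {k. summand_degree A B v m e k \<le> n \<and> (\<forall>i. good (Q i) (y k i) (x k i))})"
  proof (rule finite_UN_I)
    show "finite QQ" unfolding QQ_def by (intro finite_PiE) auto
  next
    fix Q assume "Q \<in> QQ"
    hence Q: "Q i \<in> {1, 2, 3}" for i by (auto simp: QQ_def PiE_iff)
    hence "range Q \<subseteq> {1, 2, 3}" by blast
    then obtain \<alpha> \<beta> \<gamma> :: "rat^'s" where abc:
      "map_matrix rat_of_int A *v \<alpha> + map_matrix rat_of_int B *v \<gamma> = rat_vec v"
      "\<alpha> + \<beta> + \<gamma> = (\<chi> i. 1)"
      "\<And>i. (Q i = 1 \<longrightarrow> \<alpha> $ i > 0) \<and> (Q i = 2 \<longrightarrow> \<beta> $ i > 0) \<and> (Q i = 3 \<longrightarrow> \<gamma> $ i > 0)"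
      using assms unfolding supports_index_structure_def by metis
    define c where "c i = ray_coeff (Q i) (\<alpha> $ i) (\<beta> $ i) (\<gamma> $ i)" for i
    have c: "0 < c i" for i using abc(3)[of i] Q[of i] by (auto simp: c_def ray_coeff_def)
    have sum1: "\<alpha> $ i + \<beta> $ i + \<gamma> $ i = 1" for i using abc(2) by (simp add: vec_eq_iff)
    define s where "s i = (\<alpha> $ i)\<^sup>2 + (\<beta> $ i)\<^sup>2 + (\<gamma> $ i)\<^sup>2" for i
    define C where "C = of_int n + (\<Sum>i\<in>UNIV. \<alpha> $ i * of_int (e $ i) - \<gamma> $ i * of_int (m $ i) + s i)"
    \<comment> \<open>The equation of the index structure, paired with \<open>k\<close>.\<close>
    have vk: "of_int (int_dot v k) =
        (\<Sum>i\<in>UNIV. \<alpha> $ i * of_int (int_dot (column i A) k) + \<gamma> $ i * of_int (int_dot (column i B) k))" for k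
      unfolding vdot_rat_vec[symmetric] abc(1)[symmetric]
      by (simp add: vdot_add_left mat_vec_columns vdot_sum_left column_map_of_int sum.distrib)
    have bound: "(\<Sum>i\<in>UNIV. c i * of_int (max \<bar>y k i\<bar> \<bar>x k i\<bar>)) \<le> C"
      if k: "summand_degree A B v m e k \<le> n" and good: "\<And>i. good (Q i) (y k i) (x k i)" for k
    proof -
      have "(\<Sum>i\<in>UNIV. c i * of_int (max \<bar>y k i\<bar> \<bar>x k i\<bar>) - s i) \<le>
        (\<Sum>i\<in>UNIV. of_int (tetra_degree (y k i) (x k i)) + \<alpha> $ i * of_int (x k i) - \<gamma> $ i * of_int (y k i))"
      proof (rule sum_mono)
        fix i
        show "c i * of_int (max \<bar>y k i\<bar> \<bar>x k i\<bar>) - s i \<le>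
          of_int (tetra_degree (y k i) (x k i)) + \<alpha> $ i * of_int (x k i) - \<gamma> $ i * of_int (y k i)"
          using good[of i] sum1[of i] c[of i] unfolding good_def c_def s_def by blast
      qed
      also have "\<dots> = of_int (summand_degree A B v m e k)
          + (\<Sum>i\<in>UNIV. \<alpha> $ i * of_int (e $ i) - \<gamma> $ i * of_int (m $ i))"
        unfolding summand_degree_def of_int_add vk of_int_sum
        by (simp add: x_def y_def algebra_simps sum.distrib sum_subtractf)
      finally show ?thesis using k by (simp add: C_def sum.distrib sum_subtractf)
    qed
    \<comment> \<open>All terms of the sum are nonnegative, so each of them is bounded by \<open>C\<close>.\<close>
    define R where "R = Max (range (\<lambda>i. \<lceil>C / c i\<rceil>))"
    have "\<bar>y k i\<bar> \<le> R \<and> \<bar>x k i\<bar> \<le> R"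
      if k: "summand_degree A B v m e k \<le> n" and good: "\<And>i. good (Q i) (y k i) (x k i)" for k i
    proof -
      have "c i * of_int (max \<bar>y k i\<bar> \<bar>x k i\<bar>) \<le> (\<Sum>i\<in>UNIV. c i * of_int (max \<bar>y k i\<bar> \<bar>x k i\<bar>))"
        by (rule member_le_sum) (auto intro!: mult_nonneg_nonneg less_imp_le[OF c])
      also have "\<dots> \<le> C" by (rule bound[OF k good])
      finally have "of_int (max \<bar>y k i\<bar> \<bar>x k i\<bar>) \<le> C / c i"
        using c[of i] by (simp add: field_simps)
      hence "max \<bar>y k i\<bar> \<bar>x k i\<bar> \<le> \<lceil>C / c i\<rceil>" by linarith
      also have "\<dots> \<le> R" unfolding R_def by (intro Max_ge) auto
      finally show ?thesis by simp
    qed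
    hence "{k. summand_degree A B v m e k \<le> n \<and> (\<forall>i. good (Q i) (y k i) (x k i))} \<subseteq>
      {k. \<forall>i. \<bar>m $ i - int_dot (column i B) k\<bar> \<le> R \<and> \<bar>e $ i + int_dot (column i A) k\<bar> \<le> R}"
      unfolding x_def y_def by blast
    thus "finite {k. summand_degree A B v m e k \<le> n \<and> (\<forall>i. good (Q i) (y k i) (x k i))}"
      using finite_bounded_dots[OF kf] finite_subset by blast
  qed
  ultimately show ?thesis using finite_subset by blast
qed

text \<open>
  The hypotheses on \<open>k\<close> place each argument on the ray named by \<open>Q i\<close>. Degrees are linear along these rays, so
  the degree at \<open>t k\<close> is \<open>t\<close> times the right-hand side, which finiteness forces to be positive.
\<close>

lemma finite_degree_imp_no_ray:
  fixes A B :: "int^'s^'r"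
  assumes fin: "finite {k. summand_degree A B v 0 0 k \<le> 0}" and k: "k \<noteq> 0"
    and Q: "\<And>i. Q i \<in> {1, 2, 3::nat}"
    and 1: "\<And>i. Q i = 1 \<Longrightarrow> 0 \<le> int_dot (column i A) k \<and> int_dot (column i B) k = 0"
    and 2: "\<And>i. Q i = 2 \<Longrightarrow> int_dot (column i B) k \<le> 0 \<and> int_dot (column i A) k = int_dot (column i B) k"
    and 3: "\<And>i. Q i = 3 \<Longrightarrow> 0 \<le> int_dot (column i B) k \<and> int_dot (column i A) k = 0"
  shows "0 < int_dot v k - (\<Sum>i | Q i = 2. int_dot (column i B) k)"
proof (rule ccontr)
  assume neg: "\<not> ?thesis"
  have "summand_degree A B v 0 0 (int t *s k) \<le> 0" for t :: nat
  proof -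
    have "tetra_degree (- (int t * int_dot (column i B) k)) (int t * int_dot (column i A) k) =
        int t * (if Q i = 2 then - int_dot (column i B) k else 0)" for i
    proof -
      consider "Q i = 1" | "Q i = 2" | "Q i = 3" using Q[of i] by auto
      thus ?thesis
      proof cases
        case a: 1
        thus ?thesis using 1[OF a] by (simp add: tetra_degree_II)
      next
        case a: 2
        thus ?thesis using 2[OF a] by (simp add: tetra_degree_I mult_nonneg_nonpos)
      next
        case a: 3
        thus ?thesis using 3[OF a] by (simp add: tetra_degree_II)
      qed
    qed
    hence "summand_degree A B v 0 0 (int t *s k) =
        int t * (int_dot v k + (\<Sum>i\<in>UNIV. if Q i = 2 then - int_dot (column i B) k else 0))"
      by (simp add: summand_degree_def int_dot_vdot distrib_left sum_distrib_left)
    also have "(\<Sum>i\<in>UNIV. if Q i = 2 then - int_dot (column i B) k else 0) =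
        - (\<Sum>i | Q i = 2. int_dot (column i B) k)"
      by (simp add: sum.If_cases sum_negf)
    finally show ?thesis using neg by (simp add: mult_nonneg_nonpos)
  qed
  hence "range (\<lambda>t. int t *s k) \<subseteq> {k. summand_degree A B v 0 0 k \<le> 0}" by auto
  hence "finite (range (\<lambda>t. int t *s k))" using fin finite_subset by blast
  moreover have "inj (\<lambda>t. int t *s k)"
  proof (rule injI)
    fix s t assume eq: "int s *s k = int t *s k"
    obtain j where "k $ j \<noteq> 0" using k by (auto simp: vec_eq_iff)
    thus "s = t" using arg_cong[OF eq, of "\<lambda>z. z $ j"] by simp
  qed
  ultimately show False using finite_imageD infinite_UNIV_nat by blast
qed

text \<open>
  For given \<open>Q\<close>, eliminating \<open>\<beta>\<close> turns the conditions on \<open>(\<alpha>, \<beta>, \<gamma>)\<close> into: \<open>v'\<close> is a combination of vectors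
  \<open>u i\<close> with positive coefficients and of vectors \<open>w i\<close> with arbitrary coefficients. A vector that obstructs
  this satisfies, after clearing denominators, exactly the hypotheses of \<open>finite_degree_imp_no_ray\<close>.
\<close>

lemma finite_degree_imp_supports:
  fixes A B :: "int^'s^'r"
  assumes fin: "finite {k. summand_degree A B v 0 0 k \<le> 0}"
  shows "supports_index_structure A B v"
  unfolding supports_index_structure_def rank_hconcat
proof (intro conjI allI impI)
  show "kernel_free A B"
    unfolding kernel_free_def
  proof (intro allI impI, rule ccontr)
    fix k assume k: "\<forall>i. int_dot (column i A) k = 0 \<and> int_dot (column i B) k = 0" "k \<noteq> 0"
    \<comment> \<open>A kernel vector satisfies the hypotheses for every choice of rays, and so does its negative.\<close>
    have "0 < int_dot v k - (\<Sum>i | (\<lambda>_. 1::nat) i = 2. int_dot (column i B) k)"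
      by (rule finite_degree_imp_no_ray[OF fin k(2)]) (use k in auto)
    moreover have "0 < int_dot v (- k) - (\<Sum>i | (\<lambda>_. 1::nat) i = 2. int_dot (column i B) (- k))"
      by (rule finite_degree_imp_no_ray[OF fin]) (use k in \<open>auto simp: int_dot_vdot\<close>)
    ultimately show False by (simp add: int_dot_vdot)
  qed
next
  fix Q :: "'s \<Rightarrow> nat" assume "range Q \<subseteq> {1, 2, 3}"
  hence Q: "Q i \<in> {1, 2, 3}" for i by blast
  define a where "a i = rat_vec (column i A)" for i
  define b where "b i = rat_vec (column i B)" for i
  \<comment> \<open>The coefficient of \<open>u i\<close> is the one to be made positive, that of \<open>w i\<close> is free. If \<open>Q i = 2\<close>, then
    \<open>\<gamma> = 1 - \<alpha> - \<beta>\<close> gives \<open>\<alpha> a + \<gamma> b = b + \<beta> (- b) + \<alpha> (a - b)\<close>; the constant \<open>b\<close> moves to \<open>v'\<close>.\<close>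
  define u where "u i = (if Q i = 1 then a i else if Q i = 2 then - b i else b i)" for i
  define w where "w i = (if Q i = 1 then b i else if Q i = 2 then a i - b i else a i)" for i
  define v' where "v' = rat_vec v - (\<Sum>i | Q i = 2. b i)"
  obtain l n where ln: "\<And>i. 0 < l i" "v' = (\<Sum>i\<in>UNIV. l i *s u i) + (\<Sum>i\<in>UNIV. n i *s w i)"
  proof (rule strict_farkas[of u w v'])
    fix x assume x: "x \<noteq> 0" "\<And>i. 0 \<le> vdot (u i) x" "\<And>i. vdot (w i) x = 0"
    obtain D k where D: "0 < D" "\<And>j. of_int (k $ j) = of_int D * x $ j"
      using common_denominator[of x] by blast
    have k: "rat_vec k = of_int D *s x" using D(2) by (simp add: vec_eq_iff)
    have ak: "of_int (int_dot (column i A) k) = of_int D * vdot (a i) x"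
      and bk: "of_int (int_dot (column i B) k) = of_int D * vdot (b i) x" for i
      unfolding vdot_rat_vec[symmetric] k a_def b_def by simp_all
    have "0 < int_dot v k - (\<Sum>i | Q i = 2. int_dot (column i B) k)"
    proof (rule finite_degree_imp_no_ray[OF fin _ Q])
      obtain j where "x $ j \<noteq> 0" using x(1) by (auto simp: vec_eq_iff)
      thus "k \<noteq> 0" using D(1) D(2)[of j] by auto
    next
      fix i
      have D': "(0::rat) < of_int D" using D(1) by simp
      note facts = x(2)[of i] x(3)[of i] D'
      show "0 \<le> int_dot (column i A) k \<and> int_dot (column i B) k = 0" if "Q i = 1"
      proof -
        have "(0::rat) \<le> of_int (int_dot (column i A) k) \<and> of_int (int_dot (column i B) k) = (0::rat)"
          unfolding ak bk using facts that by (simp add: u_def w_def)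
        thus ?thesis by simp
      qed
      show "0 \<le> int_dot (column i B) k \<and> int_dot (column i A) k = 0" if "Q i = 3"
      proof -
        have "(0::rat) \<le> of_int (int_dot (column i B) k) \<and> of_int (int_dot (column i A) k) = (0::rat)"
          unfolding ak bk using facts that by (simp add: u_def w_def)
        thus ?thesis by simp
      qed
      show "int_dot (column i B) k \<le> 0 \<and> int_dot (column i A) k = int_dot (column i B) k" if "Q i = 2"
      proof -
        have "of_int (int_dot (column i B) k) \<le> (0::rat)
            \<and> of_int (int_dot (column i A) k) = rat_of_int (int_dot (column i B) k)"
          unfolding ak bk using facts that
          by (simp add: u_def w_def vdot_diff_left mult_nonneg_nonpos)
        thus ?thesis by simp
      qed
    qed
    hence "(0::rat) < of_int (int_dot v k - (\<Sum>i | Q i = 2. int_dot (column i B) k))"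
      unfolding of_int_0_less_iff .
    also have "\<dots> = of_int (int_dot v k) - (\<Sum>i | Q i = 2. of_int (int_dot (column i B) k))"
      by simp
    also have "of_int (int_dot v k) = of_int D * vdot (rat_vec v) x"
      unfolding vdot_rat_vec[symmetric] k by simp
    also have "(\<Sum>i | Q i = 2. of_int (int_dot (column i B) k)) = of_int D * vdot (\<Sum>i | Q i = 2. b i) x"
      unfolding bk by (simp add: vdot_sum_left sum_distrib_left)
    finally have "0 < of_int D * vdot v' x"
      by (simp add: v'_def vdot_diff_left algebra_simps)
    thus "0 < vdot v' x" using D(1) by (simp add: zero_less_mult_iff)
  qed blast
  define al where "al i = (if Q i = 1 then l i else n i)" for i
  define ga where "ga i = (if Q i = 1 then n i else if Q i = 2 then 1 - l i - n i else l i)" for i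
  have "rat_vec v = v' + (\<Sum>i | Q i = 2. b i)" by (simp add: v'_def)
  also have "(\<Sum>i | Q i = 2. b i) = (\<Sum>i\<in>UNIV. if Q i = 2 then b i else 0)"
    by (simp add: sum.If_cases)
  also have "v' + \<dots> = (\<Sum>i\<in>UNIV. l i *s u i + n i *s w i + (if Q i = 2 then b i else 0))"
    unfolding ln(2) by (simp add: sum.distrib)
  also have "\<dots> = (\<Sum>i\<in>UNIV. al i *s a i + ga i *s b i)"
  proof (rule sum.cong)
    fix i
    show "l i *s u i + n i *s w i + (if Q i = 2 then b i else 0) = al i *s a i + ga i *s b i"
      using Q[of i] by (auto simp: u_def w_def al_def ga_def vec_eq_iff algebra_simps)
  qed simp
  finally have v: "rat_vec v = (\<Sum>i\<in>UNIV. al i *s a i) + (\<Sum>i\<in>UNIV. ga i *s b i)"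
    by (simp add: sum.distrib)
  show "\<exists>\<alpha> \<beta> \<gamma> :: rat^'s.
          map_matrix rat_of_int A *v \<alpha> + map_matrix rat_of_int B *v \<gamma> = rat_vec v \<and>
          \<alpha> + \<beta> + \<gamma> = (\<chi> i. 1) \<and>
          (\<forall>i. (Q i = 1 \<longrightarrow> \<alpha> $ i > 0) \<and> (Q i = 2 \<longrightarrow> \<beta> $ i > 0) \<and> (Q i = 3 \<longrightarrow> \<gamma> $ i > 0))"
  proof (intro exI conjI allI)
    show "map_matrix rat_of_int A *v (\<chi> i. al i) + map_matrix rat_of_int B *v (\<chi> i. ga i) = rat_vec v"
      unfolding v by (simp add: mat_vec_columns column_map_of_int a_def b_def)
    show "(\<chi> i. al i) + (\<chi> i. 1 - al i - ga i) + (\<chi> i. ga i) = (\<chi> i. 1)"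
      by (simp add: vec_eq_iff)
    show "Q i = 1 \<longrightarrow> 0 < (\<chi> i. al i) $ i" "Q i = 2 \<longrightarrow> 0 < (\<chi> i. 1 - al i - ga i) $ i"
      "Q i = 3 \<longrightarrow> 0 < (\<chi> i. ga i) $ i" for i
      using ln(1)[of i] by (auto simp: al_def ga_def)
  qed
qed

theorem converges_iff_supports:
  "(\<forall>m e. laurent_sum_converges (index_summand A B v m e) UNIV) \<longleftrightarrow> supports_index_structure A B v"
  unfolding laurent_sum_converges_iff_locally_finite locally_finite_iff_degree[OF index_summand_degree]
  using supports_imp_finite_degree finite_degree_imp_supports by blast

section \<open>Loss of dimension under a map with large kernel\<close>

text \<open>
  Summation is defined and linear only on convergent families, not on all functions; linearity on a
  subspace is what remains.
\<close>

definition linear_on_space ::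
  "('a \<Rightarrow> 'b::ab_group_add \<Rightarrow> 'b) \<Rightarrow> ('a \<Rightarrow> 'c::ab_group_add \<Rightarrow> 'c) \<Rightarrow> 'b set \<Rightarrow> ('b \<Rightarrow> 'c) \<Rightarrow> bool" where
  "linear_on_space s1 s2 W f \<longleftrightarrow>
     (\<forall>u\<in>W. \<forall>v\<in>W. f (u + v) = f u + f v) \<and> (\<forall>c. \<forall>u\<in>W. f (s1 c u) = s2 c (f u))"

lemma linear_on_space_subset:
  "linear_on_space s1 s2 W f \<Longrightarrow> V \<subseteq> W \<Longrightarrow> linear_on_space s1 s2 V f"
  unfolding linear_on_space_def by blast

lemma (in vector_space) dim_mono_finite_span:
  assumes "finite T" "V \<subseteq> span T" "W \<subseteq> V"
  shows "dim W \<le> dim V"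
proof -
  obtain B where B: "B \<subseteq> V" "independent B" "V \<subseteq> span B" "card B = dim V"
    using basis_exists by blast
  have "finite B" using independent_span_bound[OF assms(1) B(2)] B(1) assms(2) by blast
  thus ?thesis using dim_le_card[of W B] B(3,4) assms(3) by auto
qed

context vector_space_pair
begin

lemma linear_on_space_0:
  assumes "vs1.subspace W" "linear_on_space s1 s2 W f"
  shows "f 0 = 0"
proof -
  have "f (s1 0 0) = s2 0 (f 0)"
    using assms vs1.subspace_0 unfolding linear_on_space_def by blast
  thus ?thesis by simp
qed

lemma linear_on_space_image_subspace:
  assumes W: "vs1.subspace W" and f: "linear_on_space s1 s2 W f"
  shows "vs2.subspace (f ` W)"
proof (rule vs2.subspaceI)
  show "0 \<in> f ` W" using linear_on_space_0[OF assms] vs1.subspace_0[OF W] by (metis image_eqI)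
next
  fix x y assume "x \<in> f ` W" "y \<in> f ` W"
  then obtain u v where uv: "u \<in> W" "v \<in> W" "x = f u" "y = f v" by blast
  hence "x + y = f (u + v)" using f by (simp add: linear_on_space_def)
  thus "x + y \<in> f ` W" using vs1.subspace_add[OF W] uv by blast
next
  fix c x assume "x \<in> f ` W"
  then obtain u where u: "u \<in> W" "x = f u" by blast
  hence "s2 c x = f (s1 c u)" using f by (simp add: linear_on_space_def)
  thus "s2 c x \<in> f ` W" using vs1.subspace_scale[OF W] u by blast
qed

lemma linear_on_space_image_span:
  assumes W: "vs1.subspace W" and f: "linear_on_space s1 s2 W f" and B: "B \<subseteq> W"
  shows "f ` vs1.span B \<subseteq> vs2.span (f ` B)"
proof
  fix y assume "y \<in> f ` vs1.span B"
  then obtain x where x: "x \<in> vs1.span B" "y = f x" by blast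
  have "x \<in> W \<and> f x \<in> vs2.span (f ` B)" using x(1)
  proof (induction x rule: vs1.span_induct_alt)
    case base
    show ?case using vs1.subspace_0[OF W] linear_on_space_0[OF W f] by (simp add: vs2.span_zero)
  next
    case (step c x y)
    have x: "x \<in> W" using step B by blast
    have "f (s1 c x + y) = s2 c (f x) + f y"
      using f x step vs1.subspace_scale[OF W] unfolding linear_on_space_def by metis
    moreover have "s2 c (f x) + f y \<in> vs2.span (f ` B)"
      using step by (blast intro: vs2.span_add vs2.span_scale vs2.span_base)
    ultimately show ?case
      using x step vs1.subspace_scale[OF W] vs1.subspace_add[OF W] by simp
  qed
  thus "y \<in> vs2.span (f ` B)" using x by simp
qed

lemma dim_image_le_on:
  assumes W: "vs1.subspace W" and f: "linear_on_space s1 s2 W f"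
    and fin: "finite T" "W \<subseteq> vs1.span T"
  shows "vs2.dim (f ` W) \<le> vs1.dim W"
proof -
  obtain B where B: "B \<subseteq> W" "vs1.independent B" "W \<subseteq> vs1.span B" "card B = vs1.dim W"
    using vs1.basis_exists by blast
  have finB: "finite B" using vs1.independent_span_bound[OF fin(1) B(2)] B(1) fin(2) by blast
  have "f ` W \<subseteq> vs2.span (f ` B)" using linear_on_space_image_span[OF W f B(1)] B(3) by blast
  hence "vs2.dim (f ` W) \<le> card (f ` B)" using finB by (intro vs2.dim_le_card) auto
  also have "\<dots> \<le> card B" by (rule card_image_le[OF finB])
  finally show ?thesis using B(4) by simp
qed

lemma linear_on_space_image_finite_span:
  assumes W: "vs1.subspace W" and f: "linear_on_space s1 s2 W f"
    and fin: "finite T" "W \<subseteq> vs1.span T"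
  shows "\<exists>T'. finite T' \<and> f ` W \<subseteq> vs2.span T'"
proof -
  obtain B where B: "B \<subseteq> W" "vs1.independent B" "W \<subseteq> vs1.span B" "card B = vs1.dim W"
    using vs1.basis_exists by blast
  have "finite B" using vs1.independent_span_bound[OF fin(1) B(2)] B(1) fin(2) by blast
  moreover have "f ` W \<subseteq> vs2.span (f ` B)"
    using linear_on_space_image_span[OF W f B(1)] B(3) by blast
  ultimately show ?thesis by blast
qed

text \<open>
  The source of the loss of dimension: \<open>E\<close> embeds \<open>U'\<close> into the kernel of \<open>f\<close> on \<open>U\<close>. A basis of \<open>E U'\<close>
  is completed to a basis of \<open>U\<close>, and only the added vectors contribute to the image.
\<close>

lemma dim_image_drop:
  assumes U: "vs1.subspace U" and f: "linear_on_space s1 s2 U f"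
    and fin: "finite T" "U \<subseteq> vs1.span T"
    and U': "vs1.subspace U'" and E: "Vector_Spaces.linear s1 s1 E" "inj_on E U'" "E ` U' \<subseteq> U" "U' \<subseteq> U"
    and ker: "\<And>u. u \<in> U' \<Longrightarrow> f (E u) = 0"
  shows "vs2.dim (f ` U) + vs1.dim U' \<le> vs1.dim U"
proof -
  interpret p: vector_space_pair s1 s1 ..
  obtain B where B: "B \<subseteq> U'" "vs1.independent B" "U' \<subseteq> vs1.span B" "card B = vs1.dim U'"
    using vs1.basis_exists by blast
  have finB: "finite B" using vs1.independent_span_bound[OF fin(1) B(2)] B(1) fin(2) E(4) by blast
  have span: "vs1.span B \<subseteq> U'" using vs1.span_minimal[OF B(1) U'] .
  have indC: "vs1.independent (E ` B)"
    using p.linear_independent_injective_image[OF E(1) B(2)] inj_on_subset[OF E(2) span] by blast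
  have cardC: "card (E ` B) = card B"
    using card_image[OF inj_on_subset[OF E(2) B(1)]] .
  have "E ` B \<subseteq> U" using B(1) E(3) by blast
  then obtain D where D: "E ` B \<subseteq> D" "D \<subseteq> U" "vs1.independent D" "U \<subseteq> vs1.span D"
    using vs1.maximal_independent_subset_extend[OF _ indC] by metis
  have finD: "finite D" using vs1.independent_span_bound[OF fin(1) D(3)] D(2) fin(2) by blast
  have cardD: "card D = vs1.dim U" using vs1.basis_card_eq_dim[OF D(2,4,3)] .
  have "f ` U \<subseteq> vs2.span (f ` D)"
    using linear_on_space_image_span[OF U f D(2)] D(4) by blast
  also have "f ` D \<subseteq> insert 0 (f ` (D - E ` B))" using ker B(1) by blast
  hence "vs2.span (f ` D) \<subseteq> vs2.span (insert 0 (f ` (D - E ` B)))" by (rule vs2.span_mono)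
  also have "\<dots> = vs2.span (f ` (D - E ` B))" by simp
  finally have "vs2.dim (f ` U) \<le> card (f ` (D - E ` B))"
    using finD by (intro vs2.dim_le_card) auto
  also have "\<dots> \<le> card (D - E ` B)" using finD by (intro card_image_le) auto
  also have "\<dots> = vs1.dim U - vs1.dim U'"
    using D(1) finB cardC cardD B(4) by (simp add: card_Diff_subset)
  finally have "vs2.dim (f ` U) \<le> vs1.dim U - vs1.dim U'" .
  moreover have "vs1.dim U' \<le> vs1.dim U"
    using card_mono[OF finD D(1)] cardC cardD B(4) by simp
  ultimately show ?thesis by linarith
qed

end

interpretation q_pair: vector_space_pair
  "q_scale :: rat poly fract \<Rightarrow> ('a \<Rightarrow> rat fls) \<Rightarrow> 'a \<Rightarrow> rat fls"
  "q_scale :: rat poly fract \<Rightarrow> ('b \<Rightarrow> rat fls) \<Rightarrow> 'b \<Rightarrow> rat fls" ..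

section \<open>Summation over coordinates lowers the growth of dimension\<close>

text \<open>
  The first argument is the summation vector \<open>k\<close>, the second collects the parameters.
\<close>

type_synonym ('r, 'x) fam = "(int^'r) \<times> 'x \<Rightarrow> rat fls"

definition adic_sum :: "('k \<Rightarrow> 'a::comm_ring_1 fls) \<Rightarrow> 'k set \<Rightarrow> 'a fls" where
  "adic_sum g K = (THE S. adic_sums g K S)"

lemma adic_sum_eqI: "adic_sums g K S \<Longrightarrow> adic_sum g K = S"
  unfolding adic_sum_def using adic_sums_unique by blast

lemma adic_sums_adic_sum: "locally_finite g K \<Longrightarrow> adic_sums g K (adic_sum g K)"
  using locally_finite_imp_adic_sums adic_sum_eqI by metis

lemma locally_finite_cmult: "locally_finite g K \<Longrightarrow> locally_finite (\<lambda>k. c * g k) K"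
  using adic_sums_cmult locally_finite_iff_adic_sums by metis

lemma locally_finite_add: "locally_finite g K \<Longrightarrow> locally_finite h K \<Longrightarrow> locally_finite (\<lambda>k. g k + h k) K"
  using adic_sums_add locally_finite_iff_adic_sums by metis

lemma locally_finite_reindex: "bij_betw f A B \<Longrightarrow> locally_finite g B \<Longrightarrow> locally_finite (\<lambda>a. g (f a)) A"
  using adic_sums_reindex locally_finite_iff_adic_sums by metis

lemma bij_betw_add_left: "bij_betw (\<lambda>t. k + t) UNIV (UNIV :: 'a::group_add set)"
  by (rule bij_betw_byWitness[where f' = "\<lambda>t. - k + t"]) (auto simp: add.assoc[symmetric])

definition locfin_fams :: "('r::finite, 'x) fam set" where
  "locfin_fams = {u. \<forall>x. locally_finite (\<lambda>k. u (k, x)) UNIV}"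

lemma subspace_locfin_fams: "q_fun.subspace (locfin_fams :: ('r::finite, 'x) fam set)"
proof (rule q_fun.subspaceI)
  show "0 \<in> locfin_fams" by (simp add: locfin_fams_def locally_finite_def)
next
  fix u v :: "('r, 'x) fam" assume "u \<in> locfin_fams" "v \<in> locfin_fams"
  thus "u + v \<in> locfin_fams" by (simp add: locfin_fams_def locally_finite_add)
next
  fix c and u :: "('r, 'x) fam" assume "u \<in> locfin_fams"
  thus "q_scale c u \<in> locfin_fams" by (simp add: locfin_fams_def q_scale_def locally_finite_cmult)
qed

text \<open>
  The vectors supported on the coordinates in \<open>J\<close>, that is, the lattice over which the coordinates in
  \<open>J\<close> are summed out.
\<close>

definition coord_lattice :: "'r set \<Rightarrow> (int^'r) set" where
  "coord_lattice J = {t. \<forall>j. j \<notin> J \<longrightarrow> t $ j = 0}"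

text \<open>
  The result is kept as a function of all of \<open>k\<close>, although it no longer depends on the coordinates in \<open>J\<close>;
  all stages of the summation then live in the same space.
\<close>

definition sum_out :: "'r set \<Rightarrow> ('r::finite, 'x) fam \<Rightarrow> ('r::finite, 'x) fam" where
  "sum_out J u = (\<lambda>(k, x). adic_sum (\<lambda>t. u (k + t, x)) (coord_lattice J))"

lemma adic_sums_sum_out:
  assumes "u \<in> locfin_fams"
  shows "adic_sums (\<lambda>t. u (k + t, x)) (coord_lattice J) (sum_out J u (k, x))"
proof -
  have "locally_finite (\<lambda>t. u (k + t, x)) UNIV"
    using locally_finite_reindex[OF bij_betw_add_left, of "\<lambda>k. u (k, x)"] assms
    by (auto simp: locfin_fams_def)
  hence "locally_finite (\<lambda>t. u (k + t, x)) (coord_lattice J)" by (rule locally_finite_subset) simp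
  thus ?thesis unfolding sum_out_def by (simp add: adic_sums_adic_sum)
qed

lemma sum_out_eqI:
  assumes "\<And>k x. adic_sums (\<lambda>t. u (k + t, x)) (coord_lattice J) (w (k, x))"
  shows "sum_out J u = w"
  using adic_sum_eqI[OF assms] by (auto simp: sum_out_def fun_eq_iff)

lemma linear_on_sum_out: "linear_on_space q_scale q_scale locfin_fams (sum_out J)"
  unfolding linear_on_space_def
  by (auto intro!: sum_out_eqI adic_sums_add adic_sums_cmult adic_sums_sum_out simp: q_scale_def)

lemma sum_out_empty: "sum_out {} u = u"
proof (rule sum_out_eqI)
  fix k x
  have "coord_lattice {} = {0 :: int^'a}" by (auto simp: coord_lattice_def vec_eq_iff)
  thus "adic_sums (\<lambda>t. u (k + t, x)) (coord_lattice {}) (u (k, x))"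
    using adic_sums_finite[of "{0}" "\<lambda>t. u (k + t, x)"] by simp
qed

definition shift_k :: "'r \<Rightarrow> ('r::finite, 'x) fam \<Rightarrow> ('r::finite, 'x) fam" where
  "shift_k j u = (\<lambda>(k, x). u (k + axis j 1, x))"

lemma linear_shift_k: "Vector_Spaces.linear q_scale q_scale (shift_k j)"
  by (rule Vector_Spaces.linear_iff[THEN iffD2])
     (auto simp: shift_k_def q_scale_def fun_eq_iff intro: q_fun.vector_space_axioms)

lemma sum_out_shift_k:
  assumes "u \<in> locfin_fams"
  shows "sum_out J (shift_k j u) = shift_k j (sum_out J u)"
proof (rule sum_out_eqI)
  fix k x
  show "adic_sums (\<lambda>t. shift_k j u (k + t, x)) (coord_lattice J) (shift_k j (sum_out J u) (k, x))"
    using adic_sums_sum_out[OF assms, of "k + axis j 1" x J] by (simp add: shift_k_def add_ac)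
qed

text \<open>
  Summation over a coordinate kills \<open>L - 1\<close> for the shift \<open>L\<close> in that coordinate.
\<close>

lemma sum_out_shift_k_absorb:
  assumes "u \<in> locfin_fams" "j \<in> J"
  shows "sum_out J (shift_k j u) = sum_out J u"
proof (rule sum_out_eqI)
  fix k x
  have "bij_betw (\<lambda>t. t + axis j 1) (coord_lattice J) (coord_lattice J)"
    by (rule bij_betw_byWitness[where f' = "\<lambda>t. t - axis j 1"])
       (use assms(2) in \<open>auto simp: coord_lattice_def axis_def\<close>)
  from adic_sums_reindex[OF this adic_sums_sum_out[OF assms(1), of k x J]]
  show "adic_sums (\<lambda>t. shift_k j u (k + t, x)) (coord_lattice J) (sum_out J u (k, x))"
    by (simp add: shift_k_def add_ac)
qed

lemma adic_sums_sum_out_insert: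
  assumes "u \<in> locfin_fams" "j \<notin> J"
  shows "adic_sums (\<lambda>n. sum_out J u (k + axis j n, x)) UNIV (sum_out (insert j J) u (k, x))"
proof (rule adic_sums_Times)
  have "bij_betw (\<lambda>(n, t). axis j n + t) (UNIV \<times> coord_lattice J) (coord_lattice (insert j J))"
    by (rule bij_betw_byWitness[where f' = "\<lambda>t. (t $ j, t - axis j (t $ j))"])
       (use assms(2) in \<open>auto simp: coord_lattice_def axis_def vec_eq_iff\<close>)
  from adic_sums_reindex[OF this adic_sums_sum_out[OF assms(1), of k x]]
  show "adic_sums (\<lambda>(n, t). u (k + axis j n + t, x)) (UNIV \<times> coord_lattice J)
          (sum_out (insert j J) u (k, x))"
    by (simp add: case_prod_unfold add_ac)
  show "adic_sums (\<lambda>t. u (k + axis j n + t, x)) (coord_lattice J) (sum_out J u (k + axis j n, x))" for n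
    by (rule adic_sums_sum_out[OF assms(1)])
qed

definition sum_line :: "'r \<Rightarrow> ('r::finite, 'x) fam \<Rightarrow> ('r::finite, 'x) fam" where
  "sum_line j w = (\<lambda>(k, x). adic_sum (\<lambda>n. w (k + axis j n, x)) UNIV)"

lemma sum_line_sum_out:
  assumes "u \<in> locfin_fams" "j \<notin> J"
  shows "sum_line j (sum_out J u) = sum_out (insert j J) u"
  using adic_sum_eqI[OF adic_sums_sum_out_insert[OF assms]] by (auto simp: sum_line_def fun_eq_iff)

text \<open>
  \<open>L - 1\<close> is injective on families that can still be summed along the direction of \<open>L\<close>: a nonzero
  constant cannot be summed infinitely often.
\<close>

lemma shift_invariant_imp_zero:
  fixes u :: "('r::finite, 'x) fam"
  assumes u: "u \<in> locfin_fams" "j \<notin> J" and inv: "shift_k j (sum_out J u) = sum_out J u"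
  shows "sum_out J u = 0"
proof -
  let ?w = "sum_out J u"
  have step: "?w (k + axis j 1, x) = ?w (k, x)" for k x
    using fun_cong[OF inv, of "(k, x)"] by (simp add: shift_k_def)
  have nat: "?w (k + axis j (int n), x) = ?w (k, x)" for k x n
  proof (induction n)
    case 0
    thus ?case by (simp add: axis_def zero_vec_def[symmetric] cong: if_cong)
  next
    case (Suc n)
    have "k + axis j (int (Suc n)) = (k + axis j (int n)) + axis j 1"
      by (auto simp: vec_eq_iff axis_def)
    thus ?case using step[of "k + axis j (int n)" x] Suc by metis
  qed
  have const: "?w (k + axis j n, x) = ?w (k, x)" for k x n
  proof (cases "n \<ge> 0")
    case True
    thus ?thesis using nat[of k "nat n" x] by simp
  next
    case False
    have "k = (k + axis j n) + axis j (int (nat (- n)))"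
      using False by (auto simp: vec_eq_iff axis_def)
    thus ?thesis using nat[of "k + axis j n" "nat (- n)" x] by metis
  qed
  have "?w (k, x) $$ i = 0" for k x i
  proof (rule ccontr)
    assume nz: "?w (k, x) $$ i \<noteq> 0"
    define g where "g = (\<lambda>n. ?w (k + axis j n, x))"
    have g: "g n = ?w (k, x)" for n unfolding g_def by (rule const)
    have "locally_finite g UNIV"
      unfolding g_def by (rule adic_sums_imp_locally_finite[OF adic_sums_sum_out_insert[OF u]])
    hence "finite {n \<in> UNIV. \<exists>i'\<le>i. g n $$ i' \<noteq> 0}" unfolding locally_finite_def by (rule spec)
    moreover have "{n \<in> UNIV. \<exists>i'\<le>i. g n $$ i' \<noteq> 0} = UNIV"
      unfolding g using nz by auto
    ultimately have "finite (UNIV :: int set)" by simp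
    thus False by simp
  qed
  hence "?w (k, x) = 0" for k x by (intro fls_eqI) simp
  thus ?thesis by (intro ext) (simp only: split_paired_all zero_fun_apply)
qed

text \<open>
  Adding up the inequalities in \<open>step\<close> from \<open>N\<close> to \<open>2 N\<close> and using monotonicity of \<open>d'\<close> gives
  \<open>(N + 1) d' N \<le> d (2 N + 1)\<close>.
\<close>

lemma sum_growth_step:
  fixes d d' :: "nat \<Rightarrow> nat"
  assumes mono: "mono d'" and step: "\<And>N. d' (Suc N) + d N \<le> d (Suc N)"
    and bound: "\<And>N. d N * (N + 1) ^ c \<le> C * (N + 1) ^ p"
  shows "d' N * (N + 1) ^ Suc c \<le> (C * 2 ^ p) * (N + 1) ^ p"
proof -
  have tele: "(\<Sum>i<n. d' (Suc (N + i))) + d N \<le> d (N + n)" for n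
  proof (induction n)
    case (Suc n)
    thus ?case using step[of "N + n"] by simp
  qed simp
  have "d' N * (N + 1) = (\<Sum>i<N + 1. d' N)" by simp
  also have "\<dots> \<le> (\<Sum>i<N + 1. d' (Suc (N + i)))"
    by (intro sum_mono monoD[OF mono]) simp
  also have "\<dots> \<le> d (N + (N + 1))" using tele[of "N + 1"] by linarith
  finally have "d' N * (N + 1) ^ Suc c \<le> d (N + (N + 1)) * (N + 1) ^ c"
    by (simp add: mult.assoc[symmetric] del: add_Suc_right)
  also have "\<dots> \<le> d (N + (N + 1)) * (N + (N + 1) + 1) ^ c"
    by (intro mult_left_mono power_mono) auto
  also have "\<dots> \<le> C * (N + (N + 1) + 1) ^ p" by (rule bound)
  also have "N + (N + 1) + 1 = 2 * (N + 1)" by simp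
  finally show ?thesis by (simp only: power_mult_distrib mult_ac)
qed

text \<open>
  Induction on the set \<open>J\<close> of coordinates already summed. The factor \<open>(N + 1) ^ card J\<close> stands on the left to
  avoid subtraction in the exponent. The spaces \<open>U N\<close> are closed under shifts of \<open>k\<close> only: multiplication by
  powers of \<open>X\<close> in \<open>k\<close> would destroy convergence.
\<close>

theorem sum_out_growth:
  fixes U :: "nat \<Rightarrow> ('r::finite, 'x) fam set"
  assumes sub: "\<And>N. q_fun.subspace (U N)" and lf: "\<And>N. U N \<subseteq> locfin_fams"
    and fin: "\<And>N. \<exists>T. finite T \<and> U N \<subseteq> q_fun.span T"
    and mono: "\<And>N. U N \<subseteq> U (Suc N)" and shift: "\<And>N j. shift_k j ` U N \<subseteq> U (Suc N)"
    and bound: "\<And>N. q_fun.dim (U N) \<le> C * (N + 1) ^ p"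
  shows "\<exists>C'. \<forall>N. q_fun.dim (sum_out J ` U N) * (N + 1) ^ card J \<le> C' * (N + 1) ^ p"
proof -
  have "finite J" by simp
  thus ?thesis
  proof (induction J rule: finite_induct)
    case empty
    have "sum_out {} ` U N = U N" for N by (simp add: sum_out_empty)
    thus ?case using bound by auto
  next
    case (insert j J)
    obtain C' where C': "\<And>N. q_fun.dim (sum_out J ` U N) * (N + 1) ^ card J \<le> C' * (N + 1) ^ p"
      using insert.IH by blast
    define V where "V N = sum_out J ` U N" for N
    define V' where "V' N = sum_out (insert j J) ` U N" for N
    have lin: "linear_on_space q_scale q_scale (U N) (sum_out K)" for N K
      using linear_on_space_subset[OF linear_on_sum_out lf] .
    have subV: "q_fun.subspace (sum_out K ` U N)" for K N
      by (rule q_pair.linear_on_space_image_subspace[OF sub lin])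
    have finV: "\<exists>T. finite T \<and> sum_out K ` U N \<subseteq> q_fun.span T" for K N
    proof -
      obtain T where "finite T" "U N \<subseteq> q_fun.span T" using fin by blast
      thus ?thesis by (rule q_pair.linear_on_space_image_finite_span[OF sub lin])
    qed
    have dim_mono: "q_fun.dim (sum_out K ` U N) \<le> q_fun.dim (sum_out K ` U (Suc N))" for K N
    proof -
      obtain T where T: "finite T" "sum_out K ` U (Suc N) \<subseteq> q_fun.span T" using finV by blast
      show ?thesis by (rule q_fun.dim_mono_finite_span[OF T image_mono[OF mono]])
    qed
    \<comment> \<open>The operator \<open>L - 1\<close> for the coordinate that is summed next.\<close>
    define E where "E w = shift_k j w - w" for w :: "('r::finite, 'x) fam"
    have linE: "Vector_Spaces.linear q_scale q_scale E"
      by (rule Vector_Spaces.linear_iff[THEN iffD2])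
         (auto simp: E_def shift_k_def q_scale_def fun_eq_iff algebra_simps intro: q_fun.vector_space_axioms)
    have drop: "q_fun.dim (V' (Suc N)) + q_fun.dim (V N) \<le> q_fun.dim (V (Suc N))" for N
    proof -
      have line: "sum_line j (sum_out J u) = sum_out (insert j J) u" if "u \<in> U M" for u M
        using that lf insert.hyps by (intro sum_line_sum_out) auto
      have V': "V' M = sum_line j ` V M" for M
        unfolding V_def V'_def image_image using line by (intro image_cong) auto
      have linS: "linear_on_space q_scale q_scale (V (Suc N)) (sum_line j)"
        unfolding linear_on_space_def V_def
      proof (intro conjI ballI allI)
        fix w1 w2 assume "w1 \<in> sum_out J ` U (Suc N)" "w2 \<in> sum_out J ` U (Suc N)"
        then obtain u1 u2 where u: "u1 \<in> U (Suc N)" "u2 \<in> U (Suc N)" "w1 = sum_out J u1" "w2 = sum_out J u2"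
          by blast
        hence "w1 + w2 = sum_out J (u1 + u2)" "u1 + u2 \<in> U (Suc N)"
          using lin[of "Suc N" J] q_fun.subspace_add[OF sub] by (auto simp: linear_on_space_def)
        thus "sum_line j (w1 + w2) = sum_line j w1 + sum_line j w2"
          using u line lin[of "Suc N" "insert j J"] by (simp add: linear_on_space_def)
      next
        fix c w assume "w \<in> sum_out J ` U (Suc N)"
        then obtain u where u: "u \<in> U (Suc N)" "w = sum_out J u" by blast
        hence "q_scale c w = sum_out J (q_scale c u)" "q_scale c u \<in> U (Suc N)"
          using lin[of "Suc N" J] q_fun.subspace_scale[OF sub] by (auto simp: linear_on_space_def)
        thus "sum_line j (q_scale c w) = q_scale c (sum_line j w)"
          using u line lin[of "Suc N" "insert j J"] by (simp add: linear_on_space_def)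
      qed
      have E: "E (sum_out J u) = sum_out J (shift_k j u - u)" "shift_k j u - u \<in> U (Suc N)"
        "sum_out (insert j J) (shift_k j u - u) = 0" if "u \<in> U N" for u
      proof -
        have u: "u \<in> locfin_fams" "u \<in> U (Suc N)" "shift_k j u \<in> U (Suc N)" "- u \<in> U (Suc N)"
          using that lf mono shift q_fun.subspace_neg[OF sub] by blast+
        show "shift_k j u - u \<in> U (Suc N)" using u q_fun.subspace_diff[OF sub] by blast
        have diff: "sum_out K (shift_k j u - u) = sum_out K (shift_k j u) - sum_out K u" for K
        proof -
          have "sum_out K ((shift_k j u - u) + u) = sum_out K (shift_k j u - u) + sum_out K u"
            using lin[of "Suc N" K] u q_fun.subspace_diff[OF sub u(3,2)]
            unfolding linear_on_space_def by blast
          thus ?thesis by simp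
        qed
        show "E (sum_out J u) = sum_out J (shift_k j u - u)"
          unfolding diff E_def sum_out_shift_k[OF u(1)] ..
        show "sum_out (insert j J) (shift_k j u - u) = 0"
          unfolding diff using sum_out_shift_k_absorb[OF u(1)] by simp
      qed
      obtain T where T: "finite T" "V (Suc N) \<subseteq> q_fun.span T" using finV unfolding V_def by blast
      have "q_fun.dim (sum_line j ` V (Suc N)) + q_fun.dim (V N) \<le> q_fun.dim (V (Suc N))"
      proof (rule q_pair.dim_image_drop[OF _ linS T _ linE])
        show "q_fun.subspace (V (Suc N))" "q_fun.subspace (V N)" unfolding V_def by (rule subV)+
        show "E ` V N \<subseteq> V (Suc N)" unfolding V_def using E(1,2) by auto
        show "V N \<subseteq> V (Suc N)" unfolding V_def using mono by blast
        show "sum_line j (E w) = 0" if "w \<in> V N" for w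
          using that E(1) E(3) line[OF E(2)] unfolding V_def by auto
        show "inj_on E (V N)"
        proof (rule inj_onI)
          fix w1 w2 assume w: "w1 \<in> V N" "w2 \<in> V N" and eq: "E w1 = E w2"
          have "w1 - w2 \<in> V N" using w q_fun.subspace_diff[OF subV] unfolding V_def by blast
          then obtain u where u: "u \<in> U N" "w1 - w2 = sum_out J u" unfolding V_def by blast
          have "shift_k j (w1 - w2) = w1 - w2"
            using eq unfolding E_def shift_k_def by (auto simp: fun_eq_iff algebra_simps)
          hence "sum_out J u = 0"
            using u lf insert.hyps by (intro shift_invariant_imp_zero) auto
          thus "w1 = w2" using u(2) by simp
        qed
      qed
      thus ?thesis unfolding V' .
    qed
    have "q_fun.dim (V' N) * (N + 1) ^ Suc (card J) \<le> (C' * 2 ^ p) * (N + 1) ^ p" for N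
    proof (rule sum_growth_step[where d' = "\<lambda>N. q_fun.dim (V' N)" and d = "\<lambda>N. q_fun.dim (V N)"])
      show "q_fun.dim (V' (Suc N)) + q_fun.dim (V N) \<le> q_fun.dim (V (Suc N))" for N
        by (rule drop)

      show "mono (\<lambda>N. q_fun.dim (V' N))"
        unfolding V'_def by (rule incseq_SucI) (rule dim_mono)
      show "q_fun.dim (V N) * (N + 1) ^ card J \<le> C' * (N + 1) ^ p" for N
        unfolding V_def by (rule C')
    qed
    thus ?case using insert.hyps unfolding V'_def by (intro exI[of _ "C' * 2 ^ p"]) simp
  qed
qed

section \<open>Monomials of a single tetrahedron index\<close>

abbreviation to_rat :: "int fls \<Rightarrow> rat fls" where
  "to_rat \<equiv> rat_fls_of_int_fls"

lemma to_rat_add: "to_rat (f + g) = to_rat f + to_rat g"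
  and to_rat_0 [simp]: "to_rat 0 = 0"
  and to_rat_1 [simp]: "to_rat 1 = 1"
  and to_rat_Xpow [simp]: "to_rat (Xpow n) = Xpow n"
  by (rule fls_eqI; simp add: Xpow_def)+

lemma subdegree_to_rat: "fls_subdegree (to_rat f) = fls_subdegree f"
proof (cases "f = 0")
  case False
  thus ?thesis by (intro fls_subdegree_eqI) auto
qed simp

lemma to_rat_mult: "to_rat (f * g) = to_rat f * to_rat g"
  by (rule fls_eqI) (simp add: fls_times_nth(2) subdegree_to_rat)

lemma to_rat_sum: "to_rat (\<Sum>i\<in>I. f i) = (\<Sum>i\<in>I. to_rat (f i))"
  by (induction I rule: infinite_finite_induct) (simp_all add: to_rat_add)

lemma to_rat_prod: "to_rat (\<Prod>i\<in>I. f i) = (\<Prod>i\<in>I. to_rat (f i))"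
  by (induction I rule: infinite_finite_induct) (simp_all add: to_rat_mult)

lemma adic_sums_to_rat:
  assumes "adic_sums g K S" shows "adic_sums (\<lambda>k. to_rat (g k)) K (to_rat S)"
proof (rule adic_sumsI)
  fix n
  obtain F where F: "finite F" "F \<subseteq> K"
    "\<And>Y i. finite Y \<Longrightarrow> F \<subseteq> Y \<Longrightarrow> Y \<subseteq> K \<Longrightarrow> i \<le> n \<Longrightarrow> sum g Y $$ i = S $$ i"
    by (rule adic_sumsE[OF assms(1), of n]) blast
  thus "\<exists>F. finite F \<and> F \<subseteq> K \<and> (\<forall>Y. finite Y \<longrightarrow> F \<subseteq> Y \<longrightarrow> Y \<subseteq> K \<longrightarrow>
          (\<forall>i\<le>n. (\<Sum>k\<in>Y. to_rat (g k)) $$ i = to_rat S $$ i))"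
    unfolding to_rat_sum[symmetric] by (intro exI[of _ F]) simp
qed

definition tetra_rat :: "int \<Rightarrow> int \<Rightarrow> rat fls" where
  "tetra_rat m e = to_rat (tetra_index m e)"

lemma tetra_rat_pred_e:
  "tetra_rat m (e - 1) = Xpow m * tetra_rat m e - Xpow (m + e) * tetra_rat (m - 1) e"
proof -
  have "Xpow m * tetra_rat m e =
      Xpow m * (Xpow (- m) * tetra_rat m (e - 1) + Xpow e * tetra_rat (m - 1) e)"
    using tetra_index_rec_e[of m e] by (simp add: tetra_rat_def to_rat_add to_rat_mult)
  thus ?thesis by (simp add: distrib_left Xpow_mult_left)
qed

lemma tetra_rat_succ_e:
  "tetra_rat m (e + 1) = Xpow m * tetra_rat m e - Xpow (m + e) * tetra_rat (m + 1) e"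
proof -
  have "Xpow m * tetra_rat m e =
      Xpow m * (Xpow e * tetra_rat (m + 1) e + Xpow (- m) * tetra_rat m (e + 1))"
    using tetra_index_rec_m[of m e] by (simp add: tetra_rat_def to_rat_add to_rat_mult)
  thus ?thesis by (simp add: distrib_left Xpow_mult_left)
qed

text \<open>
  Elimination of the shifts in \<open>e\<close> from the two first-order recurrences. The coefficients at both ends are
  \<open>1\<close> up to sign, so the recurrence can be run in both directions without denominators.
\<close>

lemma tetra_rat_three_term:
  "tetra_rat (m + 1) e = Xpow (- e) * tetra_rat m e + Xpow e * tetra_rat m e
     - Xpow (- 2 * m - e) * tetra_rat m e - tetra_rat (m - 1) e"
proof -
  let ?I = "tetra_rat m e" and ?P = "tetra_rat (m + 1) e" and ?N = "tetra_rat (m - 1) e"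
  have "Xpow (- m - e) * tetra_rat m (e - 1) =
      Xpow (- m - e) * (Xpow (e - 1) * tetra_rat (m + 1) (e - 1) + Xpow (- m) * ?I)"
    using tetra_index_rec_m[of m "e - 1"] by (simp add: tetra_rat_def to_rat_add to_rat_mult)
  also have "\<dots> = Xpow (- m - 1) * tetra_rat (m + 1) (e - 1) + Xpow (- 2 * m - e) * ?I"
    by (simp add: distrib_left Xpow_mult_left)
  also have "tetra_rat (m + 1) (e - 1) = Xpow (m + 1) * ?P - Xpow (m + 1 + e) * ?I"
    using tetra_rat_pred_e[of "m + 1" e] by simp
  also have "Xpow (- m - 1) * \<dots> = ?P - Xpow e * ?I"
    by (simp add: right_diff_distrib Xpow_mult_left)
  also have "tetra_rat m (e - 1) = Xpow m * ?I - Xpow (m + e) * ?N"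
    by (rule tetra_rat_pred_e)
  also have "Xpow (- m - e) * \<dots> = Xpow (- e) * ?I - ?N"
    by (simp add: right_diff_distrib Xpow_mult_left)
  finally show ?thesis by (simp add: algebra_simps)
qed

lemma tetra_rat_three_term_pred:
  "tetra_rat (m - 1) e = Xpow (- e) * tetra_rat m e + Xpow e * tetra_rat m e
     - Xpow (- 2 * m - e) * tetra_rat m e - tetra_rat (m + 1) e"
  using tetra_rat_three_term[of m e] by (simp add: algebra_simps)

lemma ex_fract_Xpow: "\<exists>c. fls_of_fract c = Xpow n"
proof -
  have mon: "fps_to_fls (fps_of_poly (monom 1 k)) = (Xpow (int k) :: rat fls)" for k
    by (simp add: fps_of_poly_monom' fps_to_fls_X_power)
  show ?thesis
  proof (cases "n \<ge> 0")
    case True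
    have "fls_of_fract (Fract (monom 1 (nat n)) 1) = Xpow n"
      using True mon[of "nat n"] by (subst fls_of_fract_Fract) auto
    thus ?thesis by blast
  next
    case False
    have "Xpow (- n) * Xpow n = (1 :: rat fls)" by (simp add: Xpow_mult)
    hence "1 / Xpow (- n) = (Xpow n :: rat fls)" by (simp add: field_simps)
    hence "fls_of_fract (Fract 1 (monom 1 (nat (- n)))) = Xpow n"
      using False mon[of "nat (- n)"] by (subst fls_of_fract_Fract) auto
    thus ?thesis by blast
  qed
qed

definition qscalar :: "int \<Rightarrow> rat poly fract" where
  "qscalar n = (SOME c. fls_of_fract c = Xpow n)"

lemma fls_of_fract_qscalar [simp]: "fls_of_fract (qscalar n) = Xpow n"
  unfolding qscalar_def using someI_ex[OF ex_fract_Xpow] .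

lemma fls_of_fract_prod: "fls_of_fract (\<Prod>i\<in>I. f i) = (\<Prod>i\<in>I. fls_of_fract (f i))"
  by (induction I rule: infinite_finite_induct) (simp_all add: fls_of_fract_1 fls_of_fract_mult)

lemma linear_qI:
  assumes "\<And>u v x. f (u + v) x = f u x + f v x" "\<And>c u x. f (q_scale c u) x = fls_of_fract c * f u x"
  shows "Vector_Spaces.linear q_scale q_scale f"
  by (rule Vector_Spaces.linear_iff[THEN iffD2])
     (auto simp: fun_eq_iff assms q_scale_def[of _ "f _"] intro: q_fun.vector_space_axioms)

lemma linear_span_subset:
  assumes "Vector_Spaces.linear q_scale q_scale f" "\<And>u. u \<in> S \<Longrightarrow> f u \<in> q_fun.span T" "u \<in> q_fun.span S"
  shows "f u \<in> q_fun.span T"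
proof -
  have "f u \<in> q_fun.span (f ` S)"
    using q_pair.linear_span_image[OF assms(1), of S] assms(3) by blast
  also have "\<dots> \<subseteq> q_fun.span T"
    using assms(2) by (intro q_fun.span_minimal q_fun.subspace_span) auto
  finally show ?thesis .
qed

text \<open>
  Monomials in \<open>X\<^sup>m\<close> and \<open>X\<^sup>e\<close> times a shift of the index in \<open>m\<close>; the cases \<open>j = 0\<close> and \<open>j = 1\<close> generate
  everything else.
\<close>

definition tetra_fun :: "int \<Rightarrow> int \<Rightarrow> int \<Rightarrow> int \<times> int \<Rightarrow> rat fls" where
  "tetra_fun a b j = (\<lambda>(m, e). Xpow (a * m + b * e) * tetra_rat (m + j) e)"

definition tetra_generators :: "int \<Rightarrow> (int \<times> int \<Rightarrow> rat fls) set" where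
  "tetra_generators R = (\<lambda>(a, b, j). tetra_fun a b j) ` ({- R..R} \<times> {- R..R} \<times> {0, 1})"

abbreviation tetra_span :: "int \<Rightarrow> (int \<times> int \<Rightarrow> rat fls) set" where
  "tetra_span R \<equiv> q_fun.span (tetra_generators R)"

lemma finite_tetra_generators: "finite (tetra_generators R)"
  unfolding tetra_generators_def by simp

lemma card_tetra_generators: "R \<ge> 0 \<Longrightarrow> card (tetra_generators R) \<le> 2 * nat (2 * R + 1) ^ 2"
proof -
  assume R: "R \<ge> 0"
  have "card (tetra_generators R) \<le> card ({- R..R} \<times> {- R..R} \<times> {0, 1 :: int})"
    unfolding tetra_generators_def by (rule card_image_le) simp
  also have "\<dots> = 2 * nat (2 * R + 1) ^ 2"
    using R by (simp add: card_cartesian_product power2_eq_square)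
  finally show ?thesis .
qed

lemma tetra_span_mono: "R \<le> R' \<Longrightarrow> tetra_span R \<subseteq> tetra_span R'"
  unfolding tetra_generators_def by (intro q_fun.span_mono image_mono) auto

lemma tetra_fun_in_span: "\<bar>a\<bar> \<le> R \<Longrightarrow> \<bar>b\<bar> \<le> R \<Longrightarrow> j = 0 \<or> j = 1 \<Longrightarrow> tetra_fun a b j \<in> tetra_span R"
  unfolding tetra_generators_def by (intro q_fun.span_base image_eqI[of _ _ "(a, b, j)"]) auto

lemma tetra_fun_2: "tetra_fun a b 2 = tetra_fun a (b - 1) 1 + tetra_fun a (b + 1) 1
    - q_scale (qscalar (- 2)) (tetra_fun (a - 2) (b - 1) 1) - tetra_fun a b 0"
proof (rule ext, safe)
  fix m e
  define Y where "Y = (Xpow (a * m + b * e) :: rat fls)"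
  let ?J = "\<lambda>j. tetra_rat (m + j) e"
  have "tetra_fun a b 2 (m, e) = Y * (Xpow (- e) * ?J 1 + Xpow e * ?J 1 - Xpow (- 2 * (m + 1) - e) * ?J 1 - ?J 0)"
    using tetra_rat_three_term[of "m + 1" e] by (simp add: tetra_fun_def Y_def add.commute)
  also have "\<dots> = (Y * Xpow (- e)) * ?J 1 + (Y * Xpow e) * ?J 1 - (Y * Xpow (- 2 * (m + 1) - e)) * ?J 1 - Y * ?J 0"
    by (simp only: distrib_left right_diff_distrib mult.assoc)
  also have "Y * Xpow (- e) = Xpow (a * m + (b - 1) * e)"
    by (simp add: Y_def Xpow_mult algebra_simps)
  also have "Y * Xpow e = Xpow (a * m + (b + 1) * e)"
    by (simp add: Y_def Xpow_mult algebra_simps)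
  also have "Y * Xpow (- 2 * (m + 1) - e) = Xpow (- 2) * Xpow ((a - 2) * m + (b - 1) * e)"
    by (simp add: Y_def Xpow_mult algebra_simps)
  finally show "tetra_fun a b 2 (m, e) = (tetra_fun a (b - 1) 1 + tetra_fun a (b + 1) 1
    - q_scale (qscalar (- 2)) (tetra_fun (a - 2) (b - 1) 1) - tetra_fun a b 0) (m, e)"
    by (simp add: tetra_fun_def q_scale_def Y_def mult.assoc)
qed

lemma tetra_fun_m1: "tetra_fun a b (- 1) = tetra_fun a (b - 1) 0 + tetra_fun a (b + 1) 0
    - tetra_fun (a - 2) (b - 1) 0 - tetra_fun a b 1"
proof (rule ext, safe)
  fix m e
  define Y where "Y = (Xpow (a * m + b * e) :: rat fls)"
  let ?J = "\<lambda>j. tetra_rat (m + j) e"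
  have "tetra_fun a b (- 1) (m, e) = Y * (Xpow (- e) * ?J 0 + Xpow e * ?J 0 - Xpow (- 2 * m - e) * ?J 0 - ?J 1)"
    using tetra_rat_three_term_pred[of m e] by (simp add: tetra_fun_def Y_def)
  also have "\<dots> = (Y * Xpow (- e)) * ?J 0 + (Y * Xpow e) * ?J 0 - (Y * Xpow (- 2 * m - e)) * ?J 0 - Y * ?J 1"
    by (simp only: distrib_left right_diff_distrib mult.assoc)
  also have "Y * Xpow (- e) = Xpow (a * m + (b - 1) * e)"
    by (simp add: Y_def Xpow_mult algebra_simps)
  also have "Y * Xpow e = Xpow (a * m + (b + 1) * e)"
    by (simp add: Y_def Xpow_mult algebra_simps)
  also have "Y * Xpow (- 2 * m - e) = Xpow ((a - 2) * m + (b - 1) * e)"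
    by (simp add: Y_def Xpow_mult algebra_simps)
  finally show "tetra_fun a b (- 1) (m, e) = (tetra_fun a (b - 1) 0 + tetra_fun a (b + 1) 0
    - tetra_fun (a - 2) (b - 1) 0 - tetra_fun a b 1) (m, e)"
    by (simp add: tetra_fun_def Y_def)
qed

lemma tetra_fun_in_span_neighbour:
  assumes "\<bar>a\<bar> \<le> R" "\<bar>b\<bar> \<le> R" "j \<in> {- 1, 0, 1, 2}"
  shows "tetra_fun a b j \<in> tetra_span (R + 2)"
proof -
  consider "j = 0 \<or> j = 1" | "j = 2" | "j = - 1" using assms(3) by auto
  thus ?thesis
  proof cases
    case 1
    thus ?thesis using assms by (intro tetra_fun_in_span) auto
  next
    case 2
    thus ?thesis unfolding 2 tetra_fun_2 using assms
      by (intro q_fun.span_diff q_fun.span_add q_fun.span_scale tetra_fun_in_span) auto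
  next
    case 3
    thus ?thesis unfolding 3 tetra_fun_m1 using assms
      by (intro q_fun.span_diff q_fun.span_add tetra_fun_in_span) auto
  qed
qed

definition shift_fun :: "int \<Rightarrow> int \<Rightarrow> (int \<times> int \<Rightarrow> rat fls) \<Rightarrow> int \<times> int \<Rightarrow> rat fls" where
  "shift_fun c d u = (\<lambda>(m, e). u (m + c, e + d))"

lemma linear_shift_fun: "Vector_Spaces.linear q_scale q_scale (shift_fun c d)"
  by (rule linear_qI) (auto simp: shift_fun_def q_scale_def)

lemma shift_fun_tetra_fun:
  "shift_fun 1 0 (tetra_fun a b j) = q_scale (qscalar a) (tetra_fun a b (j + 1))"
  "shift_fun (- 1) 0 (tetra_fun a b j) = q_scale (qscalar (- a)) (tetra_fun a b (j - 1))"
  "shift_fun 0 1 (tetra_fun a b j) = q_scale (qscalar (b + j)) (tetra_fun (a + 1) b j)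
     - q_scale (qscalar (b + j)) (tetra_fun (a + 1) (b + 1) (j + 1))"
  "shift_fun 0 (- 1) (tetra_fun a b j) = q_scale (qscalar (j - b)) (tetra_fun (a + 1) b j)
     - q_scale (qscalar (j - b)) (tetra_fun (a + 1) (b + 1) (j - 1))"
proof -
  show "shift_fun 1 0 (tetra_fun a b j) = q_scale (qscalar a) (tetra_fun a b (j + 1))"
    "shift_fun (- 1) 0 (tetra_fun a b j) = q_scale (qscalar (- a)) (tetra_fun a b (j - 1))"
    by (auto simp: fun_eq_iff shift_fun_def tetra_fun_def q_scale_def Xpow_mult_left Xpow_mult algebra_simps)
  show "shift_fun 0 1 (tetra_fun a b j) = q_scale (qscalar (b + j)) (tetra_fun (a + 1) b j)
     - q_scale (qscalar (b + j)) (tetra_fun (a + 1) (b + 1) (j + 1))"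
  proof (rule ext, safe)
    fix m e
    have "shift_fun 0 (1) (tetra_fun a b j) (m, e) = Xpow (a * m + b * (e + 1)) *
        (Xpow (m + j) * tetra_rat (m + j) e - Xpow (m + j + e) * tetra_rat (m + j + 1) e)"
      by (simp add: shift_fun_def tetra_fun_def tetra_rat_succ_e)
    also have "\<dots> = Xpow (a * m + b * (e + 1) + (m + j)) * tetra_rat (m + j) e
        - Xpow (a * m + b * (e + 1) + (m + j + e)) * tetra_rat (m + j + 1) e"
      by (simp only: right_diff_distrib Xpow_mult_left)
    also have "a * m + b * (e + 1) + (m + j) = (b + j) + ((a + 1) * m + b * e)"
      by (simp add: algebra_simps)
    also have "a * m + b * (e + 1) + (m + j + e) = (b + j) + ((a + 1) * m + (b + 1) * e)"
      by (simp add: algebra_simps)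
    finally show "shift_fun 0 (1) (tetra_fun a b j) (m, e) = (q_scale (qscalar (b + j)) (tetra_fun (a + 1) b j)
        - q_scale (qscalar (b + j)) (tetra_fun (a + 1) (b + 1) (j + 1))) (m, e)"
      by (simp add: tetra_fun_def q_scale_def Xpow_mult_left add.assoc add_diff_eq)
  qed
  show "shift_fun 0 (- 1) (tetra_fun a b j) = q_scale (qscalar (j - b)) (tetra_fun (a + 1) b j)
     - q_scale (qscalar (j - b)) (tetra_fun (a + 1) (b + 1) (j - 1))"
  proof (rule ext, safe)
    fix m e
    have "shift_fun 0 (- 1) (tetra_fun a b j) (m, e) = Xpow (a * m + b * (e - 1)) *
        (Xpow (m + j) * tetra_rat (m + j) e - Xpow (m + j + e) * tetra_rat (m + j - 1) e)"
      by (simp add: shift_fun_def tetra_fun_def tetra_rat_pred_e)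
    also have "\<dots> = Xpow (a * m + b * (e - 1) + (m + j)) * tetra_rat (m + j) e
        - Xpow (a * m + b * (e - 1) + (m + j + e)) * tetra_rat (m + j - 1) e"
      by (simp only: right_diff_distrib Xpow_mult_left)
    also have "a * m + b * (e - 1) + (m + j) = (j - b) + ((a + 1) * m + b * e)"
      by (simp add: algebra_simps)
    also have "a * m + b * (e - 1) + (m + j + e) = (j - b) + ((a + 1) * m + (b + 1) * e)"
      by (simp add: algebra_simps)
    finally show "shift_fun 0 (- 1) (tetra_fun a b j) (m, e) = (q_scale (qscalar (j - b)) (tetra_fun (a + 1) b j)
        - q_scale (qscalar (j - b)) (tetra_fun (a + 1) (b + 1) (j - 1))) (m, e)"
      by (simp add: tetra_fun_def q_scale_def Xpow_mult_left add.assoc add_diff_eq)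
  qed
qed

text \<open>
  A unit shift enlarges the exponents by at most \<open>3\<close>: by one from the recurrences in \<open>e\<close>, and by
  two more when an argument \<open>m - 1\<close> or \<open>m + 2\<close> is reduced by the three-term recurrence.
\<close>

lemma shift_fun_unit:
  assumes "u \<in> tetra_span R" "(c, d) \<in> {(1, 0), (- 1, 0), (0, 1), (0, - 1)}"
  shows "shift_fun c d u \<in> tetra_span (R + 3)"
proof (rule linear_span_subset[OF linear_shift_fun _ assms(1)])
  fix w assume "w \<in> tetra_generators R"
  then obtain a b j where w: "w = tetra_fun a b j" "\<bar>a\<bar> \<le> R" "\<bar>b\<bar> \<le> R" "j \<in> {0, 1}"
    by (auto simp: tetra_generators_def)
  have ph: "tetra_fun a' b' j' \<in> tetra_span (R + 3)"
    if "\<bar>a'\<bar> \<le> R + 1" "\<bar>b'\<bar> \<le> R + 1" "j' \<in> {- 1, 0, 1, 2}" for a' b' j'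
    using tetra_fun_in_span_neighbour[OF that] by (simp add: add.commute)
  show "shift_fun c d w \<in> tetra_span (R + 3)"
    using assms(2) w(2-4) unfolding w(1)
    by (auto simp: shift_fun_tetra_fun intro!: q_fun.span_diff q_fun.span_scale ph)
qed

lemma shift_fun_multiple:
  assumes "u \<in> tetra_span R" "(c, d) \<in> {(1, 0), (- 1, 0), (0, 1), (0, - 1)}"
  shows "shift_fun (int n * c) (int n * d) u \<in> tetra_span (R + 3 * int n)"
proof (induction n)
  case 0
  have "shift_fun 0 0 u = u" by (auto simp: shift_fun_def)
  thus ?case using assms(1) by simp
next
  case (Suc n)
  have "shift_fun (int (Suc n) * c) (int (Suc n) * d) u = shift_fun c d (shift_fun (int n * c) (int n * d) u)"
    by (auto simp: shift_fun_def fun_eq_iff algebra_simps)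
  thus ?case using shift_fun_unit[OF Suc assms(2)] by (simp add: algebra_simps)
qed

lemma shift_fun_in_span:
  assumes "u \<in> tetra_span R"
  shows "shift_fun c d u \<in> tetra_span (R + 3 * \<bar>c\<bar> + 3 * \<bar>d\<bar>)"
proof -
  have 1: "shift_fun c 0 u \<in> tetra_span (R + 3 * \<bar>c\<bar>)" if "u \<in> tetra_span R" for u R c
  proof (cases "c \<ge> 0")
    case True
    thus ?thesis using shift_fun_multiple[OF that, of 1 0 "nat c"] by simp
  next
    case False
    thus ?thesis using shift_fun_multiple[OF that, of "- 1" 0 "nat (- c)"] by simp
  qed
  have 2: "shift_fun 0 d u \<in> tetra_span (R + 3 * \<bar>d\<bar>)" if "u \<in> tetra_span R" for u R d
  proof (cases "d \<ge> 0")
    case True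
    thus ?thesis using shift_fun_multiple[OF that, of 0 1 "nat d"] by simp
  next
    case False
    thus ?thesis using shift_fun_multiple[OF that, of 0 "- 1" "nat (- d)"] by simp
  qed
  have "shift_fun c d u = shift_fun 0 d (shift_fun c 0 u)" by (auto simp: shift_fun_def)
  thus ?thesis using 2[OF 1[OF assms]] by simp
qed

definition tetra_monomial :: "int \<Rightarrow> int \<Rightarrow> int \<Rightarrow> int \<Rightarrow> int \<times> int \<Rightarrow> rat fls" where
  "tetra_monomial a b c d = (\<lambda>(m, e). Xpow (a * m + b * e) * tetra_rat (m + c) (e + d))"

theorem tetra_monomial_in_span: "tetra_monomial a b c d \<in> tetra_span (\<bar>a\<bar> + \<bar>b\<bar> + 3 * \<bar>c\<bar> + 3 * \<bar>d\<bar>)"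
proof -
  define f where "f u = (\<lambda>(m, e). Xpow (a * m + b * e) * u (m, e))" for u :: "int \<times> int \<Rightarrow> rat fls"
  define R where "R = 3 * \<bar>c\<bar> + 3 * \<bar>d\<bar>"
  have lin: "Vector_Spaces.linear q_scale q_scale f"
    by (rule linear_qI) (auto simp: f_def q_scale_def algebra_simps)
  have "tetra_fun 0 0 0 \<in> tetra_span 0" by (rule tetra_fun_in_span) auto
  from shift_fun_in_span[OF this, of c d] have "shift_fun c d (tetra_fun 0 0 0) \<in> tetra_span R"
    by (simp add: R_def)
  hence "f (shift_fun c d (tetra_fun 0 0 0)) \<in> tetra_span (\<bar>a\<bar> + \<bar>b\<bar> + R)"
  proof (rule linear_span_subset[OF lin, rotated])
    fix w assume "w \<in> tetra_generators R"
    then obtain a' b' j where w: "w = tetra_fun a' b' j" "\<bar>a'\<bar> \<le> R" "\<bar>b'\<bar> \<le> R" "j \<in> {0, 1}"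
      by (auto simp: tetra_generators_def)
    have "f w = tetra_fun (a + a') (b + b') j"
      by (auto simp: fun_eq_iff w(1) f_def tetra_fun_def Xpow_mult_left Xpow_mult algebra_simps)
    thus "f w \<in> tetra_span (\<bar>a\<bar> + \<bar>b\<bar> + R)"
      using w(2-4) by (auto intro!: tetra_fun_in_span)
  qed
  moreover have "f (shift_fun c d (tetra_fun 0 0 0)) = tetra_monomial a b c d"
    by (auto simp: f_def shift_fun_def tetra_fun_def tetra_monomial_def)
  ultimately show ?thesis by (simp add: R_def add.assoc)
qed

section \<open>Monomials of the summand\<close>

lemma fun_sum_apply: "(\<Sum>i\<in>I. f i) x = (\<Sum>i\<in>I. f i x)"
  for f :: "'i \<Rightarrow> 'a \<Rightarrow> 'b::comm_monoid_add"
  by (induction I rule: infinite_finite_induct) auto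

lemma sum_UNIV_Plus:
  fixes f :: "'a::finite + 'b::finite \<Rightarrow> 'c::comm_monoid_add"
  shows "(\<Sum>j\<in>UNIV. f j) = (\<Sum>i\<in>UNIV. f (Inl i)) + (\<Sum>i\<in>UNIV. f (Inr i))"
  unfolding UNIV_Plus_UNIV[symmetric] by (subst sum.Plus) auto

definition summand_fam ::
  "int^'s^'r \<Rightarrow> int^'s^'r \<Rightarrow> int^'r \<Rightarrow> ('r, int^('s + 's)) fam" where
  "summand_fam A B v =
     (\<lambda>(k, x). to_rat (index_summand A B v (\<chi> i. x $ Inl i) (\<chi> i. x $ Inr i) k))"

definition int_vec :: "nat^'n \<Rightarrow> int^'n" where
  "int_vec a = (\<chi> j. int (a $ j))"

lemma int_vec_nth [simp]: "int_vec a $ j = int (a $ j)"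
  by (simp add: int_vec_def)

text \<open>
  Monomials of operators applied to the summand: \<open>a\<close> are exponents of \<open>X\<close> in the parameters, \<open>b\<close> shifts of the
  parameters, \<open>d\<close> shifts of \<open>k\<close>.
\<close>

definition summand_monomial ::
  "int^'s^'r \<Rightarrow> int^'s^'r \<Rightarrow> int^'r \<Rightarrow> nat^('s + 's) \<Rightarrow> nat^('s + 's) \<Rightarrow> nat^'r \<Rightarrow>
    ('r, int^('s + 's)) fam" where
  "summand_monomial A B v a b d = (\<lambda>(k, x). Xpow (int_dot (int_vec a) x) * summand_fam A B v (k + int_vec d, x + int_vec b))"

definition tetra_args :: "int^'s^'r \<Rightarrow> int^'s^'r \<Rightarrow> int^'r \<Rightarrow> int^('s + 's) \<Rightarrow> 's \<Rightarrow> int \<times> int" where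
  "tetra_args A B k x i = (x $ Inl i - int_dot (column i B) k, x $ Inr i + int_dot (column i A) k)"

definition tetra_product ::
  "int^'s^'r \<Rightarrow> int^'s^'r \<Rightarrow> int^'r \<Rightarrow> int^'r \<Rightarrow> ('s \<Rightarrow> int \<times> int \<Rightarrow> rat fls) \<Rightarrow>
    ('r, int^('s + 's)) fam" where
  "tetra_product A B v w c = (\<lambda>(k, x). Xpow (int_dot (v - w) k) * (\<Prod>i\<in>UNIV. c i (tetra_args A B k x i)))"

text \<open>
  The power of \<open>X\<close> in \<open>k\<close> that appears when the monomial \<open>X\<^bsup>a \<cdot> x\<^esup>\<close> in the parameters is rewritten in terms of
  the arguments of the tetrahedron indices.
\<close>

definition weight :: "int^'s^'r \<Rightarrow> int^'s^'r \<Rightarrow> nat^('s + 's) \<Rightarrow> int^'r" where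
  "weight A B a = (\<Sum>i\<in>UNIV. int (a $ Inr i) *s column i A - int (a $ Inl i) *s column i B)"

lemma int_dot_add_right: "int_dot x (y + z) = int_dot x y + int_dot x z"
  by (simp add: int_dot_vdot vdot_add_right)

text \<open>
  In the variables \<open>tetra_args\<close> a monomial of the summand is a product of monomials of the individual
  tetrahedron indices, up to a power of \<open>X\<close> in \<open>k\<close> that depends on \<open>a\<close> alone. A shift of \<open>k\<close> is absorbed
  by a shift of the arguments.
\<close>

lemma summand_monomial_factor:
  "summand_monomial A B v a b d (k, x) = Xpow (int_dot v (int_vec d)) *
     (Xpow (int_dot (v - weight A B a) k) *
      (\<Prod>i\<in>UNIV. tetra_monomial (int (a $ Inl i)) (int (a $ Inr i))
         (int (b $ Inl i) - int_dot (column i B) (int_vec d))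
         (int (b $ Inr i) + int_dot (column i A) (int_vec d)) (tetra_args A B k x i)))"
proof -
  let ?y = "\<lambda>i. fst (tetra_args A B k x i)" and ?z = "\<lambda>i. snd (tetra_args A B k x i)"
  let ?T = "\<lambda>i. tetra_rat (?y i + (int (b $ Inl i) - int_dot (column i B) (int_vec d)))
         (?z i + (int (b $ Inr i) + int_dot (column i A) (int_vec d)))"
  have G: "summand_fam A B v (k + int_vec d, x + int_vec b) = Xpow (int_dot v (k + int_vec d)) * (\<Prod>i\<in>UNIV. ?T i)"
    unfolding summand_fam_def index_summand_def
    by (simp add: to_rat_mult to_rat_prod tetra_rat_def[symmetric] Xpow_def[symmetric] tetra_args_def
        int_dot_add_right algebra_simps)
  have "int_dot (int_vec a) x = (\<Sum>i\<in>UNIV. int (a $ Inl i) * x $ Inl i + int (a $ Inr i) * x $ Inr i)"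
    by (simp add: int_dot_def sum_UNIV_Plus sum.distrib)
  moreover have "int_dot (weight A B a) k =
      (\<Sum>i\<in>UNIV. int (a $ Inr i) * int_dot (column i A) k - int (a $ Inl i) * int_dot (column i B) k)"
    by (simp add: weight_def int_dot_vdot vdot_sum_left vdot_diff_left)
  ultimately have e: "int_dot (int_vec a) x + int_dot (weight A B a) k =
      (\<Sum>i\<in>UNIV. int (a $ Inl i) * ?y i + int (a $ Inr i) * ?z i)"
    by (simp add: tetra_args_def algebra_simps flip: sum.distrib)
  have "int_dot (int_vec a) x + int_dot v (k + int_vec d) =
      int_dot v (int_vec d) + (int_dot (v - weight A B a) k +
        (int_dot (int_vec a) x + int_dot (weight A B a) k))"
    by (simp add: int_dot_vdot vdot_diff_left vdot_add_right)
  hence "summand_monomial A B v a b d (k, x) = Xpow (int_dot v (int_vec d)) * (Xpow (int_dot (v - weight A B a) k) *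
      (Xpow (\<Sum>i\<in>UNIV. int (a $ Inl i) * ?y i + int (a $ Inr i) * ?z i) * (\<Prod>i\<in>UNIV. ?T i)))"
    unfolding summand_monomial_def by (simp add: G Xpow_mult_left e)
  also have "Xpow (\<Sum>i\<in>UNIV. int (a $ Inl i) * ?y i + int (a $ Inr i) * ?z i) * (\<Prod>i\<in>UNIV. ?T i) =
      (\<Prod>i\<in>UNIV. Xpow (int (a $ Inl i) * ?y i + int (a $ Inr i) * ?z i) * ?T i)"
    by (simp add: prod.distrib Xpow_prod)
  finally show ?thesis by (simp add: tetra_monomial_def case_prod_unfold)
qed

definition entry_bound :: "int^'s^'r \<Rightarrow> int^'s^'r \<Rightarrow> int" where
  "entry_bound A B = (\<Sum>i\<in>UNIV. \<Sum>j\<in>UNIV. \<bar>A $ j $ i\<bar> + \<bar>B $ j $ i\<bar>)"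

lemma entry_bound_nonneg: "0 \<le> entry_bound A B"
  unfolding entry_bound_def by (intro sum_nonneg) auto

lemma column_dot_bound:
  fixes A B :: "int^'s^'r" and d :: "int^'r"
  assumes "\<And>j. \<bar>d $ j\<bar> \<le> N"
  shows "\<bar>int_dot (column i A) d\<bar> \<le> entry_bound A B * N" "\<bar>int_dot (column i B) d\<bar> \<le> entry_bound A B * N"
proof -
  have N: "0 \<le> N" using assms[of undefined] by linarith
  have *: "\<bar>int_dot (column i C) d\<bar> \<le> entry_bound A B * N"
    if C: "\<And>j i. \<bar>(C :: int^'s^'r) $ j $ i\<bar> \<le> \<bar>A $ j $ i\<bar> + \<bar>B $ j $ i\<bar>" for C
  proof -
    have "\<bar>int_dot (column i C) d\<bar> \<le> (\<Sum>j\<in>UNIV. \<bar>C $ j $ i * d $ j\<bar>)"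
      unfolding int_dot_def column_def by (simp add: sum_abs)
    also have "\<dots> \<le> (\<Sum>j\<in>UNIV. (\<bar>A $ j $ i\<bar> + \<bar>B $ j $ i\<bar>) * N)"
      unfolding abs_mult by (intro sum_mono mult_mono C assms) auto
    also have "\<dots> = (\<Sum>j\<in>UNIV. \<bar>A $ j $ i\<bar> + \<bar>B $ j $ i\<bar>) * N"
      by (simp add: sum_distrib_right)
    also have "\<dots> \<le> entry_bound A B * N"
      unfolding entry_bound_def using N
      by (intro mult_right_mono member_le_sum[of i UNIV "\<lambda>i. \<Sum>j\<in>UNIV. \<bar>A $ j $ i\<bar> + \<bar>B $ j $ i\<bar>"] sum_nonneg) auto
    finally show ?thesis .
  qed
  show "\<bar>int_dot (column i A) d\<bar> \<le> entry_bound A B * N" "\<bar>int_dot (column i B) d\<bar> \<le> entry_bound A B * N"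
    by (rule *; simp)+
qed

lemma weight_bound:
  fixes a :: "nat^('s::finite + 's)"
  assumes "\<And>j. a $ j \<le> N"
  shows "\<bar>weight A B a $ j\<bar> \<le> entry_bound A B * int N"
proof -
  have "\<bar>weight A B a $ j\<bar> \<le> (\<Sum>i\<in>UNIV. \<bar>int (a $ Inr i) * A $ j $ i - int (a $ Inl i) * B $ j $ i\<bar>)"
    unfolding weight_def by (simp add: sum_component column_def sum_abs)
  also have "\<dots> \<le> (\<Sum>i\<in>UNIV. (\<bar>A $ j $ i\<bar> + \<bar>B $ j $ i\<bar>) * int N)"
  proof (rule sum_mono)
    fix i
    have "\<bar>int (a $ Inr i) * A $ j $ i\<bar> \<le> int N * \<bar>A $ j $ i\<bar>"
      "\<bar>int (a $ Inl i) * B $ j $ i\<bar> \<le> int N * \<bar>B $ j $ i\<bar>"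
      unfolding abs_mult using assms by (auto intro!: mult_right_mono)
    thus "\<bar>int (a $ Inr i) * A $ j $ i - int (a $ Inl i) * B $ j $ i\<bar> \<le> (\<bar>A $ j $ i\<bar> + \<bar>B $ j $ i\<bar>) * int N"
      by (simp add: algebra_simps)
  qed
  also have "\<dots> = (\<Sum>i\<in>UNIV. \<bar>A $ j $ i\<bar> + \<bar>B $ j $ i\<bar>) * int N"
    by (simp add: sum_distrib_right)
  also have "\<dots> \<le> entry_bound A B * int N"
    unfolding entry_bound_def
    by (intro mult_right_mono sum_mono member_le_sum[of j UNIV "\<lambda>j. \<bar>A $ j $ i\<bar> + \<bar>B $ j $ i\<bar>" for i]) auto
  finally show ?thesis .
qed

definition tetra_products :: "int^'s^'r \<Rightarrow> int^'s^'r \<Rightarrow> int^'r \<Rightarrow> int \<Rightarrow> ('r, int^('s + 's)) fam set" where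
  "tetra_products A B v M = (\<lambda>(w, c). tetra_product A B v w c) ` ({w. \<forall>j. \<bar>w $ j\<bar> \<le> M} \<times> (UNIV \<rightarrow>\<^sub>E tetra_generators M))"

lemma finite_card_box:
  assumes "0 \<le> M"
  shows "finite {w :: int^'r. \<forall>j. \<bar>w $ j\<bar> \<le> M}" "card {w :: int^'r. \<forall>j. \<bar>w $ j\<bar> \<le> M} \<le> nat (2 * M + 1) ^ CARD('r)"
proof -
  let ?P = "UNIV \<rightarrow>\<^sub>E {- M..M} :: ('r \<Rightarrow> int) set"
  have sub: "{w :: int^'r. \<forall>j. \<bar>w $ j\<bar> \<le> M} \<subseteq> (\<lambda>f. \<chi> j. f j) ` ?P"
  proof
    fix w :: "int^'r" assume w: "w \<in> {w. \<forall>j. \<bar>w $ j\<bar> \<le> M}"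
    have "w = (\<chi> j. (\<lambda>j. w $ j) j)" by simp
    moreover have "(\<lambda>j. w $ j) \<in> ?P" using w by (auto simp: abs_le_iff minus_le_iff)
    ultimately show "w \<in> (\<lambda>f. \<chi> j. f j) ` ?P" by blast
  qed
  have finP: "finite ?P" by (intro finite_PiE) auto
  show "finite {w :: int^'r. \<forall>j. \<bar>w $ j\<bar> \<le> M}" using sub finP finite_surj by blast
  have "card {w :: int^'r. \<forall>j. \<bar>w $ j\<bar> \<le> M} \<le> card ?P" by (rule surj_card_le[OF finP sub])
  also have "\<dots> = nat (2 * M + 1) ^ CARD('r)" using assms by (simp add: card_PiE)
  finally show "card {w :: int^'r. \<forall>j. \<bar>w $ j\<bar> \<le> M} \<le> nat (2 * M + 1) ^ CARD('r)" .
qed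

text \<open>
  Up to constants, the vectors \<open>w\<close> contribute \<open>M\<^sup>r\<close>, and the two exponents of each of the \<open>s\<close> factors contribute
  \<open>M\<^sup>2\<close>.
\<close>

lemma tetra_products_finite_card:
  fixes A B :: "int^'s^'r"
  assumes "0 \<le> M"
  shows "finite (tetra_products A B v M)"
    "card (tetra_products A B v M) \<le> 2 ^ CARD('s) * nat (2 * M + 1) ^ (CARD('s + 's) + CARD('r))"
proof -
  let ?X = "{w :: int^'r. \<forall>j. \<bar>w $ j\<bar> \<le> M} \<times> ((UNIV :: 's set) \<rightarrow>\<^sub>E tetra_generators M)"
  have finX: "finite ?X" using finite_card_box(1)[OF assms] by (intro finite_cartesian_product finite_PiE) (auto simp: finite_tetra_generators)
  show "finite (tetra_products A B v M)" unfolding tetra_products_def by (intro finite_imageI finX)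
  have "card (tetra_products A B v M) \<le> card ?X" unfolding tetra_products_def by (rule card_image_le[OF finX])
  also have "\<dots> = card {w :: int^'r. \<forall>j. \<bar>w $ j\<bar> \<le> M} * card (tetra_generators M) ^ CARD('s)"
    by (simp add: card_cartesian_product card_PiE)
  also have "\<dots> \<le> nat (2 * M + 1) ^ CARD('r) * (2 * nat (2 * M + 1) ^ 2) ^ CARD('s)"
    by (intro mult_mono power_mono finite_card_box(2) card_tetra_generators assms) auto
  also have "\<dots> = 2 ^ CARD('s) * nat (2 * M + 1) ^ (CARD('s + 's) + CARD('r))"
  proof -
    have "(nat (2 * M + 1) ^ 2) ^ CARD('s) = nat (2 * M + 1) ^ CARD('s + 's)"
      unfolding power_mult[symmetric] by (rule arg_cong[of _ _ "\<lambda>e. _ ^ e"]) simp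
    thus ?thesis by (simp only: power_mult_distrib power_add mult_ac)
  qed
  finally show "card (tetra_products A B v M) \<le> 2 ^ CARD('s) * nat (2 * M + 1) ^ (CARD('s + 's) + CARD('r))" .
qed

text \<open>
  Expand each factor in its generators and multiply out. The constant \<open>8 + 6 * entry_bound A B\<close> is what
  \<open>tetra_monomial_in_span\<close> requires: exponents are at most \<open>N\<close>, shifts at most \<open>(1 + entry_bound A B) * N\<close>,
  and \<open>2 N + 6 (1 + entry_bound A B) N\<close> is the sum of both exponents and three times both shifts.
\<close>

lemma summand_monomial_in_span:
  fixes A B :: "int^'s^'r" and a b :: "nat^('s + 's)" and d :: "nat^'r"
  assumes N: "\<And>j. a $ j \<le> N" "\<And>j. b $ j \<le> N" "\<And>j. d $ j \<le> N"
    and M: "M = (8 + 6 * entry_bound A B) * int N"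
  shows "summand_monomial A B v a b d \<in> q_fun.span (tetra_products A B v M)"
proof -
  define c1 where "c1 i = int (b $ Inl i) - int_dot (column i B) (int_vec d)" for i
  define c2 where "c2 i = int (b $ Inr i) + int_dot (column i A) (int_vec d)" for i
  define u where "u i = tetra_monomial (int (a $ Inl i)) (int (a $ Inr i)) (c1 i) (c2 i)" for i
  define EB where "EB = entry_bound A B * int N"
  have EB0: "0 \<le> EB" unfolding EB_def by (intro mult_nonneg_nonneg entry_bound_nonneg) auto
  have M': "M = 8 * int N + 6 * EB" by (simp add: M EB_def algebra_simps)
  have "u i \<in> tetra_span M" for i
  proof -
    have "\<bar>int_dot (column i A) (int_vec d)\<bar> \<le> EB" "\<bar>int_dot (column i B) (int_vec d)\<bar> \<le> EB"
      unfolding EB_def by (rule column_dot_bound; use N(3) in simp)+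
    hence "\<bar>c1 i\<bar> \<le> int N + EB" "\<bar>c2 i\<bar> \<le> int N + EB"
      using N(2)[of "Inl i"] N(2)[of "Inr i"] unfolding c1_def c2_def by linarith+
    hence "\<bar>int (a $ Inl i)\<bar> + \<bar>int (a $ Inr i)\<bar> + 3 * \<bar>c1 i\<bar> + 3 * \<bar>c2 i\<bar> \<le> M"
      using N(1)[of "Inl i"] N(1)[of "Inr i"] unfolding M' by linarith
    from tetra_span_mono[OF this] show ?thesis using tetra_monomial_in_span unfolding u_def by blast
  qed
  hence "\<forall>i. \<exists>K. u i = (\<Sum>f\<in>tetra_generators M. q_scale (K f) f)"
    unfolding q_fun.span_finite[OF finite_tetra_generators] by blast
  from choice[OF this] obtain K where K: "\<And>i. u i = (\<Sum>f\<in>tetra_generators M. q_scale (K i f) f)" by blast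
  let ?P = "(UNIV :: 's set) \<rightarrow>\<^sub>E tetra_generators M"
  have expand: "(\<Prod>i\<in>UNIV. u i (p i)) =
      (\<Sum>c\<in>?P. fls_of_fract (\<Prod>i\<in>UNIV. K i (c i)) * (\<Prod>i\<in>UNIV. c i (p i)))" for p
  proof -
    have "(\<Prod>i\<in>UNIV. u i (p i)) = (\<Prod>i\<in>UNIV. \<Sum>f\<in>tetra_generators M. fls_of_fract (K i f) * f (p i))"
      unfolding K by (simp add: fun_sum_apply q_scale_def)
    also have "\<dots> = (\<Sum>c\<in>?P. \<Prod>i\<in>UNIV. fls_of_fract (K i (c i)) * c i (p i))"
      by (rule prod_sum_PiE) (auto simp: finite_tetra_generators)
    finally show ?thesis by (simp add: prod.distrib fls_of_fract_prod)
  qed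
  define w where "w = weight A B a"
  have "summand_monomial A B v a b d =
      (\<Sum>c\<in>?P. q_scale (qscalar (int_dot v (int_vec d)) * (\<Prod>i\<in>UNIV. K i (c i))) (tetra_product A B v w c))"
  proof (rule ext, safe)
    fix k x
    have "summand_monomial A B v a b d (k, x) = Xpow (int_dot v (int_vec d)) *
       (Xpow (int_dot (v - w) k) * (\<Prod>i\<in>UNIV. u i (tetra_args A B k x i)))"
      unfolding summand_monomial_factor w_def u_def c1_def c2_def ..
    also have "\<dots> = (\<Sum>c\<in>?P. q_scale (qscalar (int_dot v (int_vec d)) * (\<Prod>i\<in>UNIV. K i (c i))) (tetra_product A B v w c)) (k, x)"
      unfolding expand fun_sum_apply sum_distrib_left
      by (simp add: q_scale_def tetra_product_def fls_of_fract_mult mult_ac)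
    finally show "summand_monomial A B v a b d (k, x) =
      (\<Sum>c\<in>?P. q_scale (qscalar (int_dot v (int_vec d)) * (\<Prod>i\<in>UNIV. K i (c i))) (tetra_product A B v w c)) (k, x)" .
  qed
  moreover have "tetra_product A B v w c \<in> q_fun.span (tetra_products A B v M)" if "c \<in> ?P" for c
  proof (rule q_fun.span_base)
    have "\<bar>w $ j\<bar> \<le> M" for j
      using weight_bound[of a N A B j, OF N(1)] EB0 unfolding w_def M' EB_def[symmetric] by simp
    thus "tetra_product A B v w c \<in> tetra_products A B v M"
      unfolding tetra_products_def using that by (intro image_eqI[of _ _ "(w, c)"]) auto
  qed
  ultimately show ?thesis by (simp only:) (intro q_fun.span_sum q_fun.span_scale)
qed

abbreviation vec_total :: "nat^'n \<Rightarrow> nat" where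
  "vec_total a \<equiv> (\<Sum>j\<in>UNIV. a $ j)"

definition summand_monomials :: "int^'s^'r \<Rightarrow> int^'s^'r \<Rightarrow> int^'r \<Rightarrow> nat \<Rightarrow> ('r, int^('s + 's)) fam set" where
  "summand_monomials A B v N = {summand_monomial A B v a b d | a b d.
     vec_total a + vec_total b + vec_total d \<le> N}"

lemma summand_monomials_subset_span:
  "summand_monomials A B v N \<subseteq> q_fun.span (tetra_products A B v ((8 + 6 * entry_bound A B) * int N))"
proof
  fix g assume "g \<in> summand_monomials A B v N"
  then obtain a b d where g: "g = summand_monomial A B v a b d"
    "vec_total a + vec_total b + vec_total d \<le> N"
    by (auto simp: summand_monomials_def)
  have "a $ j \<le> vec_total a" "b $ j \<le> vec_total b" "d $ i \<le> vec_total d" for i j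
    by (rule member_le_sum; simp)+
  hence "a $ j \<le> N" "b $ j \<le> N" "d $ i \<le> N" for i j
    using g(2) by (meson add_leD1 add_leD2 le_trans)+
  thus "g \<in> q_fun.span (tetra_products A B v ((8 + 6 * entry_bound A B) * int N))"
    unfolding g(1) by (intro summand_monomial_in_span) auto
qed

lemma dim_summand_monomials:
  fixes A B :: "int^'s^'r"
  shows "\<exists>C. \<forall>N. q_fun.dim (q_fun.span (summand_monomials A B v N)) \<le> C * (N + 1) ^ (CARD('s + 's) + CARD('r))"
proof -
  define L where "L = 8 + 6 * entry_bound A B"
  have L: "0 \<le> L" using entry_bound_nonneg[of A B] by (simp add: L_def)
  let ?p = "CARD('s + 's) + CARD('r)"
  have "q_fun.dim (q_fun.span (summand_monomials A B v N)) \<le> (2 ^ CARD('s) * nat (2 * L + 1) ^ ?p) * (N + 1) ^ ?p" for N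
  proof -
    have M: "0 \<le> L * int N" using L by simp
    have "q_fun.dim (q_fun.span (summand_monomials A B v N)) \<le> card (tetra_products A B v (L * int N))"
      unfolding q_fun.dim_span
      by (intro q_fun.dim_le_card summand_monomials_subset_span[of A B v N, folded L_def] tetra_products_finite_card M)
    also have "\<dots> \<le> 2 ^ CARD('s) * nat (2 * (L * int N) + 1) ^ ?p"
      by (rule tetra_products_finite_card(2)[OF M])
    also have "\<dots> \<le> 2 ^ CARD('s) * (nat (2 * L + 1) * (N + 1)) ^ ?p"
    proof (intro mult_left_mono power_mono)
      have "2 * (L * int N) + 1 \<le> (2 * L + 1) * (int N + 1)" using L by (simp add: algebra_simps)
      hence "nat (2 * (L * int N) + 1) \<le> nat ((2 * L + 1) * (int N + 1))" by (rule nat_mono)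
      also have "\<dots> = nat (2 * L + 1) * (N + 1)" using L by (simp add: nat_mult_distrib nat_add_distrib)
      finally show "nat (2 * (L * int N) + 1) \<le> nat (2 * L + 1) * (N + 1)" .
    qed auto
    finally show ?thesis by (simp only: power_mult_distrib mult.assoc)
  qed
  thus ?thesis by blast
qed

section \<open>Holonomicity of the lattice sum\<close>

lemma locally_finite_to_rat: "locally_finite g K \<Longrightarrow> locally_finite (\<lambda>k. to_rat (g k)) K"
  unfolding locally_finite_def rat_fls_of_int_fls_nth of_int_eq_0_iff .

lemma summand_monomial_locfin:
  assumes conv: "\<And>m e. locally_finite (index_summand A B v m e) UNIV"
  shows "summand_monomial A B v a b d \<in> locfin_fams"
proof -
  have 1: "locally_finite (\<lambda>k. to_rat (index_summand A B v m e k)) UNIV" for m e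
    by (rule locally_finite_to_rat[OF conv])
  have 2: "locally_finite (\<lambda>k. summand_fam A B v (k, y)) UNIV" for y
    unfolding summand_fam_def prod.case by (rule 1)
  have 3: "locally_finite (\<lambda>k. summand_fam A B v (int_vec d + k, y)) UNIV" for y
    by (rule locally_finite_reindex[OF bij_betw_add_left 2])
  have "(\<lambda>k. summand_monomial A B v a b d (k, x)) =
      (\<lambda>k. Xpow (int_dot (int_vec a) x) * summand_fam A B v (int_vec d + k, x + int_vec b))" for x
    unfolding summand_monomial_def prod.case by (simp only: add.commute[of _ "int_vec d"])
  hence "locally_finite (\<lambda>k. summand_monomial A B v a b d (k, x)) UNIV" for x
    using locally_finite_cmult[OF 3] by metis
  thus ?thesis unfolding locfin_fams_def by simp
qed

lemma int_vec_add_axis: "int_vec (d + axis j 1) = int_vec d + axis j 1"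
  by (simp add: vec_eq_iff axis_def)

lemma shift_k_summand_monomial: "shift_k j (summand_monomial A B v a b d) = summand_monomial A B v a b (d + axis j 1)"
proof (rule ext, safe)
  fix k x
  have "k + axis j 1 + int_vec d = k + int_vec (d + axis j 1)"
    unfolding int_vec_add_axis add.assoc by (subst add.commute[of "axis j 1"]) (rule refl)
  thus "shift_k j (summand_monomial A B v a b d) (k, x) = summand_monomial A B v a b (d + axis j 1) (k, x)"
    unfolding shift_k_def summand_monomial_def prod.case by (rule arg_cong)
qed

lemma vec_total_add_axis: "vec_total (d + axis j 1) = Suc (vec_total d)" for d :: "nat^'n"
proof -
  have "(\<Sum>i\<in>UNIV. (axis j (1::nat) :: nat^'n) $ i) = (\<Sum>i\<in>UNIV. if i = j then 1 else 0)"
    by (intro sum.cong) (auto simp: axis_def)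
  thus ?thesis by (simp add: sum.distrib)
qed

text \<open>
  Summation over all of \<open>k\<close> turns monomials of the summand into the same monomials of the index, since
  operators in the parameters commute with summation over \<open>k\<close>.
\<close>

lemma sum_out_summand_monomial:
  fixes A B :: "int^'s^'r"
  assumes conv: "\<And>m e. locally_finite (index_summand A B v m e) UNIV"
  shows "sum_out UNIV (summand_monomial A B v a b 0) (0, x) = op_monomial a b (index_function A B v) x"
proof -
  let ?x = "x + int_vec b"
  define m where "m = (\<chi> i. ?x $ Inl i)"
  define e where "e = (\<chi> i. ?x $ Inr i)"
  have "adic_sums (index_summand A B v m e) UNIV (index_sum A B v m e)"
    unfolding index_sum_def by (rule adic_sums_infsum[OF conv])
  from adic_sums_cmult[OF adic_sums_to_rat[OF this], of "Xpow (int_dot (int_vec a) x)"]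
  have "adic_sums (\<lambda>k. Xpow (int_dot (int_vec a) x) * to_rat (index_summand A B v m e k)) UNIV
          (Xpow (int_dot (int_vec a) x) * index_function A B v ?x)"
    unfolding index_function_def m_def e_def .
  moreover have "int_vec (0 :: nat^'r) = 0" by (simp add: vec_eq_iff)
  hence "summand_monomial A B v a b 0 (k, x) = Xpow (int_dot (int_vec a) x) * to_rat (index_summand A B v m e k)" for k
    unfolding summand_monomial_def summand_fam_def m_def e_def by simp
  ultimately have "adic_sums (\<lambda>k. summand_monomial A B v a b 0 (k, x)) UNIV (Xpow (int_dot (int_vec a) x) * index_function A B v ?x)"
    by (simp only:)
  moreover have "adic_sums (\<lambda>k. summand_monomial A B v a b 0 (k, x)) UNIV (sum_out UNIV (summand_monomial A B v a b 0) (0, x))"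
    using adic_sums_sum_out[OF summand_monomial_locfin[OF conv], where k = 0 and x = x and J = UNIV] by (simp add: coord_lattice_def)
  ultimately have "sum_out UNIV (summand_monomial A B v a b 0) (0, x) = Xpow (int_dot (int_vec a) x) * index_function A B v ?x"
    by (rule adic_sums_unique[rotated])
  thus ?thesis by (simp add: op_monomial_def Xpow_def int_dot_def int_vec_def)
qed

theorem index_function_q_holonomic:
  fixes A B :: "int^'s^'r"
  assumes conv: "\<And>m e. locally_finite (index_summand A B v m e) UNIV"
  shows "q_holonomic (index_function A B v)"
proof -
  define U where "U N = q_fun.span (summand_monomials A B v N)" for N
  let ?p = "CARD('s + 's) + CARD('r)"
  have locfin: "U N \<subseteq> locfin_fams" for N
    unfolding U_def using summand_monomial_locfin[OF conv]
    by (intro q_fun.span_minimal subspace_locfin_fams) (auto simp: summand_monomials_def)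
  have finU: "\<exists>T. finite T \<and> U N \<subseteq> q_fun.span T" for N
  proof (intro exI conjI)
    let ?M = "(8 + 6 * entry_bound A B) * int N"
    show "finite (tetra_products A B v ?M)"
      using entry_bound_nonneg[of A B] by (intro tetra_products_finite_card mult_nonneg_nonneg) auto
    show "U N \<subseteq> q_fun.span (tetra_products A B v ?M)"
      unfolding U_def by (intro q_fun.span_minimal summand_monomials_subset_span q_fun.subspace_span)
  qed
  obtain C where C: "\<And>N. q_fun.dim (U N) \<le> C * (N + 1) ^ ?p"
    using dim_summand_monomials[of A B v] unfolding U_def by blast
  have "\<exists>C'. \<forall>N. q_fun.dim (sum_out UNIV ` U N) * (N + 1) ^ card (UNIV :: 'r set) \<le> C' * (N + 1) ^ ?p"
  proof (rule sum_out_growth[OF _ locfin finU _ _ C])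
    show "q_fun.subspace (U N)" for N unfolding U_def by (rule q_fun.subspace_span)
    show "U N \<subseteq> U (Suc N)" for N
      unfolding U_def summand_monomials_def by (rule q_fun.span_mono) force
    show "shift_k j ` U N \<subseteq> U (Suc N)" for N j
    proof -
      have "shift_k j ` summand_monomials A B v N \<subseteq> summand_monomials A B v (Suc N)"
      proof safe
        fix g assume "g \<in> summand_monomials A B v N"
        then obtain a b d where g: "g = summand_monomial A B v a b d"
          "vec_total a + vec_total b + vec_total d \<le> N"
          by (auto simp: summand_monomials_def)
        show "shift_k j g \<in> summand_monomials A B v (Suc N)"
          unfolding summand_monomials_def g(1) shift_k_summand_monomial using g(2) vec_total_add_axis[of d j]
          by (intro CollectI exI[of _ a] exI[of _ b] exI[of _ "d + axis j 1"]) auto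
      qed
      thus ?thesis unfolding U_def q_pair.linear_span_image[OF linear_shift_k, symmetric]
        by (rule q_fun.span_mono)
    qed
  qed
  then obtain C' where "\<And>N. q_fun.dim (sum_out UNIV ` U N) * (N + 1) ^ CARD('r) \<le> C' * (N + 1) ^ ?p"
    by blast
  hence C': "q_fun.dim (sum_out UNIV ` U N) \<le> C' * (N + 1) ^ CARD('s + 's)" for N
    by (simp add: power_add mult.assoc[symmetric] del: card_sum)
  define restr where "restr w = (\<lambda>x. w (0, x))" for w :: "('r, int^('s + 's)) fam"
  have lin_restr: "linear_on_space q_scale q_scale W restr" for W
    by (auto simp: linear_on_space_def restr_def q_scale_def)
  let ?F = "\<lambda>N. {op_monomial a b (index_function A B v) | a b.
        vec_total a + vec_total b \<le> N}"
  have bound: "q_fun.dim (q_fun.span (?F N)) \<le> C' * (N + 1) ^ CARD('s + 's)" for N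
  proof -
    have lin: "linear_on_space q_scale q_scale (U N) (sum_out UNIV)"
      by (rule linear_on_space_subset[OF linear_on_sum_out locfin])
    have sub: "q_fun.subspace (U N)" unfolding U_def by (rule q_fun.subspace_span)
    define V where "V = sum_out UNIV ` U N"
    have subV: "q_fun.subspace V"
      unfolding V_def by (rule q_pair.linear_on_space_image_subspace[OF sub lin])
    obtain T where T: "finite T" "U N \<subseteq> q_fun.span T" using finU by blast
    obtain T' where T': "finite T'" "V \<subseteq> q_fun.span T'"
      using q_pair.linear_on_space_image_finite_span[OF sub lin T] unfolding V_def by blast
    obtain T'' where T'': "finite T''" "restr ` V \<subseteq> q_fun.span T''"
      using q_pair.linear_on_space_image_finite_span[OF subV lin_restr T'] by blast
    \<comment> \<open>Evaluation at \<open>k = 0\<close> loses nothing, because fully summed families do not depend on \<open>k\<close>.\<close>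
    have "?F N \<subseteq> restr ` V"
    proof safe
      fix a b :: "nat^('s + 's)" assume ab: "vec_total a + vec_total b \<le> N"
      have "op_monomial a b (index_function A B v) = restr (sum_out UNIV (summand_monomial A B v a b 0))"
        using sum_out_summand_monomial[OF conv] by (auto simp: restr_def)
      moreover have "summand_monomial A B v a b 0 \<in> U N"
        unfolding U_def summand_monomials_def using ab
        by (intro q_fun.span_base CollectI exI[of _ a] exI[of _ b] exI[of _ 0]) auto
      ultimately show "op_monomial a b (index_function A B v) \<in> restr ` V"
        unfolding V_def by blast
    qed
    hence "q_fun.dim (?F N) \<le> q_fun.dim (restr ` V)"
      by (rule q_fun.dim_mono_finite_span[OF T''])
    also have "\<dots> \<le> q_fun.dim V"
      by (rule q_pair.dim_image_le_on[OF subV lin_restr T'])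
    also have "\<dots> \<le> C' * (N + 1) ^ CARD('s + 's)" unfolding V_def by (rule C')
    finally show ?thesis by (simp only: q_fun.dim_span)
  qed
  show ?thesis
    unfolding q_holonomic_def
  proof (rule bigoI[of _ "real (C' * 2 ^ CARD('s + 's))"], rule eventually_mono[OF eventually_ge_at_top[of "1::nat"]])
    fix N :: nat assume N: "1 \<le> N"
    have "q_fun.dim (q_fun.span (?F N)) \<le> C' * (N + 1) ^ CARD('s + 's)" by (rule bound)
    also have "\<dots> \<le> C' * (2 * N) ^ CARD('s + 's)" using N by (intro mult_left_mono power_mono) auto
    finally have "real (q_fun.dim (q_fun.span (?F N))) \<le> real (C' * (2 * N) ^ CARD('s + 's))"
      by (simp only: of_nat_le_iff)
    also have "\<dots> = real (C' * 2 ^ CARD('s + 's)) * real N ^ CARD('s + 's)"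
      by (simp add: power_mult_distrib)
    finally show "norm (real (q_fun.dim (q_fun.span (?F N)))) \<le>
        real (C' * 2 ^ CARD('s + 's)) * norm (real N ^ CARD('s + 's))"
      by simp
  qed
qed

theorem theorem2p4:
  fixes A B :: "int^'s^'r" and v :: "int^'r"
  shows "((\<forall>m e. laurent_sum_converges (index_summand A B v m e) UNIV)
            \<longleftrightarrow> supports_index_structure A B v)
       \<and> (supports_index_structure A B v \<longrightarrow> q_holonomic (index_function A B v))"
  using converges_iff_supports[of A B v] index_function_q_holonomic[of A B v]
  unfolding laurent_sum_converges_iff_locally_finite by blast

end
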